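(* Assume that large integers can be factored efficiently. Then there is an efficient algorithm which, given any prime $p$ and any matrix $M\in SL_2(p)$, writes $M$ as a word of length $O((\log p)^2)$ in the two matrices $$A=\begin{pmatrix}1&1\\0&1\end{pmatrix},\qquad B=\begin{pmatrix}1&0\\1&1\end{pmatrix},$$ that is, it outputs a finite sequence $g_1,\dots,g_m\in\{A,B\}$ with $g_1g_2\cdots g_m=M$ in $SL_2(p)$ and $m=O((\log p)^2)$, where the implied constant is absolute (independent of $p$ and $M$). In other words, under this assumption, Zémor's Cayley hash function is not preimage resistant.
   Context: $SL_2(p)$ is the group of $2\times 2$ matrices of determinant $1$ with entries in the integers modulo the prime $p$; $A$ and $B$ are regarded as elements of $SL_2(p)$ by reduction modulo $p$. A word in a set of matrices is a finite string of matrices from that set; its length is the number of letters (with multiplicity), and its product is the product of its letters in order. To write (factor) $M$ as a word means to find a word whose product is $M$. Zémor's Cayley hash function sends a finite string over the alphabet $\{A,B\}$ to the product of its letters, in order, in $SL_2(p)$. It is preimage resistant if it is computationally infeasible to find a message with a given hash; breaking preimage resistance means giving an efficient algorithm which, given a prime $p$ and $M\in SL_2(p)$, finds a short word in $A$ and $B$ whose product is $M$. "Efficient" means in (expected) time polynomial in the bit length of the input; algorithms are allowed to be randomized. The assumption is that there is an efficient procedure returning the prime factorization of a given integer. *)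

theory Defs
  imports
    "HOL-Probability.Probability"
    "HOL-Algebra.Group"
    "HOL-Computational_Algebra.Primes"
    "HOL-Computational_Algebra.Polynomial"
    "HOL-Number_Theory.Cong"
    "HOL-Library.Log_Nat"
begin

section \<open>Randomized programs and their running time\<close>

text \<open>
  The model of computation is a randomized random access machine with the logarithmic cost
  measure, presented as a while language. A program has number registers, which hold natural
  numbers, and stacks of natural numbers. It has arithmetic on registers, fair coin flips, and
  calls of (closed, non-recursive) subroutines. Every instruction is charged for the bit lengths
  of all numbers it handles, so up to a polynomial the cost is the number of steps of a
  probabilistic Turing machine.
\<close>

datatype binop = Add | Sub | Mul | Div | Mod | Less | Equal

datatype expr =
    Const nat
  | Reg nat
  | IsEmpty nat
  | Bin binop expr expr

datatype prog =
    Skip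
  | Assign nat expr
  | Flip nat
  | Push nat expr
  | Pop nat nat
  | Seq prog prog
  | Ite expr prog prog
  | While expr prog
  | Call prog nat nat

record config =
  num :: "nat \<Rightarrow> nat"
  stk :: "nat \<Rightarrow> nat list"
  time :: nat

primrec binop_val :: "binop \<Rightarrow> nat \<Rightarrow> nat \<Rightarrow> nat" where
  "binop_val Add m n = m + n"
| "binop_val Sub m n = m - n"
| "binop_val Mul m n = m * n"
| "binop_val Div m n = m div n"
| "binop_val Mod m n = m mod n"
| "binop_val Less m n = of_bool (m < n)"
| "binop_val Equal m n = of_bool (m = n)"

primrec eval_expr :: "expr \<Rightarrow> config \<Rightarrow> nat" where
  "eval_expr (Const n) \<sigma> = n"
| "eval_expr (Reg x) \<sigma> = num \<sigma> x"
| "eval_expr (IsEmpty k) \<sigma> = of_bool (stk \<sigma> k = [])"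
| "eval_expr (Bin f a b) \<sigma> = binop_val f (eval_expr a \<sigma>) (eval_expr b \<sigma>)"

definition bit_length :: "nat \<Rightarrow> nat" where
  "bit_length n = floorlog 2 n"

definition list_size :: "nat list \<Rightarrow> nat" where
  "list_size xs = (\<Sum>n\<leftarrow>xs. 1 + bit_length n)"

text \<open>The cost of a node covers its value, hence also every intermediate result.\<close>

primrec cost_expr :: "expr \<Rightarrow> config \<Rightarrow> nat" where
  "cost_expr (Const n) \<sigma> = 1 + bit_length n"
| "cost_expr (Reg x) \<sigma> = 1 + bit_length (num \<sigma> x)"
| "cost_expr (IsEmpty k) \<sigma> = 1"
| "cost_expr (Bin f a b) \<sigma> =
     1 + cost_expr a \<sigma> + cost_expr b \<sigma> + bit_length (eval_expr (Bin f a b) \<sigma>)"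

definition tick :: "nat \<Rightarrow> config \<Rightarrow> config" where
  "tick n \<sigma> = \<sigma>\<lparr>time := time \<sigma> + n\<rparr>"

definition set_num :: "nat \<Rightarrow> nat \<Rightarrow> config \<Rightarrow> config" where
  "set_num x n \<sigma> = \<sigma>\<lparr>num := (num \<sigma>)(x := n)\<rparr>"

definition set_stk :: "nat \<Rightarrow> nat list \<Rightarrow> config \<Rightarrow> config" where
  "set_stk k xs \<sigma> = \<sigma>\<lparr>stk := (stk \<sigma>)(k := xs)\<rparr>"

text \<open>Input and output are on stack 0, the head of the list being the top of the stack.\<close>

definition init_config :: "nat list \<Rightarrow> config" where
  "init_config xs = \<lparr>num = (\<lambda>_. 0), stk = (\<lambda>_. [])(0 := xs), time = 0\<rparr>"

text \<open>Mass missing from the resulting subprobability distribution is divergence.\<close>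

partial_function (spmf) while_spmf :: "('s \<Rightarrow> bool) \<Rightarrow> ('s \<Rightarrow> 's spmf) \<Rightarrow> 's \<Rightarrow> 's spmf" where
  "while_spmf g b \<sigma> = (if g \<sigma> then bind_spmf (b \<sigma>) (while_spmf g b) else return_spmf \<sigma>)"

text \<open>
  Popping an empty stack yields 0. A condition holds if its value is nonzero; it is charged each
  time it is evaluated, including the last time in a loop. In \<open>Call c i j\<close>, the subroutine
  \<open>c\<close> runs on fresh registers and stacks with the contents of stack \<open>i\<close> as
  its input, and its output is stored in stack \<open>j\<close>.
\<close>

primrec exec :: "prog \<Rightarrow> config \<Rightarrow> config spmf" where
  "exec Skip \<sigma> = return_spmf (tick 1 \<sigma>)"
| "exec (Assign x a) \<sigma> =
     return_spmf (tick (1 + cost_expr a \<sigma>) (set_num x (eval_expr a \<sigma>) \<sigma>))"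
| "exec (Flip x) \<sigma> = map_spmf (\<lambda>b. tick 1 (set_num x (of_bool b) \<sigma>)) coin_spmf"
| "exec (Push k a) \<sigma> =
     return_spmf (tick (1 + cost_expr a \<sigma>) (set_stk k (eval_expr a \<sigma> # stk \<sigma> k) \<sigma>))"
| "exec (Pop x k) \<sigma> =
     (let n = (case stk \<sigma> k of [] \<Rightarrow> 0 | m # _ \<Rightarrow> m)
      in return_spmf (tick (1 + bit_length n) (set_num x n (set_stk k (tl (stk \<sigma> k)) \<sigma>))))"
| "exec (Seq c d) \<sigma> = bind_spmf (exec c \<sigma>) (exec d)"
| "exec (Ite a c d) \<sigma> =
     (if eval_expr a \<sigma> \<noteq> 0 then exec c else exec d) (tick (1 + cost_expr a \<sigma>) \<sigma>)"
| "exec (While a c) \<sigma> =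
     map_spmf (\<lambda>\<tau>. tick (1 + cost_expr a \<tau>) \<tau>)
       (while_spmf (\<lambda>\<tau>. eval_expr a \<tau> \<noteq> 0) (\<lambda>\<tau>. exec c (tick (1 + cost_expr a \<tau>) \<tau>)) \<sigma>)"
| "exec (Call c i j) \<sigma> =
     map_spmf
       (\<lambda>\<tau>. tick (1 + list_size (stk \<sigma> i) + time \<tau> + list_size (stk \<tau> 0)) (set_stk j (stk \<tau> 0) \<sigma>))
       (exec c (init_config (stk \<sigma> i)))"

definition run :: "prog \<Rightarrow> nat list \<Rightarrow> config spmf" where
  "run c xs = exec c (init_config xs)"

definition result :: "config \<Rightarrow> nat list" where
  "result \<sigma> = stk \<sigma> 0"

definition expected_time :: "prog \<Rightarrow> nat list \<Rightarrow> ennreal" where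
  "expected_time c xs = (\<integral>\<^sup>+ \<sigma>. of_nat (time \<sigma>) \<partial>measure_spmf (run c xs))"

text \<open>
  The search problem with instances \<open>I\<close> and answer relation \<open>R\<close> is efficiently solvable
  (with respect to encodings of instances and answers) if one randomized program halts almost
  surely on every instance, never returns a wrong answer, and has expected running time
  polynomial in the bit length of the instance.
\<close>

definition efficiently_solvable ::
  "'i set \<Rightarrow> ('i \<Rightarrow> nat list) \<Rightarrow> ('a \<Rightarrow> nat list) \<Rightarrow> ('i \<Rightarrow> 'a \<Rightarrow> bool) \<Rightarrow> bool" where
  "efficiently_solvable I enc_in enc_out R \<longleftrightarrow>
    (\<exists>(c :: prog) (q :: nat poly). \<forall>i\<in>I.
       lossless_spmf (run c (enc_in i)) \<and>
       (\<forall>\<sigma>\<in>set_spmf (run c (enc_in i)). \<exists>a. result \<sigma> = enc_out a \<and> R i a) \<and>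
       expected_time c (enc_in i) \<le> of_nat (poly q (list_size (enc_in i))))"

definition factoring_efficient :: bool where
  "factoring_efficient \<longleftrightarrow>
     efficiently_solvable {n :: nat. n > 0} (\<lambda>n. [n]) (\<lambda>qs. qs)
       (\<lambda>n qs. mset qs = prime_factorization n)"


section \<open>The group $SL_2(p)$ and the hash function\<close>

text \<open>Residues modulo \<open>p\<close> are represented by the integers in \<open>{0..<p}\<close>.\<close>

definition mat_mod :: "nat \<Rightarrow> int^2^2 \<Rightarrow> int^2^2" where
  "mat_mod p M = (\<chi> i j. M $ i $ j mod int p)"

definition SL2 :: "nat \<Rightarrow> (int^2^2) monoid" where
  "SL2 p = \<lparr>carrier = {M. (\<forall>i j. M $ i $ j \<in> {0..<int p}) \<and> [det M = 1] (mod int p)},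
            mult = (\<lambda>M N. mat_mod p (M ** N)), one = mat_mod p (mat 1)\<rparr>"

definition A_mat :: "int^2^2" where
  "A_mat = vector [vector [1, 1], vector [0, 1]]"

definition B_mat :: "int^2^2" where
  "B_mat = vector [vector [1, 0], vector [1, 1]]"

datatype letter = LA | LB

primrec letter_mat :: "letter \<Rightarrow> int^2^2" where
  "letter_mat LA = A_mat"
| "letter_mat LB = B_mat"

definition zemor_hash :: "nat \<Rightarrow> letter list \<Rightarrow> int^2^2" where
  "zemor_hash p w =
     foldr (\<lambda>x N. mat_mod p (letter_mat x) \<otimes>\<^bsub>SL2 p\<^esub> N) w \<one>\<^bsub>SL2 p\<^esub>"

definition hash_instances :: "(nat \<times> (int^2^2)) set" where
  "hash_instances = {(p, M). prime p \<and> M \<in> carrier (SL2 p)}"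

fun enc_instance :: "nat \<times> (int^2^2) \<Rightarrow> nat list" where
  "enc_instance (p, M) =
     [p, nat (M $ 1 $ 1), nat (M $ 1 $ 2), nat (M $ 2 $ 1), nat (M $ 2 $ 2)]"

primrec enc_letter :: "letter \<Rightarrow> nat" where
  "enc_letter LA = 0"
| "enc_letter LB = 1"

definition word_problem_efficient :: "(nat \<Rightarrow> real) \<Rightarrow> bool" where
  "word_problem_efficient L \<longleftrightarrow>
     efficiently_solvable hash_instances enc_instance (map enc_letter)
       (\<lambda>(p, M) w. zemor_hash p w = M \<and> real (length w) \<le> L p)"

text \<open>Short messages are those of length polynomial in the bit length of \<open>p\<close>.\<close>

definition zemor_preimage_resistant :: bool where
  "zemor_preimage_resistant \<longleftrightarrow>
     \<not> (\<exists>q :: nat poly. word_problem_efficient (\<lambda>p. real (poly q (bit_length p))))"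


section \<open>Basic facts\<close>

lemma mat_mod_nth [simp]: "mat_mod p M $ i $ j = M $ i $ j mod int p"
  by (simp add: mat_mod_def)

lemma mat_mod_mult_left: "mat_mod p (mat_mod p M ** N) = mat_mod p (M ** N)"
proof -
  have "(a mod q * b + c mod q * d) mod q = (a * b + c * d) mod q" for a b c d q :: int
    by (intro mod_add_cong mod_mult_left_eq)
  then show ?thesis
    by (simp add: vec_eq_iff matrix_matrix_mult_def sum_2)
qed

lemma mat_mod_mult_right: "mat_mod p (M ** mat_mod p N) = mat_mod p (M ** N)"
proof -
  have "(a * (b mod q) + c * (d mod q)) mod q = (a * b + c * d) mod q" for a b c d q :: int
    by (intro mod_add_cong mod_mult_right_eq)
  then show ?thesis
    by (simp add: vec_eq_iff matrix_matrix_mult_def sum_2)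
qed

lemma mat_mod_id: "M \<in> carrier (SL2 p) \<Longrightarrow> mat_mod p M = M"
  by (simp add: SL2_def vec_eq_iff)

lemma det_mat_mod: "[det (mat_mod p M) = det M] (mod int p)"
  unfolding det_2 mat_mod_nth
  by (intro cong_diff cong_mult) (simp_all add: cong_def)

lemma mat_mod_in_SL2: "p > 0 \<Longrightarrow> [det M = 1] (mod int p) \<Longrightarrow> mat_mod p M \<in> carrier (SL2 p)"
  using cong_trans[OF det_mat_mod] by (auto simp: SL2_def)

lemma letter_mat_in_SL2: "p > 0 \<Longrightarrow> mat_mod p (letter_mat x) \<in> carrier (SL2 p)"
  by (cases x) (auto intro!: mat_mod_in_SL2 simp: det_2 A_mat_def B_mat_def)

lemma group_SL2:
  assumes "p > 0"
  shows "group (SL2 p)"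
proof (rule groupI)
  show "\<one>\<^bsub>SL2 p\<^esub> \<in> carrier (SL2 p)"
    using mat_mod_in_SL2[OF assms, of "mat 1"] by (simp add: SL2_def)
next
  fix M N assume "M \<in> carrier (SL2 p)" "N \<in> carrier (SL2 p)"
  then have "[det (M ** N) = 1] (mod int p)"
    using cong_mult[of "det M" 1 "int p" "det N" 1] by (simp add: SL2_def det_mul)
  then show "M \<otimes>\<^bsub>SL2 p\<^esub> N \<in> carrier (SL2 p)"
    using mat_mod_in_SL2[OF assms] by (simp add: SL2_def)
next
  fix M N P
  show "M \<otimes>\<^bsub>SL2 p\<^esub> N \<otimes>\<^bsub>SL2 p\<^esub> P = M \<otimes>\<^bsub>SL2 p\<^esub> (N \<otimes>\<^bsub>SL2 p\<^esub> P)"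
    by (simp add: SL2_def mat_mod_mult_left mat_mod_mult_right matrix_mul_assoc)
next
  fix M assume "M \<in> carrier (SL2 p)"
  from mat_mod_id[OF this] show "\<one>\<^bsub>SL2 p\<^esub> \<otimes>\<^bsub>SL2 p\<^esub> M = M"
    by (simp add: SL2_def mat_mod_mult_left)
next
  fix M assume M: "M \<in> carrier (SL2 p)"
  define N :: "int^2^2" where
    "N = vector [vector [M $ 2 $ 2, - (M $ 1 $ 2)], vector [- (M $ 2 $ 1), M $ 1 $ 1]]"
  have "det N = det M"
    by (simp add: N_def det_2 algebra_simps)
  with M have "mat_mod p N \<in> carrier (SL2 p)"
    by (intro mat_mod_in_SL2[OF assms]) (simp add: SL2_def)
  moreover have "N ** M = mat (det M)"
    by (simp add: vec_eq_iff forall_2 matrix_matrix_mult_def sum_2 N_def det_2 mat_def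
        algebra_simps)
  then have "mat_mod p (N ** M) = mat_mod p (mat 1)"
    using M by (simp add: SL2_def vec_eq_iff forall_2 mat_def cong_def)
  then have "mat_mod p N \<otimes>\<^bsub>SL2 p\<^esub> M = \<one>\<^bsub>SL2 p\<^esub>"
    by (simp add: SL2_def mat_mod_mult_left)
  ultimately show "\<exists>N\<in>carrier (SL2 p). N \<otimes>\<^bsub>SL2 p\<^esub> M = \<one>\<^bsub>SL2 p\<^esub>"
    by blast
qed

end

theory Submission
  imports Defs "HOL-Analysis.Harmonic_Numbers" "HOL-Number_Theory.Residues"
begin

text \<open>
  By the Bruhat decomposition it suffices to write \<open>A\<^sup>t\<close> as a word of length \<open>O((log p)\<^sup>2)\<close>. Let \<open>T\<close> be the
  word that the subtractive Euclidean algorithm produces from \<open>(y + k p, p\<^sup>2)\<close>. Its matrix has this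
  pair as first column and is therefore upper triangular modulo \<open>p\<close> with diagonal \<open>(y, 1 / y)\<close>; the
  reversed word has the diagonal \<open>(1 / y, y)\<close>. Hence \<open>T A\<^sup>e rev(T) = A\<^bsup>y\<^sup>2 e + const\<^esup>\<close>, and Horner's scheme in
  base \<open>y\<^sup>2\<close> writes \<open>A\<^sup>t\<close> with \<open>O(log p / log y)\<close> copies of \<open>T\<close> and \<open>rev(T)\<close>. With \<open>y\<^sup>2\<close> of the order of
  \<open>log p\<close> this is short enough if \<open>T\<close> has length \<open>O(log p log log p)\<close>.

  Such a \<open>T\<close> is found by drawing \<open>k\<close> at random. Each Euclidean step yields a solution of \<open>z \<equiv> \<plusminus> N v\<close>
  modulo \<open>p\<^sup>2\<close>, where \<open>N = y + k p\<close>, with \<open>q v z \<le> p\<^sup>2\<close>; a pair \<open>(v, z)\<close> determines \<open>k\<close>, and it occurs at all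
  only if \<open>z \<equiv> \<plusminus> y v\<close> modulo \<open>p\<close>. Counting these pairs shows that for at least half of the \<open>k\<close> all
  quotients are \<open>O(log p)\<close> and their sum is \<open>O(log p log log p)\<close>.
\<close>

section \<open>Subtractive Euclid on random inputs\<close>

text \<open>Modulo p only the class y of the first entry matters. The modulus
  \<open>p\<^sup>2\<close> leaves k free, so that a short word can be drawn among p candidates. The
  obstacle is that the subtractive algorithm pays for each quotient in full and the quotients have a
  heavy tail: counting over all of them would bound the mean length only by order (log p)^2. Hence
  the few k with a quotient beyond a multiple of log p are discarded first, and Markov's inequality
  is applied to the truncated count, whose mean is O(log p log log p). The size of y balances two
  costs. Each Horner digit costs up to y^2 letters A besides one T and one rev(T), and there are
  about log p / log(y^2) digits. With y^2 near log p the denominator is log log p and cancels that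
  factor in the length of T, while the blocks of A stay within (log p)^2; a bounded y would leave
  the factor log log p in place. Reversal takes the part of inversion because the inverses of A and
  B are not letters.\<close>

fun euc :: "nat \<Rightarrow> nat \<Rightarrow> nat list" where
  "euc x w =
     (if w = 0 \<or> x = 0 then []
      else if w < x then 0 # euc (x - w) w
      else 1 # euc x (w - x))"

declare euc.simps [simp del]

lemma card_residue_class_le:
  fixes p :: nat and r :: int
  assumes "p > 0"
  shows "card {z \<in> {1..n}. [int z = r] (mod int p)} \<le> n div p + 1"
proof -
  let ?A = "{z \<in> {1..n}. [int z = r] (mod int p)}"
  have "inj_on (\<lambda>z. z div p) ?A"
  proof (rule inj_onI)
    fix z z' assume *: "z \<in> ?A" "z' \<in> ?A" "z div p = z' div p"
    then have "[int z = int z'] (mod int p)"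
      by (auto intro: cong_trans cong_sym)
    then have "z mod p = z' mod p"
      by (metis cong_def cong_int_iff)
    with *(3) show "z = z'"
      by (metis div_mult_mod_eq)
  qed
  moreover have "(\<lambda>z. z div p) ` ?A \<subseteq> {..n div p}"
    by (auto simp: div_le_mono)
  ultimately have "card ?A \<le> card {..n div p}"
    by (intro card_inj_on_le) auto
  then show ?thesis by simp
qed

text \<open>
  The run of \<open>euc N M\<close> keeps \<open>M = v\<^sub>1 x + v\<^sub>2 w\<close>, where \<open>x \<equiv> N v\<^sub>2\<close> and \<open>w \<equiv> - N v\<^sub>1\<close> modulo \<open>M\<close>. A step that
  subtracts \<open>z\<close> is recorded as \<open>(q, v, z)\<close>: \<open>v\<close> is the cofactor with \<open>z \<equiv> \<plusminus> N v\<close>, and \<open>q\<close> counts how often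
  \<open>z\<close> has been subtracted in a row. The sign \<open>s\<close> tells the two kinds of steps apart.
\<close>

definition euc_steps :: "int \<Rightarrow> nat \<Rightarrow> nat \<Rightarrow> (nat \<times> nat \<times> nat) set" where
  "euc_steps s N M =
     {(q, v, z). 1 \<le> q \<and> 1 \<le> v \<and> 1 \<le> z \<and> q * v * z \<le> M \<and> [int z = s * int N * int v] (mod int M)}"

lemma finite_euc_steps: "finite (euc_steps s N M)"
proof (rule finite_subset)
  have "q \<le> M \<and> v \<le> M \<and> z \<le> M" if "1 \<le> q" "1 \<le> v" "1 \<le> z" "q * v * z \<le> M" for q v z :: nat
  proof -
    have "q * 1 * 1 \<le> q * v * z" "1 * v * 1 \<le> q * v * z" "1 * 1 * z \<le> q * v * z"
      using that by (intro mult_le_mono; simp)+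
    with that show ?thesis by linarith
  qed
  then show "euc_steps s N M \<subseteq> {..M} \<times> {..M} \<times> {..M}"
    by (auto simp: euc_steps_def)
qed auto

text \<open>The two cardinalities form a potential. The determinant condition solves the equations
  for N and M to \<open>x = N v2 - M u2\<close> and \<open>w = M u1 - N v1\<close>, so every step
  has a triple of its own. While x is subtracted repeatedly, v2 stays fixed and v1 grows by v2, so
  \<open>v1 div v2\<close> goes up by one each time; the filters therefore lose the triple of each
  step that is made.\<close>

lemma length_euc_le_aux:
  fixes u1 u2 v1 v2 x w N M :: nat
  assumes "int u1 * int v2 - int u2 * int v1 = 1"
    and "N = u1 * x + u2 * w" "M = v1 * x + v2 * w" "v1 > 0 \<or> x \<le> w" "v2 > 0"
  shows "length (euc x w) \<le>
    card {(q, v, z) \<in> euc_steps 1 N M. z < x \<or> z = x \<and> v1 div v2 < q} +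
    card {(q, v, z) \<in> euc_steps (- 1) N M. z < w \<or> z = w \<and> v2 div v1 < q}"
  using assms
proof (induction x w arbitrary: u1 u2 v1 v2 rule: euc.induct)
  case (1 x w)
  let ?R = "euc_steps 1 N M" and ?L = "euc_steps (- 1) N M"
  define F where "F x v1 v2 = {(q, v, z) \<in> ?R. z < x \<or> z = x \<and> v1 div v2 < q}" for x v1 v2
  define G where "G w v1 v2 = {(q, v, z) \<in> ?L. z < w \<or> z = w \<and> v2 div v1 < q}" for w v1 v2
  have fin: "finite (F x v1 v2)" "finite (G x v1 v2)" for x v1 v2
    by (auto simp: F_def G_def intro: finite_subset[OF _ finite_euc_steps])
  consider "x = 0 \<or> w = 0" | "x > 0" "0 < w" "w < x" | "0 < x" "x \<le> w" by linarith
  then show ?case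
  proof cases
    case 1
    then show ?thesis by (subst euc.simps) auto
  next
    case 2
    with "1.prems" have v1: "v1 > 0" by auto
    have "length (euc (x - w) w) \<le> card (F (x - w) v1 (v1 + v2)) + card (G w v1 (v1 + v2))"
      unfolding F_def G_def
    proof (rule "1.IH"(1)[where ?u1.0 = u1 and ?u2.0 = "u1 + u2"])
      show "int u1 * int (v1 + v2) - int (u1 + u2) * int v1 = 1"
        using "1.prems" by (simp add: algebra_simps)
      have "u1 * x = u1 * (x - w) + u1 * w" "v1 * x = v1 * (x - w) + v1 * w"
        using 2 by (simp_all flip: add_mult_distrib2)
      then show "N = u1 * (x - w) + (u1 + u2) * w" "M = v1 * (x - w) + (v1 + v2) * w"
        using "1.prems" by (simp_all add: algebra_simps)
    qed (use 2 v1 in auto)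
    moreover have "F (x - w) v1 (v1 + v2) \<subseteq> F x v1 v2"
      using 2 by (auto simp: F_def)
    then have "card (F (x - w) v1 (v1 + v2)) \<le> card (F x v1 v2)"
      by (intro card_mono fin)
    \<comment> \<open>The triple used up is \<open>(v2 div v1 + 1, v1, w)\<close>. Its product is at
      most (v2 + v1) w, which w < x bounds by v2 w + v1 x = M. The other case of the recursion is
      symmetric.\<close>
    moreover have "G w v1 (v1 + v2) \<subset> G w v1 v2"
    proof (rule psubsetI)
      show "G w v1 (v1 + v2) \<subseteq> G w v1 v2"
        using v1 by (auto simp: G_def)
      have "(v2 div v1 + 1) * v1 \<le> v2 + v1"
        by simp
      then have "(v2 div v1 + 1) * v1 * w \<le> (v2 + v1) * w"
        by (rule mult_le_mono1)
      also have "\<dots> \<le> M"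
        using 2 "1.prems"(3) by (simp add: add_mult_distrib)
      finally have le: "(v2 div v1 + 1) * v1 * w \<le> M" .
      have "int w = (int u1 * int v2 - int u2 * int v1) * int w"
        using "1.prems"(1) by simp
      also have "\<dots> = - 1 * int N * int v1 + int M * int u1"
        using "1.prems"(2,3) by (simp add: algebra_simps)
      finally have "[int w = - 1 * int N * int v1] (mod int M)"
        by (simp only: cong_def mod_mult_self2)
      with le v1 2 have "(v2 div v1 + 1, v1, w) \<in> G w v1 v2"
        by (simp add: G_def euc_steps_def)
      moreover have "(v2 div v1 + 1, v1, w) \<notin> G w v1 (v1 + v2)"
        using v1 by (simp add: G_def)
      ultimately show "G w v1 (v1 + v2) \<noteq> G w v1 v2" by blast
    qed
    then have "card (G w v1 (v1 + v2)) < card (G w v1 v2)"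
      by (intro psubset_card_mono fin)
    ultimately show ?thesis
      using 2 by (subst euc.simps) (simp add: F_def G_def)
  next
    case 3
    have v2: "v2 > 0" using "1.prems" by auto
    have "length (euc x (w - x)) \<le> card (F x (v1 + v2) v2) + card (G (w - x) (v1 + v2) v2)"
      unfolding F_def G_def
    proof (rule "1.IH"(2)[where ?u1.0 = "u1 + u2" and ?u2.0 = u2])
      show "int (u1 + u2) * int v2 - int u2 * int (v1 + v2) = 1"
        using "1.prems" by (simp add: algebra_simps)
      have "u2 * w = u2 * (w - x) + u2 * x" "v2 * w = v2 * (w - x) + v2 * x"
        using 3 by (simp_all flip: add_mult_distrib2)
      then show "N = (u1 + u2) * x + u2 * (w - x)" "M = (v1 + v2) * x + v2 * (w - x)"
        using "1.prems" by (simp_all add: algebra_simps)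
    qed (use 3 v2 in auto)
    moreover have "G (w - x) (v1 + v2) v2 \<subseteq> G w v1 v2"
      using 3 by (auto simp: G_def)
    then have "card (G (w - x) (v1 + v2) v2) \<le> card (G w v1 v2)"
      by (intro card_mono fin)
    moreover have "F x (v1 + v2) v2 \<subset> F x v1 v2"
    proof (rule psubsetI)
      show "F x (v1 + v2) v2 \<subseteq> F x v1 v2"
        using v2 by (auto simp: F_def)
      have "(v1 div v2 + 1) * v2 \<le> v1 + v2"
        by simp
      then have "(v1 div v2 + 1) * v2 * x \<le> (v1 + v2) * x"
        by (rule mult_le_mono1)
      also have "\<dots> \<le> M"
        using 3 "1.prems"(3) by (simp add: add_mult_distrib)
      finally have le: "(v1 div v2 + 1) * v2 * x \<le> M" .
      have "int x = (int u1 * int v2 - int u2 * int v1) * int x"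
        using "1.prems"(1) by simp
      also have "\<dots> = 1 * int N * int v2 + int M * (- int u2)"
        using "1.prems"(2,3) by (simp add: algebra_simps)
      finally have "[int x = 1 * int N * int v2] (mod int M)"
        by (simp only: cong_def mod_mult_self2)
      with le v2 3 have "(v1 div v2 + 1, v2, x) \<in> F x v1 v2"
        by (simp add: F_def euc_steps_def)
      moreover have "(v1 div v2 + 1, v2, x) \<notin> F x (v1 + v2) v2"
        using v2 by (simp add: F_def)
      ultimately show "F x (v1 + v2) v2 \<noteq> F x v1 v2" by blast
    qed
    then have "card (F x (v1 + v2) v2) < card (F x v1 v2)"
      by (intro psubset_card_mono fin)
    ultimately show ?thesis
      using 3 by (subst euc.simps) (simp add: F_def G_def)
  qed
qed

text \<open>The run starts with v1 = 0 and v2 = 1. A zero cofactor is harmless here: by N <= M the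
  first subtraction is from w and makes v1 positive.\<close>

lemma length_euc_le:
  assumes "N \<le> M"
  shows "length (euc N M) \<le> card (euc_steps 1 N M) + card (euc_steps (- 1) N M)"
proof -
  have "length (euc N M) \<le>
    card {(q, v, z) \<in> euc_steps 1 N M. z < N \<or> z = N \<and> 0 div 1 < q} +
    card {(q, v, z) \<in> euc_steps (- 1) N M. z < M \<or> z = M \<and> 1 div 0 < q}"
    using assms length_euc_le_aux[of 1 1 0 0 N N M M] by simp
  also have "\<dots> \<le> card (euc_steps 1 N M) + card (euc_steps (- 1) N M)"
    by (intro add_mono card_mono finite_euc_steps) auto
  finally show ?thesis .
qed

section \<open>Counting pairs (v, z) modulo p\<close>

definition class_pairs :: "nat \<Rightarrow> int \<Rightarrow> nat \<Rightarrow> (nat \<times> nat) set" where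
  "class_pairs p c q =
     {(v, z). 1 \<le> v \<and> 1 \<le> z \<and> q * v * z \<le> p\<^sup>2 \<and> \<not> p dvd v \<and> [int z = c * int v] (mod int p)}"

lemma finite_class_pairs:
  assumes "q > 0"
  shows "finite (class_pairs p c q)"
proof (rule finite_subset)
  have "v \<le> p\<^sup>2 \<and> z \<le> p\<^sup>2" if "1 \<le> v" "1 \<le> z" "q * v * z \<le> p\<^sup>2" for v z :: nat
  proof -
    have "1 * v * 1 \<le> q * v * z" "1 * 1 * z \<le> q * v * z"
      using that assms by (intro mult_le_mono; simp)+
    with that show ?thesis by linarith
  qed
  then show "class_pairs p c q \<subseteq> {..p\<^sup>2} \<times> {..p\<^sup>2}"
    by (auto simp: class_pairs_def)
qed auto

text \<open>Dirichlet's hyperbola method: q (Y + 1)^2 > p^2 prevents v and z from both exceeding Y.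
  For a given v, the possible z form one residue class up to p^2 / (q v). As c is a unit, the same
  count holds with v and z exchanged, whence the factor 2. In the applications c is y or -y, so that
  a single set of pairs serves all k.\<close>

lemma card_class_pairs_le:
  assumes p: "prime p" and q: "q > 0" and c: "\<not> int p dvd c" and Y: "p\<^sup>2 < q * (Y + 1)\<^sup>2"
  shows "card (class_pairs p c q) \<le> 2 * (\<Sum>v=1..Y. p\<^sup>2 div (q * v) div p + 1)"
proof -
  have p0: "p > 0" using p by (rule prime_gt_0_nat)
  define V where "V v = {z \<in> {1..p\<^sup>2 div (q * v)}. [int z = c * int v] (mod int p)}" for v
  obtain c' where c': "[c * c' = 1] (mod int p)"
    using c p cong_solve_coprime_int[of c "int p"] prime_imp_coprime[of "int p" c]
    by (auto simp: coprime_commute)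
  define Z where "Z z = {v \<in> {1..p\<^sup>2 div (q * z)}. [int v = c' * int z] (mod int p)}" for z
  have div: "a * b * d \<le> n \<Longrightarrow> a * b > 0 \<Longrightarrow> d \<le> n div (a * b)" for a b d n :: nat
    by (simp add: less_eq_div_iff_mult_less_eq mult.commute)
  have "class_pairs p c q \<subseteq> Sigma {1..Y} V \<union> (\<lambda>(z, v). (v, z)) ` Sigma {1..Y} Z"
  proof
    fix x assume "x \<in> class_pairs p c q"
    then obtain v z where x: "x = (v, z)" and vz: "1 \<le> v" "1 \<le> z" "q * v * z \<le> p\<^sup>2"
      "[int z = c * int v] (mod int p)"
      by (auto simp: class_pairs_def)
    have "[c' * int z = c' * (c * int v)] (mod int p)"
      using vz(4) by (rule cong_scalar_left)
    moreover have "[c' * (c * int v) = int v] (mod int p)"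
      using cong_scalar_right[OF c', of "int v"] by (simp add: ac_simps)
    ultimately have v: "[int v = c' * int z] (mod int p)"
      by (metis cong_sym cong_trans)
    have "v \<le> Y \<or> z \<le> Y"
    proof (rule ccontr)
      assume "\<not> (v \<le> Y \<or> z \<le> Y)"
      then have "(Y + 1) * (Y + 1) \<le> v * z"
        by (intro mult_le_mono) auto
      then have "q * (Y + 1)\<^sup>2 \<le> q * v * z"
        by (simp only: power2_eq_square mult.assoc mult_le_mono2)
      with vz Y show False by linarith
    qed
    moreover have "x \<in> Sigma {1..Y} V" if "v \<le> Y"
      using that vz q x div[of q v z] by (auto simp: V_def)
    moreover have "(z, v) \<in> Sigma {1..Y} Z" if "z \<le> Y"
      using that vz v q div[of q z v] by (auto simp: Z_def ac_simps)
    ultimately show "x \<in> Sigma {1..Y} V \<union> (\<lambda>(z, v). (v, z)) ` Sigma {1..Y} Z"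
      using x by force
  qed
  moreover have fin: "finite (Sigma {1..Y} V)" "finite (Sigma {1..Y} Z)"
    by (auto simp: V_def Z_def)
  ultimately have "card (class_pairs p c q) \<le> card (Sigma {1..Y} V \<union> (\<lambda>(z, v). (v, z)) ` Sigma {1..Y} Z)"
    by (intro card_mono) auto
  also have "\<dots> \<le> card (Sigma {1..Y} V) + card ((\<lambda>(z, v). (v, z)) ` Sigma {1..Y} Z)"
    by (rule card_Un_le)
  also have "\<dots> \<le> card (Sigma {1..Y} V) + card (Sigma {1..Y} Z)"
    using card_image_le[OF fin(2)] by simp
  also have "\<dots> = (\<Sum>v=1..Y. card (V v)) + (\<Sum>z=1..Y. card (Z z))"
    by (simp add: V_def Z_def)
  also have "\<dots> \<le> (\<Sum>v=1..Y. p\<^sup>2 div (q * v) div p + 1) + (\<Sum>v=1..Y. p\<^sup>2 div (q * v) div p + 1)"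
    unfolding V_def Z_def by (intro add_mono sum_mono card_residue_class_le p0)
  finally show ?thesis by simp
qed

lemma card_class_pairs_le_real:
  assumes "prime p" "q > 0" "\<not> int p dvd c" "p\<^sup>2 < q * (Y + 1)\<^sup>2"
  shows "real (card (class_pairs p c q)) \<le> 2 * (real p / real q * harm Y + real Y)"
proof -
  have p0: "p > 0" using assms by (simp add: prime_gt_0_nat)
  have "real (p\<^sup>2 div (q * v) div p) \<le> real p / real q * (1 / real v)" for v
  proof -
    have "p\<^sup>2 div (q * v) div p = p * p div (p * (q * v))"
      by (metis div_mult2_eq mult.commute power2_eq_square)
    also have "\<dots> = p div (q * v)"
      using p0 by (metis div_mult_mult1 less_numeral_extra(3))
    also have "real \<dots> \<le> real p / real (q * v)"
      by (rule of_nat_div_le_of_nat)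
    finally show ?thesis by simp
  qed
  then have "real (\<Sum>v=1..Y. p\<^sup>2 div (q * v) div p + 1) \<le> (\<Sum>v=1..Y. real p / real q * (1 / real v) + 1)"
    unfolding of_nat_sum of_nat_add by (intro sum_mono add_mono) auto
  also have "\<dots> = real p / real q * harm Y + real Y"
    by (simp add: harm_def sum.distrib sum_distrib_left inverse_eq_divide)
  finally show ?thesis
    using of_nat_mono[OF card_class_pairs_le[OF assms], where 'a = real] by simp
qed

lemma harm_le_ln: "n > 0 \<Longrightarrow> harm n \<le> 1 + ln (real n)"
proof (induction n rule: nat_induct_non_zero)
  case (Suc n)
  have "ln (real n / (real n + 1)) \<le> real n / (real n + 1) - 1"
    using Suc by (intro ln_le_minus_one) auto
  also have "\<dots> = - (1 / (real n + 1))"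
    by (simp add: field_simps)
  finally have "1 / (real n + 1) \<le> ln (real n + 1) - ln (real n)"
    using Suc by (simp add: ln_div)
  then show ?case
    using Suc by (simp add: harm_Suc inverse_eq_divide add.commute)
qed (simp add: harm_def)


section \<open>Averaging the length of the run over k\<close>

locale euc_sampling =
  fixes p y :: nat
  assumes p: "prime p" and y: "2 \<le> y" "y + 1 < p"
begin

abbreviation "S s k \<equiv> euc_steps s (y + k * p) (p\<^sup>2)"

lemma sign_not_dvd:
  assumes "s = 1 \<or> s = - 1"
  shows "\<not> int p dvd s * int y"
proof
  assume "int p dvd s * int y"
  with assms have "p dvd y" by (auto simp: int_dvd_int_iff)
  with y show False by (auto dest: dvd_imp_le)
qed

text \<open>Reduction modulo p makes k disappear. The size bound is what keeps p from dividing v: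
  otherwise p divides z too, and q v z <= p^2 leaves only q = 1 and v = z = p. Cancelling p from the
  congruence then gives y = 1 or y = -1 modulo p, which 2 <= y and y + 1 < p exclude.\<close>

lemma steps_class_pairs:
  assumes s: "s = 1 \<or> s = - 1" and t: "(q, v, z) \<in> S s k"
  shows "(v, z) \<in> class_pairs p (s * int y) q"
proof -
  have p0: "p > 0" using p by (rule prime_gt_0_nat)
  from t have vz: "1 \<le> q" "1 \<le> v" "1 \<le> z" "q * v * z \<le> p\<^sup>2"
    and cong: "[int z = s * int (y + k * p) * int v] (mod int (p\<^sup>2))"
    by (auto simp: euc_steps_def)
  have cong_p: "[int z = s * int y * int v] (mod int p)"
  proof -
    have "[int z = s * int (y + k * p) * int v] (mod int p)"
      using cong by (rule cong_dvd_modulus) (simp add: power2_eq_square)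
    also have "s * int (y + k * p) * int v = s * int y * int v + int p * (s * int k * int v)"
      by (simp add: algebra_simps)
    also have "[\<dots> = s * int y * int v] (mod int p)"
      by (simp add: cong_def)
    finally show ?thesis .
  qed
  moreover have "\<not> p dvd v"
  proof
    assume "p dvd v"
    then obtain v' where v': "v = p * v'" by blast
    have "int p dvd int z"
      using v' by (simp only: cong_dvd_iff[OF cong_p]) simp
    then obtain z' where z': "z = p * z'"
      by (auto simp: int_dvd_int_iff)
    have "(q * v' * z') * p\<^sup>2 \<le> 1 * p\<^sup>2"
      using vz(4) by (simp add: v' z' power2_eq_square ac_simps)
    then have "q * v' * z' \<le> 1"
      using p0 by (simp only: mult_le_cancel2) auto
    moreover have "q * v' * z' \<noteq> 0"
      using vz v' z' by auto
    ultimately have "q * v' * z' = 1" by linarith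
    then have "v = p" "z = p"
      using v' z' by auto
    with cong have "[int p * 1 = int p * (s * int (y + k * p))] (mod int p * int p)"
      by (simp add: power2_eq_square ac_simps)
    then have "int p * int p dvd int p * (1 - s * int (y + k * p))"
      by (simp add: cong_iff_dvd_diff algebra_simps)
    then have "int p dvd 1 - s * int (y + k * p)"
      using p0 by simp
    then have "int p dvd 1 - s * int (y + k * p) + int p * (s * int k)"
      by (intro dvd_add) auto
    also have "1 - s * int (y + k * p) + int p * (s * int k) = 1 - s * int y"
      by (simp add: algebra_simps)
    finally have "int p dvd 1 - s * int y" .
    then have "int p dvd int y - 1 \<or> int p dvd int y + 1"
      using s by (auto simp: dvd_diff_commute add.commute)
    then show False
      using y zdvd_imp_le[of "int p" "int y - 1"] zdvd_imp_le[of "int p" "int y + 1"] by auto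
  qed
  ultimately show ?thesis
    using vz by (simp add: class_pairs_def)
qed

text \<open>Subtracting the two congruences gives p^2 | s p v (k - k'). One factor p cancels, and v
  is a unit modulo p.\<close>

lemma steps_unique:
  assumes s: "s = 1 \<or> s = - 1" and k: "k < p" "k' < p"
    and t: "(q, v, z) \<in> S s k" "(q, v, z) \<in> S s k'"
  shows "k = k'"
proof -
  have p0: "p > 0" using p by (rule prime_gt_0_nat)
  have pv: "\<not> int p dvd int v"
    using steps_class_pairs[OF s t(1)] by (simp add: class_pairs_def)
  have "[s * int (y + k * p) * int v = s * int (y + k' * p) * int v] (mod int (p\<^sup>2))"
    using t by (auto simp: euc_steps_def intro: cong_trans cong_sym)
  then have "int (p\<^sup>2) dvd s * int (y + k * p) * int v - s * int (y + k' * p) * int v"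
    by (simp add: cong_iff_dvd_diff)
  also have "s * int (y + k * p) * int v - s * int (y + k' * p) * int v = int p * (s * (int v * (int k - int k')))"
    by (simp add: algebra_simps)
  finally have "int p dvd s * (int v * (int k - int k'))"
    using p0 by (simp add: power2_eq_square)
  then have "int p dvd int v * (int k - int k')"
    using s by auto
  then have "int p dvd int k - int k'"
    using pv p by (simp add: prime_dvd_mult_iff)
  moreover have "\<bar>int k - int k'\<bar> < int p"
    using k by linarith
  ultimately show ?thesis
    using dvd_imp_le_int[of "int k - int k'" "int p"] by fastforce
qed

text \<open>Every k in question owns a pair, and no pair has two owners. Asking for the exact value
  Q loses nothing, because lowering q to a positive value preserves membership in
  \<open>euc_steps\<close>.\<close>

lemma card_large_quotient:
  assumes s: "s = 1 \<or> s = - 1" and Q: "Q > 0"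
  shows "card {k \<in> {..<p}. \<exists>v z. (Q, v, z) \<in> S s k} \<le> card (class_pairs p (s * int y) Q)"
proof -
  let ?C = "class_pairs p (s * int y) Q"
  define K where "K t = {k \<in> {..<p}. (Q, t) \<in> S s k}" for t
  have "{k \<in> {..<p}. \<exists>v z. (Q, v, z) \<in> S s k} \<subseteq> (\<Union>t\<in>?C. K t)"
    using steps_class_pairs[OF s] unfolding K_def by fastforce
  then have "card {k \<in> {..<p}. \<exists>v z. (Q, v, z) \<in> S s k} \<le> card (\<Union>t\<in>?C. K t)"
    by (intro card_mono) (auto simp: K_def finite_class_pairs[OF Q])
  also have "\<dots> \<le> (\<Sum>t\<in>?C. card (K t))"
    by (intro card_UN_le finite_class_pairs Q)
  also have "card (K t) \<le> 1" for t
    using steps_unique[OF s] unfolding K_def by (cases t) (auto simp: card_le_Suc0_iff_eq)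
  then have "(\<Sum>t\<in>?C. card (K t)) \<le> card ?C"
    by (metis card_eq_sum sum_mono)
  finally show ?thesis .
qed

lemma sum_card_small_quotients:
  assumes s: "s = 1 \<or> s = - 1"
  shows "(\<Sum>k<p. card {t \<in> S s k. fst t < Q}) \<le> (\<Sum>q=1..<Q. card (class_pairs p (s * int y) q))"
proof -
  let ?X = "Sigma {..<p} (\<lambda>k. {t \<in> S s k. fst t < Q})"
  let ?Y = "Sigma {1..<Q} (class_pairs p (s * int y))"
  have "(\<Sum>k<p. card {t \<in> S s k. fst t < Q}) = card ?X"
    by (simp add: finite_euc_steps)
  also have "\<dots> \<le> card ?Y"
  proof (rule card_inj_on_le)
    show "inj_on snd ?X"
      using steps_unique[OF s] by (auto intro!: inj_onI)
    show "snd ` ?X \<subseteq> ?Y"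
      using steps_class_pairs[OF s] by (auto simp: euc_steps_def)
    show "finite ?Y"
      by (auto simp: finite_class_pairs)
  qed
  also have "\<dots> = (\<Sum>q=1..<Q. card (class_pairs p (s * int y) q))"
    by (simp add: finite_class_pairs)
  finally show ?thesis .
qed

text \<open>\<open>K1\<close> takes care of the k with a quotient of at least Q = r^2, for either
  sign. For all other k every step has q < Q, and \<open>K2\<close> is handled by Markov's
  inequality with threshold B.\<close>

lemma card_long_euc:
  assumes r: "r > 0"
  shows "real (card {k \<in> {..<p}. B < length (euc (y + k * p) (p\<^sup>2))}) * real B \<le>
    4 * (real p / (real r)\<^sup>2 * harm p + real p / real r) * real B +
    4 * (real p * harm p * harm (r\<^sup>2) + real p * real (r\<^sup>2))"
proof -
  have p0: "p > 0" using p by (rule prime_gt_0_nat)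
  \<comment> \<open>A square, so that Y = p div r satisfies Q (Y + 1)^2 > p^2. The hyperbola count
    for q = Q then has the error term p / r.\<close>
  define Q where "Q = r\<^sup>2"
  have Q: "Q > 0" using r by (simp add: Q_def)
  define K1 where "K1 s = {k \<in> {..<p}. \<exists>v z. (Q, v, z) \<in> S s k}" for s
  define S' where "S' s k = {t \<in> S s k. fst t < Q}" for s k
  define K2 where "K2 = {k \<in> {..<p}. B < card (S' 1 k) + card (S' (- 1) k)}"
  have "{k \<in> {..<p}. B < length (euc (y + k * p) (p\<^sup>2))} \<subseteq> K1 1 \<union> K1 (- 1) \<union> K2"
  proof
    fix k assume k: "k \<in> {k \<in> {..<p}. B < length (euc (y + k * p) (p\<^sup>2))}"
    have *: "S s k = S' s k" if "k \<notin> K1 s" for s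
    proof -
      have "q < Q" if t: "(q, v, z) \<in> S s k" for q v z
      proof (rule ccontr)
        assume "\<not> q < Q"
        then have "Q * v * z \<le> q * v * z"
          by (intro mult_le_mono) auto
        also have "\<dots> \<le> p\<^sup>2"
          using t by (simp add: euc_steps_def)
        finally have "(Q, v, z) \<in> S s k"
          using t Q by (simp add: euc_steps_def)
        with \<open>k \<notin> K1 s\<close> k show False
          by (auto simp: K1_def)
      qed
      then show ?thesis by (auto simp: S'_def)
    qed
    have "y + k * p \<le> p\<^sup>2"
    proof -
      have "y + k * p \<le> (k + 1) * p" using y by simp
      also have "\<dots> \<le> p * p" using k by (intro mult_le_mono1) auto
      finally show ?thesis by (simp add: power2_eq_square)
    qed
    then have "B < card (S 1 k) + card (S (- 1) k)"
      using k length_euc_le[of "y + k * p" "p\<^sup>2"] by simp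
    then show "k \<in> K1 1 \<union> K1 (- 1) \<union> K2"
      using k *[of 1] *[of "- 1"]
      by (cases "k \<in> K1 1"; cases "k \<in> K1 (- 1)") (simp_all add: K2_def)
  qed
  then have "card {k \<in> {..<p}. B < length (euc (y + k * p) (p\<^sup>2))} \<le> card (K1 1 \<union> K1 (- 1) \<union> K2)"
    by (intro card_mono) (auto simp: K1_def K2_def)
  also have "\<dots> \<le> card (K1 1) + card (K1 (- 1)) + card K2"
    by (meson add_mono card_Un_le le_trans order_refl)
  finally have "card {k \<in> {..<p}. B < length (euc (y + k * p) (p\<^sup>2))} \<le> card (K1 1) + card (K1 (- 1)) + card K2" .
  then have "card {k \<in> {..<p}. B < length (euc (y + k * p) (p\<^sup>2))} * B \<le> (card (K1 1) + card (K1 (- 1))) * B + card K2 * B"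
    by (metis add_mult_distrib mult_le_mono1)
  then have main: "real (card {k \<in> {..<p}. B < length (euc (y + k * p) (p\<^sup>2))}) * real B \<le>
      (real (card (K1 1)) + real (card (K1 (- 1)))) * real B + real (card K2 * B)"
    by (metis (mono_tags, lifting) of_nat_add of_nat_le_iff of_nat_mult)

  have K1: "real (card (K1 s)) \<le> 2 * (real p / (real r)\<^sup>2 * harm p + real p / real r)" if s: "s = 1 \<or> s = - 1" for s
  proof -
    have "p < (p div r + 1) * r"
      using r by (metis Suc_eq_plus1 dividend_less_div_times mult.commute mult_Suc_right)
    then have "p\<^sup>2 < ((p div r + 1) * r)\<^sup>2"
      by (intro power_strict_mono) auto
    then have "p\<^sup>2 < Q * (p div r + 1)\<^sup>2"
      by (simp only: Q_def power_mult_distrib mult.commute)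
    then have "real (card (class_pairs p (s * int y) Q)) \<le> 2 * (real p / real Q * harm (p div r) + real (p div r))"
      by (intro card_class_pairs_le_real p Q sign_not_dvd s)
    also have "\<dots> \<le> 2 * (real p / real Q * harm p + real p / real r)"
      by (intro mult_left_mono add_mono harm_mono) (auto simp: of_nat_div_le_of_nat)
    finally show ?thesis
      using card_large_quotient[OF s Q] by (simp add: K1_def Q_def)
  qed

  have S': "real (\<Sum>k<p. card (S' s k)) \<le> 2 * (real p * harm p * harm Q + real p * real Q)" if s: "s = 1 \<or> s = - 1" for s
  proof -
    have "real (\<Sum>k<p. card (S' s k)) \<le> real (\<Sum>q=1..<Q. card (class_pairs p (s * int y) q))"
      unfolding S'_def of_nat_le_iff by (rule sum_card_small_quotients[OF s])
    also have "\<dots> = (\<Sum>q=1..<Q. real (card (class_pairs p (s * int y) q)))"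
      by simp
    also have "\<dots> \<le> (\<Sum>q=1..<Q. 2 * (real p / real q * harm p + real p))"
    proof (intro sum_mono)
      fix q assume q: "q \<in> {1..<Q}"
      \<comment> \<open>For small q the crude choice Y = p is enough: its error p occurs once for
        each q and adds up to p Q at most.\<close>
      have "p\<^sup>2 < (p + 1)\<^sup>2" by (intro power_strict_mono) auto
      also have "1 * (p + 1)\<^sup>2 \<le> q * (p + 1)\<^sup>2" using q by (intro mult_le_mono1) auto
      finally show "real (card (class_pairs p (s * int y) q)) \<le> 2 * (real p / real q * harm p + real p)"
        using q by (intro card_class_pairs_le_real p sign_not_dvd s) auto
    qed
    also have "\<dots> \<le> (\<Sum>q=1..Q. 2 * (real p / real q * harm p + real p))"
      by (intro sum_mono2) (auto simp: harm_nonneg)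
    also have "\<dots> = 2 * (real p * harm p * harm Q + real p * real Q)"
      by (simp add: sum.distrib harm_def[of Q] inverse_eq_divide algebra_simps
          flip: sum_distrib_left sum_divide_distrib)
         (simp add: sum_distrib_left)
    finally show ?thesis .
  qed

  have "card K2 * B = (\<Sum>k\<in>K2. B)" by simp
  also have "\<dots> \<le> (\<Sum>k\<in>K2. card (S' 1 k) + card (S' (- 1) k))"
    by (intro sum_mono) (auto simp: K2_def)
  also have "\<dots> \<le> (\<Sum>k<p. card (S' 1 k) + card (S' (- 1) k))"
    by (intro sum_mono2) (auto simp: K2_def)
  finally have "real (card K2 * B) \<le> real (\<Sum>k<p. card (S' 1 k)) + real (\<Sum>k<p. card (S' (- 1) k))"
    unfolding sum.distrib by (metis of_nat_add of_nat_le_iff)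
  also have "\<dots> \<le> 4 * (real p * harm p * harm Q + real p * real Q)"
    using S'[of 1] S'[of "- 1"] by simp
  finally have "real (card K2 * B) \<le> 4 * (real p * harm p * harm Q + real p * real Q)" .
  moreover have "(real (card (K1 1)) + real (card (K1 (- 1)))) * real B \<le> 4 * (real p / (real r)\<^sup>2 * harm p + real p / real r) * real B"
    by (intro mult_right_mono order_trans[OF add_mono[OF K1 K1]]) (auto simp: mult.commute)
  ultimately show ?thesis
    using main by (simp add: Q_def)
qed

text \<open>The choice r = 64 y puts r^2 between 4096 L and 16384 L. With harm p <= 2 L, large
  quotients then affect at most 4 p / 64 of the k. The constant 2^18 = 16 * 16384 brings the
  contribution of Markov's inequality down to p / 4, since l >= 2 gives 2 (15 + l) + 16384 <= 16384
  l. In total fewer than half of the k are bad.\<close>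

lemma card_short_euc:
  defines "L \<equiv> bit_length p"
  assumes L: "L < y\<^sup>2" "y\<^sup>2 \<le> 4 * L"
  shows "p \<le> 2 * card {k \<in> {..<p}. length (euc (y + k * p) (p\<^sup>2)) \<le> 2 ^ 18 * L * bit_length L}"
proof -
  define l where "l = bit_length L"
  define B where "B = 2 ^ 18 * L * l"
  define r where "r = 64 * y"
  have p_less: "p < 2 ^ L"
    unfolding L_def bit_length_def by (rule floorlog_leD[of _ _ "floorlog 2 p"]) auto
  have L_less: "L < 2 ^ l"
    unfolding l_def bit_length_def by (rule floorlog_leD[of _ _ "floorlog 2 L"]) auto
  have L2: "2 \<le> L"
    using p_less prime_ge_2_nat[OF p] y power_increasing[of L 1 "2::nat"] by (cases "L \<le> 1") auto
  then have l2: "2 \<le> l"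
    using L_less power_increasing[of l 1 "2::nat"] by (cases "l \<le> 1") auto
  have ln2: "ln (2 :: real) \<le> 1"
    using ln_le_minus_one[of "2 :: real"] by simp
  have ln_pow: "ln (real n) \<le> real m" if "n \<le> 2 ^ m" "n > 0" for n m
  proof -
    have "real n \<le> real (2 ^ m)"
      using that(1) by (simp only: of_nat_le_iff)
    then have "ln (real n) \<le> ln (2 ^ m)"
      using that(2) by simp
    also have "\<dots> = real m * ln 2"
      by (simp add: ln_realpow)
    also have "\<dots> \<le> real m * 1"
      using ln2 by (intro mult_left_mono) auto
    finally show ?thesis by simp
  qed
  have h: "harm p \<le> 2 * real L"
    using harm_le_ln[of p] ln_pow[of p L] p_less prime_gt_0_nat[OF p] L2 by simp
  have r0: "r > 0" using y by (simp add: r_def)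
  have r2: "r\<^sup>2 = 4096 * y\<^sup>2"
    by (simp add: r_def power2_eq_square)
  have hr: "harm (r\<^sup>2) \<le> 15 + real l"
  proof -
    have "r\<^sup>2 \<le> 2 ^ (14 + l)"
      using L L_less by (simp add: r2 power_add)
    then show ?thesis
      using harm_le_ln[of "r\<^sup>2"] ln_pow[of "r\<^sup>2" "14 + l"] y by (simp add: r_def)
  qed
  have B: "real B = 2 ^ 18 * real L * real l" "real B > 0"
    using L2 l2 by (simp_all add: B_def)
  let ?bad = "{k \<in> {..<p}. B < length (euc (y + k * p) (p\<^sup>2))}"
  let ?good = "{k \<in> {..<p}. length (euc (y + k * p) (p\<^sup>2)) \<le> B}"
  have t1: "real p / (real r)\<^sup>2 * harm p + real p / real r \<le> real p / 64"
  proof -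
    have "(real r)\<^sup>2 = 4096 * real (y\<^sup>2)"
      using r2 by (metis of_nat_mult of_nat_numeral of_nat_power)
    also have "\<dots> \<ge> 4096 * real L"
      using L(1) by (simp only: mult_le_cancel_left of_nat_le_iff) simp
    finally have "real p / (real r)\<^sup>2 * harm p \<le> real p / (4096 * real L) * (2 * real L)"
      using L2 r0 by (intro mult_mono divide_left_mono h harm_nonneg) auto
    also have "\<dots> = real p / 2048"
      using L2 by simp
    finally have "real p / (real r)\<^sup>2 * harm p \<le> real p / 2048" .
    moreover have "real p / real r \<le> real p / 128"
      using y by (intro divide_left_mono) (auto simp: r_def)
    moreover have "real p \<ge> 0" by simp
    ultimately show ?thesis by linarith
  qed
  have t2: "real p * harm p * harm (r\<^sup>2) + real p * real (r\<^sup>2) \<le> real p * (real B / 16)"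
  proof -
    have "real p * harm p * harm (r\<^sup>2) \<le> real p * (2 * real L) * (15 + real l)"
      by (intro mult_mono h hr) (auto simp: harm_nonneg)
    moreover have "real (r\<^sup>2) \<le> real (16384 * L)"
      using L(2) unfolding of_nat_le_iff r2 by linarith
    then have "real p * real (r\<^sup>2) \<le> real p * (16384 * real L)"
      by (intro mult_left_mono) auto
    moreover have "2 * (15 + real l) + 16384 \<le> 2 ^ 18 * real l / 16"
      using l2 by simp
    then have "real p * (real L * (2 * (15 + real l) + 16384)) \<le> real p * (real L * (2 ^ 18 * real l / 16))"
      by (intro mult_left_mono) auto
    ultimately show ?thesis
      unfolding B by (simp add: algebra_simps)
  qed
  have "real (card ?bad) * real B \<le> 4 * (real p / 64) * real B + 4 * (real p * (real B / 16))"
    by (intro order_trans[OF card_long_euc[OF r0, of B]] add_mono mult_right_mono mult_left_mono t1 t2) auto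
  also have "\<dots> \<le> (real p / 2) * real B"
    by (simp add: algebra_simps)
  finally have "real (card ?bad) \<le> real p / 2"
    using B(2) by (simp only: mult_le_cancel_right_pos)
  moreover have "card ?good + card ?bad = p"
  proof -
    have "card (?good \<union> ?bad) = card ?good + card ?bad"
      by (intro card_Un_disjoint) auto
    moreover have "?good \<union> ?bad = {..<p}" by auto
    ultimately show ?thesis by simp
  qed
  ultimately have "p \<le> 2 * card ?good" by linarith
  then show ?thesis
    by (simp only: B_def l_def)
qed

end

section \<open>Words and matrices\<close>

definition mat2 :: "int \<Rightarrow> int \<Rightarrow> int \<Rightarrow> int \<Rightarrow> int^2^2" where
  "mat2 a b c d = vector [vector [a, b], vector [c, d]]"

lemma mat2_nth [simp]:
  "mat2 a b c d $ 1 $ 1 = a" "mat2 a b c d $ 1 $ 2 = b" "mat2 a b c d $ 2 $ 1 = c" "mat2 a b c d $ 2 $ 2 = d"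
  by (simp_all add: mat2_def)

lemma mat2_eqI:
  "M $ 1 $ 1 = N $ 1 $ 1 \<Longrightarrow> M $ 1 $ 2 = N $ 1 $ 2 \<Longrightarrow> M $ 2 $ 1 = N $ 2 $ 1 \<Longrightarrow> M $ 2 $ 2 = N $ 2 $ 2 \<Longrightarrow> M = N"
  for M N :: "int^2^2"
  by (simp add: vec_eq_iff forall_2)

lemma mat2_mult:
  "mat2 a b c d ** mat2 a' b' c' d' = mat2 (a * a' + b * c') (a * b' + b * d') (c * a' + d * c') (c * b' + d * d')"
  by (rule mat2_eqI) (simp_all add: matrix_matrix_mult_def sum_2)

lemma mat_1_mat2: "mat 1 = mat2 1 0 0 1"
  by (rule mat2_eqI) (simp_all add: mat_def)

lemma mat2_collapse: "mat2 (M $ 1 $ 1) (M $ 1 $ 2) (M $ 2 $ 1) (M $ 2 $ 2) = M"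
  by (rule mat2_eqI) simp_all

section \<open>Words, reversal and the Euclidean word\<close>

primrec word_mat :: "nat list \<Rightarrow> int^2^2" where
  "word_mat [] = mat 1"
| "word_mat (x # w) = (if x = 0 then A_mat else B_mat) ** word_mat w"

lemma A_mat_mat2: "A_mat = mat2 1 1 0 1" and B_mat_mat2: "B_mat = mat2 1 0 1 1"
  by (simp_all add: A_mat_def B_mat_def mat2_def)

lemma word_mat_append: "word_mat (v @ w) = word_mat v ** word_mat w"
  by (induction v) (simp_all add: matrix_mul_assoc)

lemma zemor_hash_word_mat: "zemor_hash p w = mat_mod p (word_mat (map enc_letter w))"
proof (induction w)
  case (Cons x w)
  have "letter_mat x = (if enc_letter x = 0 then A_mat else B_mat)"
    by (cases x) simp_all
  then show ?case
    using Cons by (simp add: zemor_hash_def SL2_def mat_mod_mult_left mat_mod_mult_right)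
qed (simp add: zemor_hash_def SL2_def)

text \<open>Reflection in the antidiagonal is an anti-automorphism of the matrix ring, and it fixes
  both A and B.\<close>

lemma word_mat_rev:
  "word_mat w = mat2 a b c d \<Longrightarrow> word_mat (rev w) = mat2 d b c a"
proof (induction w arbitrary: a b c d)
  case Nil
  from arg_cong[OF this[simplified mat_1_mat2 word_mat.simps], of "\<lambda>M. (M $ 1 $ 1, M $ 1 $ 2, M $ 2 $ 1, M $ 2 $ 2)"]
  show ?case by (simp add: mat_1_mat2)
next
  case (Cons x w)
  define a' b' c' d' where "a' = word_mat w $ 1 $ 1" "b' = word_mat w $ 1 $ 2"
    "c' = word_mat w $ 2 $ 1" "d' = word_mat w $ 2 $ 2"
  have w: "word_mat w = mat2 a' b' c' d'"
    by (simp add: a'_b'_c'_d'_def mat2_collapse)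
  have "mat2 a b c d = (if x = 0 then mat2 1 1 0 1 else mat2 1 0 1 1) ** mat2 a' b' c' d'"
    using Cons.prems[symmetric] by (auto simp: w A_mat_mat2 B_mat_mat2)
  from arg_cong[OF this, of "\<lambda>M. (M $ 1 $ 1, M $ 1 $ 2, M $ 2 $ 1, M $ 2 $ 2)"]
  show ?case
    using Cons.IH[OF w]
    by (auto simp: word_mat_append A_mat_mat2 B_mat_mat2 mat2_mult mat_1_mat2 add.commute split: if_splits)
qed

lemma det_word_mat: "det (word_mat w) = 1"
proof (induction w)
  case (Cons x w)
  have "det A_mat = 1" "det B_mat = 1"
    by (simp_all add: A_mat_mat2 B_mat_mat2 det_2)
  with Cons show ?case by (simp add: det_mul)
qed (simp add: mat_1_mat2 det_2)

text \<open>Left multiplication by A or B undoes one subtraction on the column (x, w). Since ties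
  are resolved by subtracting from w, a coprime pair ends in (1, 0), the first column of the empty
  word's matrix.\<close>

lemma word_mat_euc:
  "x > 0 \<Longrightarrow> coprime x w \<Longrightarrow> \<exists>b d. word_mat (euc x w) = mat2 (int x) b (int w) d"
proof (induction x w rule: euc.induct)
  case (1 x w)
  consider "w = 0" | "w > 0" "w < x" | "w > 0" "x \<le> w" by linarith
  then show ?case
  proof cases
    case 1
    then have "x = 1" using "1.prems" by simp
    then show ?thesis
      using 1 by (subst euc.simps) (auto simp: mat_1_mat2)
  next
    case 2
    then have "coprime (x - w) w"
      using "1.prems" by (simp add: coprime_iff_gcd_eq_1 gcd_diff1_nat)
    then obtain b d where "word_mat (euc (x - w) w) = mat2 (int (x - w)) b (int w) d"
      using "1.IH"(1) 2 by auto
    then show ?thesis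
      using 2 by (subst euc.simps) (auto simp: A_mat_mat2 mat2_mult of_nat_diff)
  next
    case 3
    then have "coprime x (w - x)"
      using "1.prems" by (metis coprime_iff_gcd_eq_1 gcd_diff1_nat gcd.commute)
    then obtain b d where "word_mat (euc x (w - x)) = mat2 (int x) b (int (w - x)) d"
      using "1.IH"(2) 3 "1.prems" by auto
    then show ?thesis
      using 3 "1.prems" by (subst euc.simps) (auto simp: B_mat_mat2 mat2_mult of_nat_diff)
  qed
qed

lemma set_euc: "set (euc x w) \<subseteq> {0, 1}"
proof (induction x w rule: euc.induct)
  case (1 x w)
  then show ?case by (subst euc.simps) auto
qed

lemma word_mat_replicate: "word_mat (replicate r 0) = mat2 1 (int r) 0 1"
  by (induction r) (simp_all add: mat_1_mat2 A_mat_mat2 mat2_mult add.commute)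

section \<open>Powers of A and factorizations modulo p\<close>

lemma mat_mod_eq_mult:
  assumes "mat_mod p M = mat_mod p M'" "mat_mod p N = mat_mod p N'"
  shows "mat_mod p (M ** N) = mat_mod p (M' ** N')"
  by (metis assms mat_mod_mult_left mat_mod_mult_right)

lemma mat_mod_mat2_eqI:
  assumes "[a = a'] (mod int p)" "[b = b'] (mod int p)" "[c = c'] (mod int p)" "[d = d'] (mod int p)"
  shows "mat_mod p (mat2 a b c d) = mat_mod p (mat2 a' b' c' d')"
  using assms by (intro mat2_eqI) (simp_all add: cong_def)

text \<open>Modulo p, T is upper triangular with diagonal (y, d) and y d = 1, while rev(T) has
  diagonal (d, y) and the same corner b. The product thus behaves like a conjugation of A^e, except
  that the corners add up to 2 y b and do not cancel.\<close>

lemma word_mat_conj: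
  assumes T: "word_mat T = mat2 N b M d" and N: "[N = y] (mod int p)" and M: "int p dvd M"
  shows "mat_mod p (word_mat T ** mat2 1 e 0 1 ** word_mat (rev T)) = mat_mod p (mat2 1 (y\<^sup>2 * e + 2 * y * b) 0 1)"
proof -
  have M': "[M * z = 0] (mod int p)" for z
    using M by (simp add: cong_0_iff)
  have "det (word_mat T) = 1" by (rule det_word_mat)
  then have det: "N * d = 1 + M * b"
    by (simp add: T det_2 mult.commute)
  have "word_mat T ** mat2 1 e 0 1 ** word_mat (rev T) =
      mat2 (1 + M * (2 * b + N * e)) (N * N * e + 2 * N * b) (0 + M * (2 * d + M * e)) (1 + M * (2 * b + N * e))"
    using det by (simp add: T word_mat_rev[OF T] mat2_mult algebra_simps)
  also have "mat_mod p \<dots> = mat_mod p (mat2 1 (y\<^sup>2 * e + 2 * y * b) 0 1)"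
    using cong_add[OF cong_refl M', of 1] cong_add[OF cong_refl M', of 0] N
    by (intro mat_mod_mat2_eqI) (auto simp: power2_eq_square intro!: cong_add cong_mult)
  finally show ?thesis .
qed

text \<open>This packing lets a register hold a whole word; the length is kept apart because leading
  zeros are letters. Appending a letter is a doubling, and prepending one, as the reversed word
  requires, adds a top digit (\<open>bin_word_Cons\<close>).\<close>

primrec bin_word :: "nat \<Rightarrow> nat \<Rightarrow> nat list" where
  "bin_word x 0 = []"
| "bin_word x (Suc i) = bin_word (x div 2) i @ [x mod 2]"

lemma length_bin_word [simp]: "length (bin_word x i) = i"
  by (induction i arbitrary: x) simp_all

lemma bin_word_0 [simp]: "bin_word 0 i = replicate i 0"
  by (induction i) (simp_all add: replicate_append_same)

lemma bin_word_Cons: "x < 2 ^ i \<Longrightarrow> l < 2 \<Longrightarrow> bin_word (x + l * 2 ^ i) (Suc i) = l # bin_word x i"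
proof (induction i arbitrary: x)
  case (Suc i)
  have "x + l * 2 ^ Suc i = x + 2 * (l * 2 ^ i)"
    by simp
  then have "(x + l * 2 ^ Suc i) div 2 = x div 2 + l * 2 ^ i" "(x + l * 2 ^ Suc i) mod 2 = x mod 2"
    by (simp_all only: div_mult_self2 mod_mult_self2)
  moreover have "bin_word (x div 2 + l * 2 ^ i) (Suc i) = l # bin_word (x div 2) i"
    using Suc.prems by (intro Suc.IH) auto
  ultimately show ?case
    by (subst bin_word.simps(2)) (simp del: bin_word.simps(2) add: bin_word.simps(2)[of x i])
qed simp

text \<open>The Bruhat decomposition, with \<open>A\<^sup>-\<^sup>1 B A\<^sup>-\<^sup>1\<close> as the Weyl element.\<close>

lemma bruhat:
  assumes det: "[a * d - b * c = 1] (mod int p)" and r: "[r * c = 1] (mod int p)"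
    and x: "[x = (a + 1 - c) * r] (mod int p)" and s: "[s = c - 2] (mod int p)"
    and z: "[z = (d + 1 - c) * r] (mod int p)"
  shows "mat_mod p (mat2 1 x 0 1 ** (B_mat ** (mat2 1 s 0 1 ** (B_mat ** mat2 1 z 0 1)))) = mat_mod p (mat2 a b c d)"
proof -
  have "mat_mod p (mat2 1 x 0 1 ** (B_mat ** (mat2 1 s 0 1 ** (B_mat ** mat2 1 z 0 1)))) =
      mat_mod p (mat2 (1 + s + x * (2 + s)) (s + x * (1 + s) + z * (1 + s + x * (2 + s))) (2 + s) ((1 + s) + z * (2 + s)))"
    by (simp add: B_mat_mat2 mat2_mult algebra_simps)
  also have "\<dots> = mat_mod p (mat2 a b c d)"
  proof (rule mat_mod_mat2_eqI)
    \<comment> \<open>B A^s B has the lower left entry s + 2, which is why s is c - 2. The outer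
      powers of A then adjust the two diagonal entries.\<close>
    have c: "[2 + s = c] (mod int p)" "[1 + s = c - 1] (mod int p)"
      using cong_add[OF cong_refl s, of 2] cong_add[OF cong_refl s, of 1] by simp_all
    have unit: "[u * r * c = u] (mod int p)" for u
      using cong_mult[OF cong_refl r, of u] by (simp add: mult.assoc)
    have xc: "[x * c = a + 1 - c] (mod int p)"
      using cong_mult[OF x cong_refl, of c] unit cong_trans by blast
    have zc: "[z * c = d + 1 - c] (mod int p)"
      using cong_mult[OF z cong_refl, of c] unit cong_trans by blast
    have "[1 + s + x * (2 + s) = (c - 1) + x * c] (mod int p)"
      using c by (intro cong_add cong_mult) auto
    also have "[(c - 1) + x * c = (c - 1) + (a + 1 - c)] (mod int p)"
      using xc by (intro cong_add) auto
    finally show a: "[1 + s + x * (2 + s) = a] (mod int p)" by simp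
    have "[1 + s + z * (2 + s) = (c - 1) + z * c] (mod int p)"
      using c by (intro cong_add cong_mult) auto
    also have "[(c - 1) + z * c = (c - 1) + (d + 1 - c)] (mod int p)"
      using zc by (intro cong_add) auto
    finally show "[1 + s + z * (2 + s) = d] (mod int p)" by simp
    show "[2 + s = c] (mod int p)" by (rule c)
    \<comment> \<open>The upper right entry has no exponent left to adjust it. It is compared after
      multiplication by the unit c, where the determinant fixes it.\<close>
    define e where "e = s + x * (1 + s) + z * (1 + s + x * (2 + s))"
    have "[e = (c - 2) + x * (c - 1) + z * a] (mod int p)"
      unfolding e_def using s c a by (intro cong_add cong_mult) auto
    then have "[e * c = ((c - 2) + x * (c - 1) + z * a) * c] (mod int p)"
      by (rule cong_mult) auto
    also have "((c - 2) + x * (c - 1) + z * a) * c = (c - 2) * c + (x * c) * (c - 1) + (z * c) * a"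
      by (simp add: algebra_simps)
    also have "[\<dots> = (c - 2) * c + (a + 1 - c) * (c - 1) + (d + 1 - c) * a] (mod int p)"
      using xc zc by (intro cong_add cong_mult) auto
    also have "(c - 2) * c + (a + 1 - c) * (c - 1) + (d + 1 - c) * a = (a * d - b * c) - 1 + b * c"
      by (simp add: algebra_simps)
    also have "[\<dots> = 1 - 1 + b * c] (mod int p)"
      using det by (intro cong_add cong_diff) auto
    finally have ec: "[e * c = b * c] (mod int p)" by simp
    have "[e = e * r * c] (mod int p)"
      by (rule cong_sym) (rule unit)
    also have "e * r * c = (e * c) * r" by simp
    also have "[(e * c) * r = (b * c) * r] (mod int p)"
      by (rule cong_mult[OF ec cong_refl])
    also have "(b * c) * r = b * r * c" by simp
    also have "[b * r * c = b] (mod int p)" by (rule unit)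
    finally show "[e = b] (mod int p)" .
  qed
  finally show ?thesis .
qed

text \<open>The sum \<beta> (1 + \<alpha> + ... + \<alpha>^(k-1)): the exponent that Horner's scheme
  accumulates from the constant 2 y b of each conjugation.\<close>

primrec geom :: "nat \<Rightarrow> nat \<Rightarrow> nat \<Rightarrow> nat" where
  "geom \<alpha> \<beta> 0 = 0"
| "geom \<alpha> \<beta> (Suc k) = geom \<alpha> \<beta> k * \<alpha> + \<beta>"

text \<open>One Horner step. All copies of rev(T) already stand at the right end of W; putting
  \<open>T\<close> in front consumes one of them, and the block of r zeros supplies the next
  digit.\<close>

lemma expansion_step:
  assumes T: "word_mat T = mat2 N (int v) M d" "[N = int y] (mod int p)" "int p dvd M"
    and W: "mat_mod p (word_mat W) = mat_mod p (mat2 1 (int e) 0 1 ** word_mat (concat (replicate (Suc i) (rev T))))"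
  shows "mat_mod p (word_mat (replicate r 0 @ T @ W)) =
    mat_mod p (mat2 1 (int (r + (y\<^sup>2 * e + 2 * y * v))) 0 1 ** word_mat (concat (replicate i (rev T))))"
proof -
  let ?R = "word_mat (concat (replicate i (rev T)))"
  have "mat_mod p (word_mat (replicate r 0 @ T @ W)) = mat_mod p (mat2 1 (int r) 0 1 ** (word_mat T ** word_mat W))"
    by (simp add: word_mat_append word_mat_replicate)
  also have "\<dots> = mat_mod p (mat2 1 (int r) 0 1 ** (word_mat T ** (mat2 1 (int e) 0 1 ** word_mat (concat (replicate (Suc i) (rev T))))))"
    by (intro mat_mod_eq_mult W refl)
  also have "\<dots> = mat_mod p (mat2 1 (int r) 0 1 ** ((word_mat T ** mat2 1 (int e) 0 1 ** word_mat (rev T)) ** ?R))"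
    by (simp add: word_mat_append matrix_mul_assoc)
  also have "\<dots> = mat_mod p (mat2 1 (int r) 0 1 ** (mat2 1 ((int y)\<^sup>2 * int e + 2 * int y * int v) 0 1 ** ?R))"
    by (intro mat_mod_eq_mult word_mat_conj[OF T] refl)
  also have "\<dots> = mat_mod p (mat2 1 (int (r + (y\<^sup>2 * e + 2 * y * v))) 0 1 ** ?R)"
    by (simp add: matrix_mul_assoc mat2_mult ac_simps)
  finally show ?thesis .
qed

section \<open>Program logic for expected running time\<close>

lemma nn_integral_bind_spmf:
  "(\<integral>\<^sup>+ x. f x \<partial>measure_spmf (bind_spmf p k)) = (\<integral>\<^sup>+ y. (\<integral>\<^sup>+ x. f x \<partial>measure_spmf (k y)) \<partial>measure_spmf p)"
  by (simp add: measure_spmf_bind o_def nn_integral_bind[where B = "count_space UNIV"])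

lemma nn_integral_mono_spmf:
  assumes "\<And>x. x \<in> set_spmf p \<Longrightarrow> f x \<le> g x"
  shows "(\<integral>\<^sup>+ x. f x \<partial>measure_spmf p) \<le> (\<integral>\<^sup>+ x. g x \<partial>measure_spmf p)"
  using assms by (intro nn_integral_mono_AE) auto

text \<open>Monotone convergence along a chain. It applies because the supremum has countable
  support, to which all integrals can be restricted.\<close>

lemma nn_integral_lub_spmf:
  assumes chain: "Complete_Partial_Order.chain (ord_spmf (=)) Y" and Y: "Y \<noteq> {}"
  shows "(\<integral>\<^sup>+ x. f x \<partial>measure_spmf (lub_spmf Y)) = (SUP y\<in>Y. \<integral>\<^sup>+ x. f x \<partial>measure_spmf y)"
proof -
  let ?M = "count_space (set_spmf (lub_spmf Y))"
  have "(\<integral>\<^sup>+ x. f x \<partial>measure_spmf (lub_spmf Y)) = (\<integral>\<^sup>+ x. ennreal (spmf (lub_spmf Y) x) * f x \<partial>?M)"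
    by (rule nn_integral_measure_spmf')
  also have "\<dots> = (\<integral>\<^sup>+ x. (SUP y\<in>Y. ennreal (spmf y x) * f x) \<partial>?M)"
    by (simp add: ennreal_spmf_lub_spmf[OF chain Y] SUP_mult_right_ennreal)
  also have "\<dots> = (SUP y\<in>Y. \<integral>\<^sup>+ x. ennreal (spmf y x) * f x \<partial>?M)"
    using Y
  proof (rule nn_integral_monotone_convergence_SUP_countable)
    have "(\<lambda>i x. ennreal (spmf i x) * f x) ` Y = (\<lambda>h x. h x * f x) ` (\<lambda>p x. ennreal (spmf p x)) ` Y"
      by (simp add: image_image)
    also have "Complete_Partial_Order.chain (\<le>) \<dots>"
      using chain_ord_spmf_eqD[OF chain] by (rule chain_imageI) (auto simp: le_fun_def mult_right_mono)
    finally show "Complete_Partial_Order.chain (\<le>) ((\<lambda>i x. ennreal (spmf i x) * f x) ` Y)" .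
  qed simp
  also have "\<dots> = (SUP y\<in>Y. \<integral>\<^sup>+ x. ennreal (spmf y x) * f x \<partial>count_space UNIV)"
    by (auto simp: nn_integral_count_space_indicator set_lub_spmf[OF chain] spmf_eq_0_set_spmf
        split: split_indicator intro!: arg_cong[of _ _ Sup] image_cong nn_integral_cong)
  also have "\<dots> = (SUP y\<in>Y. \<integral>\<^sup>+ x. f x \<partial>measure_spmf y)"
    by (simp add: nn_integral_measure_spmf)
  finally show ?thesis .
qed

text \<open>A potential that does not grow in expectation bounds the expected final value. Fixpoint
  induction proves this without any knowledge of termination, since diverging mass contributes
  nothing to the integral.\<close>

lemma nn_integral_while_spmf_le:
  fixes g :: "'s \<Rightarrow> bool"
  assumes inv: "\<And>\<sigma> \<tau>. I \<sigma> \<Longrightarrow> g \<sigma> \<Longrightarrow> \<tau> \<in> set_spmf (b \<sigma>) \<Longrightarrow> I \<tau>"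
    and step: "\<And>\<sigma>. I \<sigma> \<Longrightarrow> g \<sigma> \<Longrightarrow> (\<integral>\<^sup>+ \<tau>. \<phi> \<tau> \<partial>measure_spmf (b \<sigma>)) \<le> \<phi> \<sigma>"
    and stop: "\<And>\<sigma>. I \<sigma> \<Longrightarrow> \<not> g \<sigma> \<Longrightarrow> f \<sigma> \<le> \<phi> \<sigma>"
    and I: "I \<sigma>"
  shows "(\<integral>\<^sup>+ \<tau>. f \<tau> \<partial>measure_spmf (while_spmf g b \<sigma>)) \<le> \<phi> \<sigma>"
proof -
  define P where "P w \<longleftrightarrow> (\<forall>\<sigma>. I \<sigma> \<longrightarrow> (\<integral>\<^sup>+ \<tau>. f \<tau> \<partial>measure_spmf (w g b \<sigma>)) \<le> \<phi> \<sigma>)"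
    for w :: "('s \<Rightarrow> bool) \<Rightarrow> ('s \<Rightarrow> 's spmf) \<Rightarrow> 's \<Rightarrow> 's spmf"
  have "P while_spmf"
  proof (rule while_spmf.fixp_induct[of P])
    show "spmf.admissible (\<lambda>w. P (curry (curry w)))"
    proof (rule ccpo.admissibleI)
      fix A :: "((('s \<Rightarrow> bool) \<times> ('s \<Rightarrow> 's spmf)) \<times> 's \<Rightarrow> 's spmf) set"
      assume chain: "Complete_Partial_Order.chain spmf.le_fun A" and A: "A \<noteq> {}"
        and P: "\<forall>w\<in>A. P (curry (curry w))"
      have "(\<integral>\<^sup>+ \<tau>. f \<tau> \<partial>measure_spmf (spmf.lub_fun A ((g, b), \<sigma>))) \<le> \<phi> \<sigma>" if "I \<sigma>" for \<sigma>
      proof -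
        let ?Y = "{y. \<exists>w\<in>A. y = w ((g, b), \<sigma>)}"
        have "Complete_Partial_Order.chain (ord_spmf (=)) ?Y"
          using chain by (rule chain_fun)
        then have "(\<integral>\<^sup>+ \<tau>. f \<tau> \<partial>measure_spmf (lub_spmf ?Y)) = (SUP y\<in>?Y. \<integral>\<^sup>+ \<tau>. f \<tau> \<partial>measure_spmf y)"
          using A by (intro nn_integral_lub_spmf) auto
        also have "\<dots> \<le> \<phi> \<sigma>"
          using P that by (intro SUP_least) (auto simp: P_def)
        finally show ?thesis by (simp add: fun_lub_def)
      qed
      then show "P (curry (curry (spmf.lub_fun A)))"
        by (simp add: P_def)
    qed
    show "P (\<lambda>_ _ _. return_pmf None)"
      by (simp add: P_def)
    fix w assume w: "P w"
    show "P (\<lambda>g b \<sigma>. if g \<sigma> then bind_spmf (b \<sigma>) (w g b) else return_spmf \<sigma>)"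
      unfolding P_def
    proof (intro allI impI)
      fix \<sigma> assume \<sigma>: "I \<sigma>"
      show "(\<integral>\<^sup>+ \<tau>. f \<tau> \<partial>measure_spmf (if g \<sigma> then bind_spmf (b \<sigma>) (w g b) else return_spmf \<sigma>)) \<le> \<phi> \<sigma>"
      proof (cases "g \<sigma>")
        case True
        have "(\<integral>\<^sup>+ \<tau>. f \<tau> \<partial>measure_spmf (bind_spmf (b \<sigma>) (w g b))) \<le> (\<integral>\<^sup>+ \<tau>. \<phi> \<tau> \<partial>measure_spmf (b \<sigma>))"
          unfolding nn_integral_bind_spmf
          using w inv[OF \<sigma> True] by (intro nn_integral_mono_spmf) (simp add: P_def)
        also have "\<dots> \<le> \<phi> \<sigma>"
          using step[OF \<sigma> True] .
        finally show ?thesis using True by simp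
      next
        case False
        then show ?thesis
          using stop[OF \<sigma> False] by (simp add: measure_spmf_return_spmf nn_integral_return)
      qed
    qed
  qed
  with I show ?thesis by (simp add: P_def)
qed

text \<open>The previous bound, applied to the indicator of the bad outcomes with potential
  0.\<close>

lemma while_spmf_invariant:
  assumes inv: "\<And>\<sigma> \<tau>. I \<sigma> \<Longrightarrow> g \<sigma> \<Longrightarrow> \<tau> \<in> set_spmf (b \<sigma>) \<Longrightarrow> I \<tau>"
    and I: "I \<sigma>" and \<tau>: "\<tau> \<in> set_spmf (while_spmf g b \<sigma>)"
  shows "I \<tau> \<and> \<not> g \<tau>"
proof (rule ccontr)
  assume neg: "\<not> (I \<tau> \<and> \<not> g \<tau>)"
  let ?f = "\<lambda>\<sigma>. indicator {\<sigma>. \<not> (I \<sigma> \<and> \<not> g \<sigma>)} \<sigma> :: ennreal"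
  have "(\<integral>\<^sup>+ \<tau>. ?f \<tau> \<partial>measure_spmf (while_spmf g b \<sigma>)) \<le> 0"
    using inv I by (intro nn_integral_while_spmf_le[where I = I]) auto
  then have "(\<integral>\<^sup>+ \<tau>. ?f \<tau> \<partial>measure_spmf (while_spmf g b \<sigma>)) = 0"
    by (simp only: le_zero_eq)
  then have "AE \<tau> in measure_spmf (while_spmf g b \<sigma>). ?f \<tau> = 0"
    by (subst (asm) nn_integral_0_iff_AE) simp_all
  with \<tau> neg show False by (auto simp: indicator_def)
qed

text \<open>Let r be the infimum of the termination probabilities over all states of the invariant.
  One unfolding shows that each of them is at least r + (1 - r) min(\<delta>, 1), hence so is r
  itself, and this forces r = 1.\<close>

lemma lossless_while_spmf:
  fixes \<delta> :: real
  assumes inv: "\<And>\<sigma> \<tau>. I \<sigma> \<Longrightarrow> g \<sigma> \<Longrightarrow> \<tau> \<in> set_spmf (b \<sigma>) \<Longrightarrow> I \<tau>"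
    and lossless: "\<And>\<sigma>. I \<sigma> \<Longrightarrow> g \<sigma> \<Longrightarrow> lossless_spmf (b \<sigma>)"
    and stop: "\<And>\<sigma>. I \<sigma> \<Longrightarrow> g \<sigma> \<Longrightarrow> \<delta> \<le> measure (measure_spmf (b \<sigma>)) {\<tau>. \<not> g \<tau>}"
    and \<delta>: "\<delta> > 0" and I: "I \<sigma>"
  shows "lossless_spmf (while_spmf g b \<sigma>)"
proof -
  define w where "w \<sigma> = weight_spmf (while_spmf g b \<sigma>)" for \<sigma>
  define r where "r = (INF \<sigma>\<in>Collect I. w \<sigma>)"
  have w01: "0 \<le> w \<sigma>" "w \<sigma> \<le> 1" for \<sigma>
    by (simp_all add: w_def weight_spmf_nonneg weight_spmf_le_1)
  have r_le: "r \<le> w \<sigma>" if "I \<sigma>" for \<sigma>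
    unfolding r_def using that w01 by (intro cINF_lower bdd_belowI2[where m = 0]) auto
  have w_stop: "w \<sigma> = 1" if "\<not> g \<sigma>" for \<sigma>
    using that by (simp add: w_def while_spmf.simps)
  have r1: "r \<le> 1" using r_le[OF I] w01[of \<sigma>] by simp
  \<comment> \<open>Where the guard fails already, the probability is 1; the minimum with 1 makes
    the bound valid there too.\<close>
  have "r + (1 - r) * min \<delta> 1 \<le> w \<sigma>" if \<sigma>: "I \<sigma>" for \<sigma>
  proof (cases "g \<sigma>")
    case True
    let ?M = "measure_spmf (b \<sigma>)" and ?A = "{\<tau>. \<not> g \<tau>}"
    have "while_spmf g b \<sigma> = bind_spmf (b \<sigma>) (while_spmf g b)"
      using True by (subst while_spmf.simps) simp
    then have "w \<sigma> = weight_spmf (bind_spmf (b \<sigma>) (while_spmf g b))"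
      by (simp only: w_def)
    also have "\<dots> = (\<integral>\<tau>. w \<tau> \<partial>?M)"
      by (simp only: weight_bind_spmf w_def[abs_def] o_def)
    finally have "w \<sigma> = (\<integral>\<tau>. w \<tau> \<partial>?M)" .
    also have "\<dots> \<ge> (\<integral>\<tau>. r + (1 - r) * indicator ?A \<tau> \<partial>?M)"
    proof (rule integral_mono_AE)
      show "integrable ?M w"
        using w01 by (intro measure_spmf.integrable_const_bound[where B = 1]) auto
      show "integrable ?M (\<lambda>\<tau>. r + (1 - r) * indicator ?A \<tau>)"
        by (intro Bochner_Integration.integrable_add integrable_mult_right integrable_real_indicator)
           (auto simp: measure_spmf.emeasure_eq_measure)
      show "AE \<tau> in ?M. r + (1 - r) * indicator ?A \<tau> \<le> w \<tau>"
        using inv[OF \<sigma> True] r_le w_stop by (auto simp: indicator_def)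
    qed
    also have "(\<integral>\<tau>. r + (1 - r) * indicator ?A \<tau> \<partial>?M) = r + (1 - r) * measure ?M ?A"
      using lossless[OF \<sigma> True]
      by (subst Bochner_Integration.integral_add)
         (auto simp: lossless_weight_spmfD measure_spmf.emeasure_eq_measure intro!: integrable_mult_right integrable_real_indicator)
    also have "\<dots> \<ge> r + (1 - r) * min \<delta> 1"
      using stop[OF \<sigma> True] r1 by (intro add_left_mono mult_left_mono) auto
    finally show ?thesis by simp
  next
    case False
    have "(1 - r) * min \<delta> 1 \<le> (1 - r) * 1"
      using r1 by (intro mult_left_mono) auto
    with False show ?thesis by (simp add: w_stop)
  qed
  then have "r + (1 - r) * min \<delta> 1 \<le> (INF \<sigma>\<in>Collect I. w \<sigma>)"
    using I by (intro cINF_greatest) auto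
  then have "r + (1 - r) * min \<delta> 1 \<le> r"
    by (simp only: r_def)
  then have "(1 - r) * min \<delta> 1 \<le> 0" by simp
  then have "1 \<le> r"
    using \<delta> by (auto simp: mult_le_0_iff min_def split: if_splits)
  then have "w \<sigma> = 1"
    using r_le[OF I] w01[of \<sigma>] by simp
  then show ?thesis
    by (simp add: w_def lossless_spmf_def)
qed

section \<open>Hoare triples with expected cost\<close>

type_synonym assertion = "(nat \<Rightarrow> nat) \<Rightarrow> (nat \<Rightarrow> nat list) \<Rightarrow> bool"

primrec expr_val :: "expr \<Rightarrow> (nat \<Rightarrow> nat) \<Rightarrow> (nat \<Rightarrow> nat list) \<Rightarrow> nat" where
  "expr_val (Const c) n s = c"
| "expr_val (Reg x) n s = n x"
| "expr_val (IsEmpty k) n s = of_bool (s k = [])"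
| "expr_val (Bin f a b) n s = binop_val f (expr_val a n s) (expr_val b n s)"

lemma eval_expr_ev: "eval_expr a \<sigma> = expr_val a (num \<sigma>) (stk \<sigma>)"
  by (induction a) simp_all

text \<open>
  Up to the factor \<open>b + 1\<close>, these bound the bit length of the value and the cost of an expression
  over registers of at most \<open>b\<close> bits.
\<close>

primrec expr_width :: "expr \<Rightarrow> nat" where
  "expr_width (Const c) = bit_length c"
| "expr_width (Reg x) = 1"
| "expr_width (IsEmpty k) = 1"
| "expr_width (Bin f a b) = expr_width a + expr_width b + 1"

primrec expr_cost :: "expr \<Rightarrow> nat" where
  "expr_cost (Const c) = 1 + bit_length c"
| "expr_cost (Reg x) = 1"
| "expr_cost (IsEmpty k) = 1"
| "expr_cost (Bin f a b) = 2 + expr_cost a + expr_cost b + expr_width (Bin f a b)"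

definition regs_bounded :: "nat \<Rightarrow> (nat \<Rightarrow> nat) \<Rightarrow> bool" where
  "regs_bounded b n \<longleftrightarrow> (\<forall>x. n x < 2 ^ b)"

lemma bit_length_le_iff: "bit_length n \<le> b \<longleftrightarrow> n < 2 ^ b"
  by (simp add: bit_length_def floorlog_le_iff)

lemma less_power_bit_length: "n < 2 ^ bit_length n"
  using bit_length_le_iff by blast

lemma binop_val_bound:
  assumes "m < 2 ^ i" "n < 2 ^ j"
  shows "binop_val f m n < 2 ^ (i + j + 1)"
proof -
  have ge: "(2::nat) ^ (i + j + 1) \<ge> 2 ^ i" "(2::nat) ^ (i + j + 1) > 1"
    using power_increasing[of i "i + j + 1" "2::nat"] one_less_power[of "2::nat" "i + j + 1"] by simp_all
  have "m + n < 2 ^ i + 2 ^ j" using assms by simp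
  also have "\<dots> \<le> 2 ^ (i + j) + 2 ^ (i + j)" by (intro add_mono power_increasing) auto
  finally have add: "m + n < 2 ^ (i + j + 1)" by simp
  have "m * n \<le> 2 ^ i * 2 ^ j" using assms by (intro mult_le_mono) auto
  also have "\<dots> < 2 ^ (i + j + 1)" by (simp add: power_add)
  finally have mul: "m * n < 2 ^ (i + j + 1)" .
  have "binop_val f m n < t" if "m < t" "1 < t" "m + n < t" "m * n < t" for t
    using that by (cases f) (auto intro: le_less_trans[OF div_le_dividend] le_less_trans[OF mod_less_eq_dividend] le_less_trans[OF diff_le_self])
  then show ?thesis
    using assms(1) ge add mul by simp
qed

lemma eval_expr_width:
  assumes "regs_bounded b (num \<sigma>)"
  shows "bit_length (eval_expr a \<sigma>) \<le> expr_width a * (b + 1)"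
proof (induction a)
  case (Bin f a1 a2)
  then have "binop_val f (eval_expr a1 \<sigma>) (eval_expr a2 \<sigma>) < 2 ^ (expr_width a1 * (b + 1) + expr_width a2 * (b + 1) + 1)"
    unfolding bit_length_le_iff by (rule binop_val_bound)
  also have "\<dots> \<le> 2 ^ (expr_width (Bin f a1 a2) * (b + 1))"
    by (intro power_increasing) (auto simp: algebra_simps)
  finally show ?case by (simp add: bit_length_le_iff)
next
  case (Reg x)
  have "num \<sigma> x < 2 ^ b" using assms by (simp add: regs_bounded_def)
  then show ?case by (simp add: bit_length_le_iff)
next
  case (IsEmpty k)
  have "(1::nat) < 2 ^ (b + 1)" by (rule one_less_power) auto
  then show ?case
    by (simp add: bit_length_le_iff)
qed simp_all

lemma cost_expr_le:
  assumes "regs_bounded b (num \<sigma>)"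
  shows "cost_expr a \<sigma> \<le> expr_cost a * (b + 1)"
proof (induction a)
  case (Reg x)
  then show ?case
    using assms by (simp add: regs_bounded_def bit_length_le_iff)
next
  case (Bin f a1 a2)
  then show ?case
    using eval_expr_width[OF assms, of "Bin f a1 a2"] by (simp add: algebra_simps)
qed simp_all

text \<open>Correctness is demanded of every outcome, but time only in expectation. The bound on the
  registers is part of the postcondition because the cost of whatever runs next depends on
  it.\<close>

definition spec :: "nat \<Rightarrow> config spmf \<Rightarrow> assertion \<Rightarrow> nat \<Rightarrow> bool" where
  "spec b \<mu> Q t \<longleftrightarrow>
     lossless_spmf \<mu> \<and> (\<forall>\<tau>\<in>set_spmf \<mu>. regs_bounded b (num \<tau>) \<and> Q (num \<tau>) (stk \<tau>)) \<and>
     (\<integral>\<^sup>+ \<tau>. of_nat (time \<tau>) \<partial>measure_spmf \<mu>) \<le> of_nat t"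

text \<open>Time is measured in units of b + 1, the price of touching one register, so that
  \<open>k\<close> depends on expressions and round counts only. The initial time is part of the
  bound so that triples can be chained.\<close>

definition hoare :: "nat \<Rightarrow> assertion \<Rightarrow> prog \<Rightarrow> assertion \<Rightarrow> nat \<Rightarrow> bool" where
  "hoare b P c Q k \<longleftrightarrow>
     (\<forall>\<sigma> :: config. regs_bounded b (num \<sigma>) \<longrightarrow> P (num \<sigma>) (stk \<sigma>) \<longrightarrow> spec b (exec c \<sigma>) Q (time \<sigma> + k * (b + 1)))"

lemma hoareD:
  "hoare b P c Q k \<Longrightarrow> regs_bounded b (num \<sigma>) \<Longrightarrow> P (num \<sigma>) (stk \<sigma>) \<Longrightarrow>
    spec b (exec c \<sigma>) Q (time \<sigma> + k * (b + 1))"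
  by (simp add: hoare_def)

lemma spec_return:
  "spec b (return_spmf \<tau>) Q t \<longleftrightarrow> regs_bounded b (num \<tau>) \<and> Q (num \<tau>) (stk \<tau>) \<and> time \<tau> \<le> t"
  by (simp add: spec_def measure_spmf_return_spmf nn_integral_return)

lemma spec_bind:
  assumes "spec b \<mu> R t"
    and f: "\<And>\<tau>. \<tau> \<in> set_spmf \<mu> \<Longrightarrow> regs_bounded b (num \<tau>) \<Longrightarrow> R (num \<tau>) (stk \<tau>) \<Longrightarrow> spec b (f \<tau>) Q (time \<tau> + k)"
  shows "spec b (bind_spmf \<mu> f) Q (t + k)"
proof -
  have \<mu>: "lossless_spmf \<mu>" "\<And>\<tau>. \<tau> \<in> set_spmf \<mu> \<Longrightarrow> spec b (f \<tau>) Q (time \<tau> + k)"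
    "(\<integral>\<^sup>+ \<tau>. of_nat (time \<tau>) \<partial>measure_spmf \<mu>) \<le> of_nat t"
    using assms by (auto simp: spec_def)
  have "(\<integral>\<^sup>+ \<tau>. of_nat (time \<tau>) \<partial>measure_spmf (bind_spmf \<mu> f)) \<le> (\<integral>\<^sup>+ \<tau>. of_nat (time \<tau> + k) \<partial>measure_spmf \<mu>)"
    unfolding nn_integral_bind_spmf using \<mu>(2) by (intro nn_integral_mono_spmf) (simp add: spec_def)
  also have "\<dots> = (\<integral>\<^sup>+ \<tau>. of_nat (time \<tau>) \<partial>measure_spmf \<mu>) + of_nat k * emeasure (measure_spmf \<mu>) (space (measure_spmf \<mu>))"
    by (simp add: nn_integral_add)
  also have "\<dots> \<le> of_nat t + of_nat k * 1"
    using \<mu>(3) by (intro add_mono mult_left_mono measure_spmf.emeasure_space_le_1) auto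
  finally show ?thesis
    using \<mu> by (auto simp: spec_def set_bind_spmf)
qed

lemma spec_weaken:
  assumes "spec b \<mu> Q' t'" "t' \<le> t" "\<And>n s. regs_bounded b n \<Longrightarrow> Q' n s \<Longrightarrow> Q n s"
  shows "spec b \<mu> Q t"
proof -
  have "of_nat t' \<le> (of_nat t :: ennreal)"
    using assms(2) by (rule of_nat_mono)
  then show ?thesis
    using assms(1,3) order_trans by (fastforce simp: spec_def)
qed

lemma hoare_conseq:
  assumes "hoare b P' c Q' k'" "\<And>n s. regs_bounded b n \<Longrightarrow> P n s \<Longrightarrow> P' n s"
    "\<And>n s. regs_bounded b n \<Longrightarrow> Q' n s \<Longrightarrow> Q n s" "k' \<le> k"
  shows "hoare b P c Q k"
  unfolding hoare_def
proof (intro allI impI)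
  fix \<sigma> :: config assume "regs_bounded b (num \<sigma>)" "P (num \<sigma>) (stk \<sigma>)"
  with assms(1,2) have "spec b (exec c \<sigma>) Q' (time \<sigma> + k' * (b + 1))"
    by (auto simp: hoare_def)
  moreover have "time \<sigma> + k' * (b + 1) \<le> time \<sigma> + k * (b + 1)"
    using assms(4) by (intro add_left_mono mult_le_mono1)
  ultimately show "spec b (exec c \<sigma>) Q (time \<sigma> + k * (b + 1))"
    using assms(3) by (rule spec_weaken)
qed

lemma hoare_ghost:
  assumes "\<And>n0 s0. regs_bounded b n0 \<Longrightarrow> P n0 s0 \<Longrightarrow> hoare b (\<lambda>n s. n = n0 \<and> s = s0) c Q k"
  shows "hoare b P c Q k"
  using assms unfolding hoare_def by blast

lemma hoare_skip: "hoare b P Skip P 1"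
  by (simp add: hoare_def spec_return tick_def)

lemma hoare_assign:
  "hoare b (\<lambda>n s. expr_val a n s < 2 ^ b \<and> Q (n(x := expr_val a n s)) s) (Assign x a) Q (1 + expr_cost a)"
  unfolding hoare_def
proof (intro allI impI)
  fix \<sigma> :: config assume "regs_bounded b (num \<sigma>)"
    "expr_val a (num \<sigma>) (stk \<sigma>) < 2 ^ b \<and> Q ((num \<sigma>)(x := expr_val a (num \<sigma>) (stk \<sigma>))) (stk \<sigma>)"
  then show "spec b (exec (Assign x a) \<sigma>) Q (time \<sigma> + (1 + expr_cost a) * (b + 1))"
    using cost_expr_le[of b \<sigma> a]
    by (simp add: spec_return tick_def set_num_def eval_expr_ev regs_bounded_def)
qed

lemma hoare_push:
  "hoare b (\<lambda>n s. Q n (s(k := expr_val a n s # s k))) (Push k a) Q (1 + expr_cost a)"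
  unfolding hoare_def
proof (intro allI impI)
  fix \<sigma> :: config assume "regs_bounded b (num \<sigma>)"
    "Q (num \<sigma>) ((stk \<sigma>)(k := expr_val a (num \<sigma>) (stk \<sigma>) # stk \<sigma> k))"
  then show "spec b (exec (Push k a) \<sigma>) Q (time \<sigma> + (1 + expr_cost a) * (b + 1))"
    using cost_expr_le[of b \<sigma> a]
    by (simp add: spec_return tick_def set_stk_def eval_expr_ev)
qed

lemma hoare_pop:
  "hoare b (\<lambda>n s. s k \<noteq> [] \<and> hd (s k) < 2 ^ b \<and> Q (n(x := hd (s k))) (s(k := tl (s k)))) (Pop x k) Q 1"
  unfolding hoare_def
proof (intro allI impI)
  fix \<sigma> :: config assume "regs_bounded b (num \<sigma>)"
    "stk \<sigma> k \<noteq> [] \<and> hd (stk \<sigma> k) < 2 ^ b \<and>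
     Q ((num \<sigma>)(x := hd (stk \<sigma> k))) ((stk \<sigma>)(k := tl (stk \<sigma> k)))"
  then show "spec b (exec (Pop x k) \<sigma>) Q (time \<sigma> + 1 * (b + 1))"
    by (cases "stk \<sigma> k")
       (simp_all add: spec_return tick_def set_num_def set_stk_def regs_bounded_def bit_length_le_iff)
qed

lemma hoare_flip:
  "hoare b (\<lambda>n s. 0 < b \<and> Q (n(x := 0)) s \<and> Q (n(x := 1)) s) (Flip x) Q 1"
  unfolding hoare_def
proof (intro allI impI)
  fix \<sigma> :: config assume *: "regs_bounded b (num \<sigma>)"
    "0 < b \<and> Q ((num \<sigma>)(x := 0)) (stk \<sigma>) \<and> Q ((num \<sigma>)(x := 1)) (stk \<sigma>)"
  have "spec b coin Q' t" if "coin = map_spmf f coin_spmf" "Q' = Q" "t = time \<sigma> + 1 * (b + 1)"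
    "f = (\<lambda>b. tick 1 (set_num x (of_bool b) \<sigma>))" for coin f Q' t
  proof -
    have "(\<integral>\<^sup>+ \<tau>. of_nat (time \<tau>) \<partial>measure_spmf coin) = (\<integral>\<^sup>+ \<tau>. of_nat (time \<sigma> + 1) \<partial>measure_spmf coin_spmf)"
      by (simp add: that map_spmf_conv_bind_spmf nn_integral_bind_spmf measure_spmf_return_spmf
          nn_integral_return tick_def set_num_def)
    also have "\<dots> = of_nat (time \<sigma> + 1) * emeasure (measure_spmf coin_spmf) (space (measure_spmf coin_spmf))"
      by (rule nn_integral_const)
    also have "\<dots> \<le> of_nat (time \<sigma> + 1) * 1"
      by (intro mult_left_mono measure_spmf.emeasure_space_le_1) auto
    also have "\<dots> \<le> of_nat t"
      unfolding mult_1_right by (rule of_nat_mono) (simp add: that)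
    finally show ?thesis
      using * one_less_power[of "2::nat" b]
      by (auto simp: that spec_def tick_def set_num_def regs_bounded_def of_bool_def)
  qed
  then show "spec b (exec (Flip x) \<sigma>) Q (time \<sigma> + 1 * (b + 1))"
    by simp
qed

lemma hoare_seq:
  assumes "hoare b R d Q k'" "hoare b P c R k"
  shows "hoare b P (Seq c d) Q (k + k')"
  unfolding hoare_def
proof (intro allI impI)
  fix \<sigma> :: config assume "regs_bounded b (num \<sigma>)" "P (num \<sigma>) (stk \<sigma>)"
  then have "spec b (exec (Seq c d) \<sigma>) Q (time \<sigma> + k * (b + 1) + k' * (b + 1))"
    unfolding exec.simps by (intro spec_bind[OF hoareD[OF assms(2)] hoareD[OF assms(1)]])
  then show "spec b (exec (Seq c d) \<sigma>) Q (time \<sigma> + (k + k') * (b + 1))"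
    by (simp add: algebra_simps)
qed

lemma hoare_ite:
  assumes "hoare b P c Q k" "hoare b P' d Q k'"
  shows "hoare b (\<lambda>n s. if expr_val a n s \<noteq> 0 then P n s else P' n s) (Ite a c d) Q (1 + expr_cost a + k + k')"
  unfolding hoare_def
proof (intro allI impI)
  fix \<sigma> :: config assume *: "regs_bounded b (num \<sigma>)"
    "if expr_val a (num \<sigma>) (stk \<sigma>) \<noteq> 0 then P (num \<sigma>) (stk \<sigma>) else P' (num \<sigma>) (stk \<sigma>)"
  let ?\<sigma> = "tick (1 + cost_expr a \<sigma>) \<sigma>"
  have "spec b (exec (Ite a c d) \<sigma>) Q (time ?\<sigma> + (k + k') * (b + 1))"
  proof (cases "expr_val a (num \<sigma>) (stk \<sigma>) \<noteq> 0")
    case True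
    then have "spec b (exec c ?\<sigma>) Q (time ?\<sigma> + k * (b + 1))"
      using * by (intro hoareD[OF assms(1)]) (simp_all add: tick_def)
    moreover have "exec (Ite a c d) \<sigma> = exec c ?\<sigma>"
      using True by (simp add: eval_expr_ev)
    ultimately show ?thesis
      by (simp only:) (elim spec_weaken, auto simp: algebra_simps)
  next
    case False
    then have "spec b (exec d ?\<sigma>) Q (time ?\<sigma> + k' * (b + 1))"
      using * by (intro hoareD[OF assms(2)]) (simp_all add: tick_def)
    moreover have "exec (Ite a c d) \<sigma> = exec d ?\<sigma>"
      using False by (simp add: eval_expr_ev)
    ultimately show ?thesis
      by (simp only:) (elim spec_weaken, auto simp: algebra_simps)
  qed
  then show "spec b (exec (Ite a c d) \<sigma>) Q (time \<sigma> + (1 + expr_cost a + k + k') * (b + 1))"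
    using cost_expr_le[OF *(1), of a] by (elim spec_weaken) (auto simp: tick_def algebra_simps)
qed

lemma exec_while:
  "exec (While a c) \<sigma> =
     (if expr_val a (num \<sigma>) (stk \<sigma>) \<noteq> 0
      then bind_spmf (exec c (tick (1 + cost_expr a \<sigma>) \<sigma>)) (exec (While a c))
      else return_spmf (tick (1 + cost_expr a \<sigma>) \<sigma>))"
proof -
  have "exec (While a c) = (\<lambda>\<sigma>. map_spmf (\<lambda>\<tau>. tick (1 + cost_expr a \<tau>) \<tau>)
      (while_spmf (\<lambda>\<tau>. eval_expr a \<tau> \<noteq> 0) (\<lambda>\<tau>. exec c (tick (1 + cost_expr a \<tau>) \<tau>)) \<sigma>))"
    by (rule ext) simp
  then show ?thesis
    by (subst exec.simps, subst while_spmf.simps) (simp add: eval_expr_ev map_spmf_bind_spmf o_def)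
qed

declare exec.simps(8) [simp del]

lemma hoare_while:
  assumes body: "\<And>z. hoare b (\<lambda>n s. I n s \<and> expr_val a n s \<noteq> 0 \<and> m n s = z) c (\<lambda>n s. I n s \<and> m n s < z) k"
    and m: "\<And>n s. regs_bounded b n \<Longrightarrow> I n s \<Longrightarrow> m n s \<le> K"
  shows "hoare b I (While a c) (\<lambda>n s. I n s \<and> expr_val a n s = 0) ((K + 1) * (1 + expr_cost a) + K * k)"
proof -
  have "spec b (exec (While a c) \<sigma>) (\<lambda>n s. I n s \<and> expr_val a n s = 0)
      (time \<sigma> + ((z + 1) * (1 + expr_cost a) + z * k) * (b + 1))"
    if "regs_bounded b (num \<sigma>)" "I (num \<sigma>) (stk \<sigma>)" "m (num \<sigma>) (stk \<sigma>) \<le> z" for \<sigma> z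
    using that
  proof (induction z arbitrary: \<sigma> rule: less_induct)
    case (less z)
    let ?\<sigma> = "tick (1 + cost_expr a \<sigma>) \<sigma>"
    have cost: "1 + cost_expr a \<sigma> \<le> (1 + expr_cost a) * (b + 1)"
      using cost_expr_le[OF less.prems(1), of a] by simp
    show ?case
    proof (cases "expr_val a (num \<sigma>) (stk \<sigma>) = 0")
      case True
      have "1 + cost_expr a \<sigma> \<le> ((z + 1) * (1 + expr_cost a) + z * k) * (b + 1)"
        using cost by (rule order_trans) (auto intro!: mult_le_mono1 simp: algebra_simps)
      then show ?thesis
        using True less.prems by (subst exec_while) (simp add: spec_return tick_def)
    next
      case False
      let ?Q = "\<lambda>n s. I n s \<and> expr_val a n s = 0"
      let ?z = "m (num \<sigma>) (stk \<sigma>)"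
      have c: "spec b (exec c ?\<sigma>) (\<lambda>n s. I n s \<and> m n s < ?z) (time ?\<sigma> + k * (b + 1))"
        using less.prems False by (intro hoareD[OF body[of ?z]]) (simp_all add: tick_def)
      \<comment> \<open>With z = 0 no state could satisfy the postcondition of the body, yet a
        lossless distribution has outcomes.\<close>
      have z: "z > 0"
      proof (rule ccontr)
        assume "\<not> z > 0"
        then have "set_spmf (exec c ?\<sigma>) = {}"
          using c less.prems by (auto simp: spec_def)
        then show False
          using c measure_spmf_zero_iff[of "exec c ?\<sigma>" UNIV] by (simp add: spec_def lossless_spmf_def weight_spmf_def)
      qed
      have "spec b (bind_spmf (exec c ?\<sigma>) (exec (While a c))) ?Q
          (time ?\<sigma> + k * (b + 1) + (z * (1 + expr_cost a) + (z - 1) * k) * (b + 1))"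
        using c
      proof (rule spec_bind)
        fix \<tau> :: config assume \<tau>: "regs_bounded b (num \<tau>)" "I (num \<tau>) (stk \<tau>) \<and> m (num \<tau>) (stk \<tau>) < ?z"
        then have "m (num \<tau>) (stk \<tau>) \<le> z - 1"
          using less.prems(3) by linarith
        with \<tau> show "spec b (exec (While a c) \<tau>) ?Q (time \<tau> + (z * (1 + expr_cost a) + (z - 1) * k) * (b + 1))"
          using less.IH[of "z - 1" \<tau>] z by simp
      qed
      moreover have "time ?\<sigma> + k * (b + 1) + (z * (1 + expr_cost a) + (z - 1) * k) * (b + 1)
          \<le> time \<sigma> + ((z + 1) * (1 + expr_cost a) + z * k) * (b + 1)"
        using cost z by (cases z) (auto simp: tick_def algebra_simps)
      ultimately show ?thesis
        using False unfolding exec_while[of a c \<sigma>] by (simp only: if_True not_False_eq_True) (elim spec_weaken, auto)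
    qed
  qed
  with m show ?thesis by (simp add: hoare_def)
qed

text \<open>One round takes expected time T, guard included, and the number of rounds is dominated
  by a geometric variable with mean 4. The last evaluation of the guard is the fifth one
  charged.\<close>

lemma hoare_search:
  assumes body: "hoare b (\<lambda>n s. I n s \<and> expr_val a n s \<noteq> 0) c I k"
    and success: "\<And>\<sigma>. regs_bounded b (num \<sigma>) \<Longrightarrow> I (num \<sigma>) (stk \<sigma>) \<Longrightarrow> expr_val a (num \<sigma>) (stk \<sigma>) \<noteq> 0 \<Longrightarrow>
      1 / 4 \<le> measure (measure_spmf (exec c \<sigma>)) {\<tau>. expr_val a (num \<tau>) (stk \<tau>) = 0}"
  shows "hoare b I (While a c) (\<lambda>n s. I n s \<and> expr_val a n s = 0) (5 * (1 + expr_cost a) + 4 * k)"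
  unfolding hoare_def
proof (intro allI impI)
  fix \<sigma> :: config assume \<sigma>: "regs_bounded b (num \<sigma>)" "I (num \<sigma>) (stk \<sigma>)"
  define J where "J \<tau> \<longleftrightarrow> regs_bounded b (num \<tau>) \<and> I (num \<tau>) (stk \<tau>)" for \<tau> :: config
  define g where "g \<tau> \<longleftrightarrow> eval_expr a \<tau> \<noteq> 0" for \<tau>
  define B where "B \<tau> = exec c (tick (1 + cost_expr a \<tau>) \<tau>)" for \<tau>
  define e where "e = (1 + expr_cost a) * (b + 1)"
  define T where "T = e + k * (b + 1)"
  have g: "g \<tau> \<longleftrightarrow> expr_val a (num \<tau>) (stk \<tau>) \<noteq> 0" for \<tau>
    by (simp add: g_def eval_expr_ev)
  have cost: "1 + cost_expr a \<tau> \<le> e" if "J \<tau>" for \<tau>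
    using cost_expr_le[of b \<tau> a] that by (simp add: J_def e_def)
  have B: "spec b (B \<tau>) I (time \<tau> + T)" if "J \<tau>" "g \<tau>" for \<tau>
  proof -
    let ?\<tau> = "tick (1 + cost_expr a \<tau>) \<tau>"
    have "spec b (B \<tau>) I (time ?\<tau> + k * (b + 1))"
      unfolding B_def using that by (intro hoareD[OF body]) (simp_all add: J_def g tick_def)
    moreover have "time ?\<tau> + k * (b + 1) \<le> time \<tau> + T"
      using cost[OF that(1)] by (simp add: T_def tick_def)
    ultimately show ?thesis
      by (rule spec_weaken)
  qed
  have inv: "J \<tau>'" if "J \<tau>" "g \<tau>" "\<tau>' \<in> set_spmf (B \<tau>)" for \<tau> \<tau>'
    using B[OF that(1,2)] that(3) by (auto simp: spec_def J_def)
  have lossless_B: "lossless_spmf (B \<tau>)" if "J \<tau>" "g \<tau>" for \<tau>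
    using B[OF that] by (simp add: spec_def)
  have quarter: "1 / 4 \<le> measure (measure_spmf (B \<tau>)) {\<tau>. \<not> g \<tau>}" if "J \<tau>" "g \<tau>" for \<tau>
    using success[of "tick (1 + cost_expr a \<tau>) \<tau>"] that by (simp add: J_def g B_def tick_def)
  let ?W = "while_spmf g B \<sigma>"
  have W: "exec (While a c) \<sigma> = map_spmf (\<lambda>\<tau>. tick (1 + cost_expr a \<tau>) \<tau>) ?W"
    by (simp add: g_def[abs_def] B_def[abs_def] exec.simps(8))
  have lossless: "lossless_spmf ?W"
    by (rule lossless_while_spmf[where I = J, OF inv lossless_B quarter]) (use \<sigma> in \<open>simp_all add: J_def\<close>)
  have supp: "J \<tau> \<and> \<not> g \<tau>" if "\<tau> \<in> set_spmf ?W" for \<tau>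
    by (rule while_spmf_invariant[where I = J, OF inv _ that]) (use \<sigma> in \<open>simp_all add: J_def\<close>)
  \<comment> \<open>A running search has a reserve of 4 T. A round uses T and leaves the search
    running with probability at most 3/4, so the expected new reserve is at most 3 T and the
    potential does not grow.\<close>
  define \<phi> :: "config \<Rightarrow> ennreal" where "\<phi> \<tau> = of_nat (time \<tau>) + of_nat (4 * T) * indicator {\<tau>. g \<tau>} \<tau>" for \<tau>
  have "(\<integral>\<^sup>+ \<tau>. of_nat (time \<tau>) \<partial>measure_spmf ?W) \<le> \<phi> \<sigma>"
  proof (rule nn_integral_while_spmf_le[where I = J, OF inv])
    fix \<tau> assume \<tau>: "J \<tau>" "g \<tau>"
    let ?M = "measure_spmf (B \<tau>)"
    have compl: "space ?M - {\<tau>. \<not> g \<tau>} = {\<tau>. g \<tau>}"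
      by (auto simp: space_measure_spmf)
    have "measure ?M {\<tau>. g \<tau>} = 1 - measure ?M {\<tau>. \<not> g \<tau>}"
      using measure_spmf.finite_measure_compl[of "{\<tau>. \<not> g \<tau>}" "B \<tau>"] lossless_B[OF \<tau>]
      by (simp only: compl lossless_weight_spmfD) simp
    also have "\<dots> \<le> 3 / 4"
      using quarter[OF \<tau>] by simp
    finally have "emeasure ?M {\<tau>. g \<tau>} \<le> ennreal (3 / 4)"
      by (simp add: measure_spmf.emeasure_eq_measure ennreal_leI)
    then have "of_nat (4 * T) * emeasure ?M {\<tau>. g \<tau>} \<le> of_nat (4 * T) * ennreal (3 / 4)"
      by (intro mult_left_mono) auto
    also have "\<dots> = of_nat (3 * T)"
      by (simp flip: ennreal_of_nat_eq_real_of_nat ennreal_mult' add: ennreal_of_nat_eq_real_of_nat)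
    finally have "of_nat (4 * T) * emeasure ?M {\<tau>. g \<tau>} \<le> of_nat (3 * T)" .
    moreover have "(\<integral>\<^sup>+ \<tau>'. \<phi> \<tau>' \<partial>?M) = (\<integral>\<^sup>+ \<tau>'. of_nat (time \<tau>') \<partial>?M) + of_nat (4 * T) * emeasure ?M {\<tau>. g \<tau>}"
      by (simp add: \<phi>_def nn_integral_add nn_integral_cmult)
    ultimately have "(\<integral>\<^sup>+ \<tau>'. \<phi> \<tau>' \<partial>?M) \<le> of_nat (time \<tau> + T) + of_nat (3 * T)"
      using B[OF \<tau>] by (auto simp: spec_def intro: add_mono)
    also have "\<dots> = of_nat (time \<tau> + 4 * T)"
      unfolding of_nat_add[symmetric] by (rule arg_cong[where f = of_nat]) simp
    also have "\<dots> = \<phi> \<tau>"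
      unfolding \<phi>_def of_nat_add using \<tau> by simp
    finally show "(\<integral>\<^sup>+ \<tau>'. \<phi> \<tau>' \<partial>?M) \<le> \<phi> \<tau>" .
  qed (use \<sigma> in \<open>simp_all add: J_def \<phi>_def\<close>)
  also have "\<dots> \<le> of_nat (time \<sigma> + 4 * T)"
    unfolding \<phi>_def of_nat_add by (intro add_left_mono) (auto simp: indicator_def)
  finally have "spec b ?W (\<lambda>n s. I n s \<and> expr_val a n s = 0) (time \<sigma> + 4 * T)"
    using lossless supp by (auto simp: spec_def J_def g)
  then have "spec b (exec (While a c) \<sigma>) (\<lambda>n s. I n s \<and> expr_val a n s = 0) (time \<sigma> + 4 * T + e)"
    unfolding W map_spmf_conv_bind_spmf o_def
  proof (rule spec_bind)
    fix \<tau> assume "\<tau> \<in> set_spmf ?W" "regs_bounded b (num \<tau>)" "I (num \<tau>) (stk \<tau>) \<and> expr_val a (num \<tau>) (stk \<tau>) = 0"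
    then show "spec b (return_spmf (tick (1 + cost_expr a \<tau>) \<tau>)) (\<lambda>n s. I n s \<and> expr_val a n s = 0) (time \<tau> + e)"
      using cost supp by (auto simp: spec_return tick_def)
  qed
  then show "spec b (exec (While a c) \<sigma>) (\<lambda>n s. I n s \<and> expr_val a n s = 0)
      (time \<sigma> + (5 * (1 + expr_cost a) + 4 * k) * (b + 1))"
    by (simp add: T_def e_def algebra_simps)
qed

text \<open>
  Every loop is charged for \<open>b + 4\<close> rounds. This covers deterministic loops of at most \<open>b\<close> rounds as
  well as a search whose rounds succeed with probability \<open>1 / 4\<close>. The value at \<open>Call\<close> is a dummy.
\<close>

primrec prog_cost :: "nat \<Rightarrow> prog \<Rightarrow> nat" where
  "prog_cost b Skip = 1"
| "prog_cost b (Assign x a) = 1 + expr_cost a"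
| "prog_cost b (Flip x) = 1"
| "prog_cost b (Push k a) = 1 + expr_cost a"
| "prog_cost b (Pop x k) = 1"
| "prog_cost b (Seq c d) = prog_cost b c + prog_cost b d"
| "prog_cost b (Ite a c d) = 1 + expr_cost a + prog_cost b c + prog_cost b d"
| "prog_cost b (While a c) = (b + 5) * (1 + expr_cost a) + (b + 4) * prog_cost b c"
| "prog_cost b (Call c i j) = 0"

text \<open>Each level of loop nesting contributes one linear factor in b, and a fixed program has
  only finitely many levels.\<close>

lemma prog_cost_poly: "\<exists>q :: nat poly. \<forall>b. prog_cost b c = poly q b"
proof (induction c)
  case (Seq c d)
  then obtain q r where "\<forall>b. prog_cost b c = poly q b" "\<forall>b. prog_cost b d = poly r b" by blast
  then show ?case by (intro exI[of _ "q + r"]) simp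
next
  case (Ite a c d)
  then obtain q r where "\<forall>b. prog_cost b c = poly q b" "\<forall>b. prog_cost b d = poly r b" by blast
  then show ?case by (intro exI[of _ "[:1 + expr_cost a:] + q + r"]) simp
next
  case (While a c)
  then obtain q where "\<forall>b. prog_cost b c = poly q b" by blast
  then show ?case by (intro exI[of _ "[:5, 1:] * [:1 + expr_cost a:] + [:4, 1:] * q"]) (simp add: algebra_simps)
qed (auto intro: exI[of _ "[:_:]"])

text \<open>Reading the cost off the program text removes it from all later proofs: what remains is
  functional correctness, register bounds, and a round bound or success probability for each
  loop.\<close>

definition triple :: "nat \<Rightarrow> assertion \<Rightarrow> prog \<Rightarrow> assertion \<Rightarrow> bool" where
  "triple b P c Q \<longleftrightarrow> hoare b P c Q (prog_cost b c)"

lemma triple_conseq: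
  "triple b P' c Q' \<Longrightarrow> (\<And>n s. regs_bounded b n \<Longrightarrow> P n s \<Longrightarrow> P' n s) \<Longrightarrow>
    (\<And>n s. regs_bounded b n \<Longrightarrow> Q' n s \<Longrightarrow> Q n s) \<Longrightarrow> triple b P c Q"
  unfolding triple_def by (erule hoare_conseq) auto

lemma triple_pre:
  "triple b P' c Q \<Longrightarrow> (\<And>n s. regs_bounded b n \<Longrightarrow> P n s \<Longrightarrow> P' n s) \<Longrightarrow> triple b P c Q"
  by (erule triple_conseq) auto

lemma triple_ghost:
  "(\<And>n0 s0. regs_bounded b n0 \<Longrightarrow> P n0 s0 \<Longrightarrow> triple b (\<lambda>n s. n = n0 \<and> s = s0) c Q) \<Longrightarrow> triple b P c Q"
  unfolding triple_def by (rule hoare_ghost) auto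

lemma triple_skip: "triple b P Skip P"
  using hoare_skip by (simp add: triple_def)

lemma triple_assign:
  "triple b (\<lambda>n s. expr_val a n s < 2 ^ b \<and> Q (n(x := expr_val a n s)) s) (Assign x a) Q"
  using hoare_assign by (simp add: triple_def)

lemma triple_push:
  "triple b (\<lambda>n s. Q n (s(k := expr_val a n s # s k))) (Push k a) Q"
  using hoare_push by (simp add: triple_def)

lemma triple_pop:
  "triple b (\<lambda>n s. s k \<noteq> [] \<and> hd (s k) < 2 ^ b \<and> Q (n(x := hd (s k))) (s(k := tl (s k)))) (Pop x k) Q"
  using hoare_pop by (simp add: triple_def)

lemma triple_flip:
  "triple b (\<lambda>n s. 0 < b \<and> Q (n(x := 0)) s \<and> Q (n(x := 1)) s) (Flip x) Q"
  using hoare_flip by (simp add: triple_def)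

lemma triple_seq:
  "triple b R d Q \<Longrightarrow> triple b P c R \<Longrightarrow> triple b P (Seq c d) Q"
  unfolding triple_def by (simp add: hoare_seq)

lemma triple_ite:
  "triple b P c Q \<Longrightarrow> triple b P' d Q \<Longrightarrow>
    triple b (\<lambda>n s. if expr_val a n s \<noteq> 0 then P n s else P' n s) (Ite a c d) Q"
  unfolding triple_def using hoare_ite by simp

lemmas triple_intros = triple_seq triple_assign triple_push triple_pop triple_flip triple_skip triple_ite

lemma triple_while:
  assumes body: "\<And>z. triple b (\<lambda>n s. I n s \<and> expr_val a n s \<noteq> 0 \<and> m n s = z) c (\<lambda>n s. I n s \<and> m n s < z)"
    and m: "\<And>n s. regs_bounded b n \<Longrightarrow> I n s \<Longrightarrow> m n s \<le> b"
  shows "triple b I (While a c) (\<lambda>n s. I n s \<and> expr_val a n s = 0)"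
proof -
  have "hoare b I (While a c) (\<lambda>n s. I n s \<and> expr_val a n s = 0) ((b + 1) * (1 + expr_cost a) + b * prog_cost b c)"
    using assms unfolding triple_def by (rule hoare_while)
  then show ?thesis
    unfolding triple_def by (rule hoare_conseq) (auto simp: algebra_simps)
qed

lemma triple_while_ghost:
  assumes "\<And>n0 s0 z. regs_bounded b n0 \<Longrightarrow> P n0 s0 \<Longrightarrow>
      triple b (\<lambda>n s. I n0 s0 n s \<and> expr_val a n s \<noteq> 0 \<and> m n s = z) c (\<lambda>n s. I n0 s0 n s \<and> m n s < z)"
    and "\<And>n0 s0 n s. regs_bounded b n0 \<Longrightarrow> P n0 s0 \<Longrightarrow> regs_bounded b n \<Longrightarrow> I n0 s0 n s \<Longrightarrow> m n s \<le> b"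
    and "\<And>n0 s0. regs_bounded b n0 \<Longrightarrow> P n0 s0 \<Longrightarrow> I n0 s0 n0 s0"
    and "\<And>n0 s0 n s. regs_bounded b n0 \<Longrightarrow> P n0 s0 \<Longrightarrow> regs_bounded b n \<Longrightarrow> I n0 s0 n s \<Longrightarrow> expr_val a n s = 0 \<Longrightarrow> Q n s"
  shows "triple b P (While a c) Q"
proof (rule triple_ghost)
  fix n0 s0 assume *: "regs_bounded b n0" "P n0 s0"
  show "triple b (\<lambda>n s. n = n0 \<and> s = s0) (While a c) Q"
    by (rule triple_conseq[OF triple_while[of b "I n0 s0" a m]]) (use * assms in auto)
qed

lemma triple_while_search:
  assumes "triple b (\<lambda>n s. I n s \<and> expr_val a n s \<noteq> 0) c I"
    and "\<And>\<sigma>. regs_bounded b (num \<sigma>) \<Longrightarrow> I (num \<sigma>) (stk \<sigma>) \<Longrightarrow> expr_val a (num \<sigma>) (stk \<sigma>) \<noteq> 0 \<Longrightarrow>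
      1 / 4 \<le> measure (measure_spmf (exec c \<sigma>)) {\<tau>. expr_val a (num \<tau>) (stk \<tau>) = 0}"
  shows "triple b I (While a c) (\<lambda>n s. I n s \<and> expr_val a n s = 0)"
proof -
  have "hoare b I (While a c) (\<lambda>n s. I n s \<and> expr_val a n s = 0) (5 * (1 + expr_cost a) + 4 * prog_cost b c)"
    using assms unfolding triple_def by (rule hoare_search)
  then show ?thesis
    unfolding triple_def by (rule hoare_conseq) (auto simp: algebra_simps)
qed

lemma bit_length_div_less: "x > 0 \<Longrightarrow> y \<ge> 2 \<Longrightarrow> bit_length (x div y) < bit_length x"
proof -
  assume x: "x > 0" and y: "y \<ge> 2"
  have "x div y \<le> x div 2" using y by (rule div_le_mono2[rotated]) simp
  then have "bit_length (x div y) \<le> bit_length (x div 2)"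
    unfolding bit_length_def by (rule floorlog_mono)
  also have "\<dots> < bit_length x"
    using x unfolding bit_length_def by (subst (2) compute_floorlog) simp
  finally show ?thesis .
qed

lemma bit_length_half: "x > 0 \<Longrightarrow> bit_length x = Suc (bit_length (x div 2))"
  unfolding bit_length_def by (subst compute_floorlog) simp

lemma bit_length_0 [simp]: "bit_length 0 = 0"
  by (simp add: bit_length_def floorlog_def)

lemma regs_bounded_bit_length: "regs_bounded b n \<Longrightarrow> bit_length (n x) \<le> b"
  by (simp add: regs_bounded_def bit_length_le_iff)

abbreviation eadd (infixl "+." 65) where "a +. b \<equiv> Bin Add a b"
abbreviation esub (infixl "-." 65) where "a -. b \<equiv> Bin Sub a b"
abbreviation emul (infixl "*." 70) where "a *. b \<equiv> Bin Mul a b"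
abbreviation ediv (infixl "div." 70) where "a div. b \<equiv> Bin Div a b"
abbreviation emod (infixl "mod." 70) where "a mod. b \<equiv> Bin binop.Mod a b"
abbreviation eless (infix "<." 50) where "a <. b \<equiv> Bin Less a b"
abbreviation eequal (infix "=." 50) where "a =. b \<equiv> Bin Equal a b"
abbreviation assign_reg (infix "<~" 45) where "x <~ a \<equiv> Assign x a"
abbreviation seq_comp (infixr ";;" 40) where "c ;; d \<equiv> Seq c d"

definition bit_length_prog :: "nat \<Rightarrow> nat \<Rightarrow> prog" where
  "bit_length_prog x r = While (Reg x) (x <~ Reg x div. Const 2 ;; r <~ Reg r +. Const 1)"

lemma triple_bit_length_prog:
  assumes "x \<noteq> r"
  shows "triple b (\<lambda>n s. n r + bit_length (n x) < 2 ^ b \<and> Q (n(x := 0, r := n r + bit_length (n x))) s)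
    (bit_length_prog x r) Q"
  unfolding bit_length_prog_def
proof (rule triple_while_ghost[where m = "\<lambda>n s. bit_length (n x)" and
    I = "\<lambda>n0 s0 n s. s = s0 \<and> n r + bit_length (n x) = n0 r + bit_length (n0 x) \<and>
      (\<forall>y. y \<noteq> x \<longrightarrow> y \<noteq> r \<longrightarrow> n y = n0 y)"], goal_cases)
  case (1 n0 s0 z)
  show ?case
  proof (rule triple_pre, (rule triple_intros)+, goal_cases)
    case (1 n s)
    have "n x div 2 < 2 ^ b" using 1(1) by (auto simp: regs_bounded_def intro: le_less_trans[OF div_le_dividend])
    then show ?case
      using 1 assms \<open>n0 r + bit_length (n0 x) < 2 ^ b \<and> _\<close> bit_length_half[of "n x"] by auto
  qed
next
  case (4 n0 s0 n s)
  then have "n = n0(x := 0, r := n0 r + bit_length (n0 x))"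
    using assms by auto
  with 4 show ?case by simp
qed (auto simp: regs_bounded_bit_length)

section \<open>Writing powers\<close>

text \<open>
  Registers. \<open>p\<close>, \<open>a\<close>, \<open>b\<close>, \<open>c\<close>, \<open>d\<close> hold the input, \<open>L\<close> and \<open>l\<close> the bit lengths of \<open>p\<close> and \<open>L\<close>, \<open>val\<close> the base
  \<open>\<alpha> = y\<^sup>2\<close>, and \<open>vB\<close> the bound on the number of Euclidean steps. The current word \<open>T\<close> has length \<open>m\<close>; its
  letters are the binary digits of \<open>cd\<close>, in reverse order those of \<open>rcd\<close>, and \<open>(u, v)\<close> is the upper row
  of its matrix. The shift of the exponents is \<open>g\<close>, and \<open>P\<close> is the largest power of \<open>\<alpha>\<close> up to \<open>p\<close>.
\<close>

abbreviation (input) "vp \<equiv> 0 :: nat"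
abbreviation (input) "va \<equiv> 1 :: nat"
abbreviation (input) "vb \<equiv> 2 :: nat"
abbreviation (input) "vc \<equiv> 3 :: nat"
abbreviation (input) "vd \<equiv> 4 :: nat"
abbreviation (input) "vL \<equiv> 5 :: nat"
abbreviation (input) "vl \<equiv> 6 :: nat"
abbreviation (input) "vy \<equiv> 7 :: nat"
abbreviation (input) "val \<equiv> 8 :: nat"
abbreviation (input) "vB \<equiv> 9 :: nat"
abbreviation (input) "vF \<equiv> 10 :: nat"
abbreviation (input) "vk \<equiv> 11 :: nat"
abbreviation (input) "vx \<equiv> 12 :: nat"
abbreviation (input) "vw \<equiv> 13 :: nat"
abbreviation (input) "vu \<equiv> 14 :: nat"
abbreviation (input) "vv \<equiv> 15 :: nat"
abbreviation (input) "vcd \<equiv> 16 :: nat"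
abbreviation (input) "vrcd \<equiv> 17 :: nat"
abbreviation (input) "vpw \<equiv> 18 :: nat"
abbreviation (input) "vm \<equiv> 19 :: nat"
abbreviation (input) "vi \<equiv> 20 :: nat"
abbreviation (input) "vg \<equiv> 21 :: nat"
abbreviation (input) "vP \<equiv> 22 :: nat"
abbreviation (input) "vQ \<equiv> 23 :: nat"
abbreviation (input) "vt \<equiv> 24 :: nat"
abbreviation (input) "vr \<equiv> 25 :: nat"
abbreviation (input) "ve \<equiv> 26 :: nat"
abbreviation (input) "vfl \<equiv> 27 :: nat"
abbreviation (input) "vf \<equiv> 28 :: nat"

definition agree :: "nat set \<Rightarrow> (nat \<Rightarrow> nat) \<Rightarrow> (nat \<Rightarrow> nat) \<Rightarrow> bool" where
  "agree X n n0 \<longleftrightarrow> (\<forall>x. x \<notin> X \<longrightarrow> n x = n0 x)"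

lemma agree_refl [simp]: "agree X n n"
  by (simp add: agree_def)

lemma agree_upd [simp]: "x \<in> X \<Longrightarrow> agree X (n(x := k)) n0 \<longleftrightarrow> agree X n n0"
  by (auto simp: agree_def)

definition emit :: prog where
  "emit =
    While (Reg vi)
      (Push 0 (Reg vx mod. Const 2) ;;
       vx <~ Reg vx div. Const 2 ;;
       vi <~ Reg vi -. Const 1)"

lemma less_power_div: "m < 2 ^ b \<Longrightarrow> m div k < (2 ^ b :: nat)"
  by (rule le_less_trans[OF div_le_dividend])

lemma less_power_diff: "m < 2 ^ b \<Longrightarrow> m - k < (2 ^ b :: nat)"
  by (rule le_less_trans[OF diff_le_self])

lemma less_power_mod: "m < 2 ^ b \<Longrightarrow> m mod k < (2 ^ b :: nat)"
  by (rule le_less_trans[OF mod_less_eq_dividend])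

lemma regs_boundedD: "regs_bounded b n \<Longrightarrow> n x < 2 ^ b"
  by (simp add: regs_bounded_def)

text \<open>The digits are pushed from the lowest to the highest, so the word ends up on the stack
  in reading order. \<open>Q\<close> is required for every final value of the scratch register
  \<open>vx\<close>, whose content after the call is of no interest to a caller.\<close>

lemma triple_emit:
  "triple b (\<lambda>n s. n vi \<le> b \<and> (\<forall>x. Q (n(vx := x, vi := 0)) (s(0 := bin_word (n vx) (n vi) @ s 0)))) emit Q"
  unfolding emit_def
proof (rule triple_while_ghost[where m = "\<lambda>n s. n vi" and
    I = "\<lambda>n0 s0 n s. n vi \<le> b \<and> agree {vx, vi} n n0 \<and> s = s0(0 := s 0) \<and>
      bin_word (n vx) (n vi) @ s 0 = bin_word (n0 vx) (n0 vi) @ s0 0"], goal_cases)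
  case (1 n0 s0 z)
  show ?case
  proof (rule triple_pre, (rule triple_intros)+, goal_cases)
    case (1 n s)
    then have i: "n vi = Suc (n vi - 1)" by simp
    have *: "n vi \<le> b" "agree {vx, vi} n n0" "s = s0(0 := s 0)" "n vi = z"
      "bin_word (n vx) (n vi) @ s 0 = bin_word (n0 vx) (n0 vi) @ s0 0"
      using 1(2) by blast+
    have "bin_word (n vx) (n vi) = bin_word (n vx div 2) (n vi - 1) @ [n vx mod 2]"
      by (subst i) simp
    with *(5) have "bin_word (n vx div 2) (n vi - 1) @ (n vx mod 2) # s 0 = bin_word (n0 vx) (n0 vi) @ s0 0"
      by (metis append.assoc append_Cons append_Nil)
    moreover have "s(0 := x # s 0) = s0(0 := x # s 0)" for x
      using *(3) by (metis fun_upd_upd)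
    moreover have "n vi - 1 < z" using i *(4) by linarith
    ultimately show ?case
      using *(1,2) less_power_div[OF regs_boundedD[OF 1(1)], of vx 2] less_power_diff[OF regs_boundedD[OF 1(1)], of vi 1]
      by simp
  qed
next
  case (4 n0 s0 n s)
  then have "n = n0(vx := n vx, vi := 0)" "s = s0(0 := bin_word (n0 vx) (n0 vi) @ s0 0)"
    by (auto simp: agree_def)
  with 4(2) show ?case by metis
qed auto

text \<open>
  Writes a word for \<open>A\<^sup>t\<close>: with the base \<open>\<alpha> = y\<^sup>2\<close> and the digits \<open>r\<^sub>0, \<dots>, r\<^sub>j\<close> of the shifted exponent it
  is \<open>A\<^bsup>r\<^sub>0\<^esup> T \<dots> A\<^bsup>r\<^sub>j\<^esub> rev(T)\<^sup>j\<close>, produced from right to left.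
\<close>

definition write_power :: prog where
  "write_power =
    (vt <~ (Reg vt +. Reg vp -. Reg vg) mod. Reg vp ;;
     vQ <~ Reg vP ;;
     While (Const 1 <. Reg vQ)
       (vx <~ Reg vrcd ;; vi <~ Reg vm ;; emit ;; vQ <~ Reg vQ div. Reg val) ;;
     vQ <~ Reg vP ;;
     vx <~ Const 0 ;; vi <~ Reg vt div. Reg vQ ;; emit ;; vt <~ Reg vt mod. Reg vQ ;;
     While (Const 1 <. Reg vQ)
       (vQ <~ Reg vQ div. Reg val ;;
        vx <~ Reg vcd ;; vi <~ Reg vm ;; emit ;;
        vx <~ Const 0 ;; vi <~ Reg vt div. Reg vQ ;; emit ;; vt <~ Reg vt mod. Reg vQ))"

abbreviation (input) "scratch \<equiv> {vt, vx, vi, vQ}"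

text \<open>The bounds y^2 <= b and length T <= b limit the rounds of \<open>emit\<close> for a
  digit and for a copy of T. For j = 0 nothing is asked of T: the exponent is then a single digit,
  which settles the small primes.\<close>

definition power_ready :: "nat \<Rightarrow> nat \<Rightarrow> nat \<Rightarrow> nat list \<Rightarrow> nat \<Rightarrow> (nat \<Rightarrow> nat) \<Rightarrow> bool" where
  "power_ready p y j T b n \<longleftrightarrow>
     n vp = p \<and> 0 < p \<and> n val = y\<^sup>2 \<and> 2 \<le> y \<and> n vP = (y\<^sup>2) ^ j \<and> p < (y\<^sup>2) ^ Suc j \<and>
     n vg < p \<and> y\<^sup>2 \<le> b \<and>
     (0 < j \<longrightarrow> set T \<subseteq> {0, 1} \<and> n vm = length T \<and> length T \<le> b \<and> bin_word (n vcd) (n vm) = T \<and>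
       bin_word (n vrcd) (n vm) = rev T \<and> [n vg = geom (y\<^sup>2) (2 * y * n vv) j] (mod p) \<and>
       (\<exists>N M d. word_mat T = mat2 N (int (n vv)) M d \<and> [N = int y] (mod int p) \<and> int p dvd M)) \<and>
     (j = 0 \<longrightarrow> n vg = 0)"

lemma triple_write_power:
  assumes ready: "power_ready p y j T b n0" and t: "t < p"
  shows "triple b (\<lambda>n s. agree scratch n n0 \<and> n vt = t \<and> s 0 = s0) write_power
    (\<lambda>n s. agree scratch n n0 \<and>
      (\<exists>W. s 0 = W @ s0 \<and> set W \<subseteq> {0, 1} \<and> mat_mod p (word_mat W) = mat_mod p (mat2 1 (int t) 0 1) \<and>
        length W \<le> 2 * j * length T + (j + 1) * y\<^sup>2))"
proof -
  define \<alpha> where "\<alpha> = y\<^sup>2"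
  \<comment> \<open>The exponent from which the constants of the j conjugations have been subtracted
    in advance.\<close>
  define \<sigma> where "\<sigma> = (t + p - n0 vg) mod p"
  define R where "R i = concat (replicate i (rev T))" for i
  \<comment> \<open>The exponent reached when the digits from position i upwards have been
    processed; E 0 is \<sigma> plus the complete shift, hence t modulo p.\<close>
  define E where "E i = \<sigma> div \<alpha> ^ i + geom \<alpha> (2 * y * n0 vv) (j - i)" for i
  have n0: "n0 vp = p" "0 < p" "n0 val = \<alpha>" "2 \<le> y" "n0 vP = \<alpha> ^ j" "p < \<alpha> ^ Suc j" "n0 vg < p" "\<alpha> \<le> b"
    using ready by (simp_all add: power_ready_def \<alpha>_def)
  have T: "set T \<subseteq> {0, 1}" "n0 vm = length T" "length T \<le> b" "bin_word (n0 vcd) (n0 vm) = T"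
      "bin_word (n0 vrcd) (n0 vm) = rev T" if "0 < j"
    using ready[unfolded power_ready_def] that by blast+
  have \<alpha>: "2 \<le> \<alpha>"
    using n0(4) mult_le_mono[OF n0(4) n0(4)] by (simp add: \<alpha>_def power2_eq_square)
  have \<sigma>: "\<sigma> < p" using n0 by (simp add: \<sigma>_def)
  have pow: "1 < \<alpha> ^ i \<longleftrightarrow> 0 < i" for i
    using \<alpha> one_less_power[of \<alpha> i] by (cases "i = 0") auto
  have regs: "n vp = p" "n val = \<alpha>" "n vP = \<alpha> ^ j" "n vg = n0 vg" "n vcd = n0 vcd" "n vrcd = n0 vrcd" "n vm = n0 vm"
    if "agree scratch n n0" for n
    using that n0 by (simp_all add: agree_def)
  \<comment> \<open>\<open>?I1\<close> describes the output of the right end rev(T)^j. In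
    \<open>?I2\<close> there are i digits still to come, and as many copies of rev(T) still
    unmatched.\<close>
  let ?I1 = "\<lambda>n s. agree scratch n n0 \<and> n vt = \<sigma> \<and>
    (\<exists>i\<le>j. n vQ = \<alpha> ^ i \<and> s 0 = R (j - i) @ s0)"
  let ?I2 = "\<lambda>n s. agree scratch n n0 \<and>
    (\<exists>i\<le>j. n vQ = \<alpha> ^ i \<and> n vt = \<sigma> mod \<alpha> ^ i \<and>
      (\<exists>W. s 0 = W @ s0 \<and> set W \<subseteq> {0, 1} \<and>
        mat_mod p (word_mat W) = mat_mod p (mat2 1 (int (E i)) 0 1 ** word_mat (R i)) \<and>
        length W \<le> j * length T + (j - i) * length T + (j - i + 1) * \<alpha>))"
  have loop1: "triple b ?I1
      (While (Const 1 <. Reg vQ) (vx <~ Reg vrcd ;; vi <~ Reg vm ;; emit ;; vQ <~ Reg vQ div. Reg val))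
      (\<lambda>n s. ?I1 n s \<and> expr_val (Const 1 <. Reg vQ) n s = 0)"
  proof (rule triple_while[where m = "\<lambda>n s. bit_length (n vQ)"], goal_cases)
    case (1 z)
    show ?case
    proof (rule triple_pre, (rule triple_intros triple_emit)+, goal_cases)
      case (1 n s)
      then obtain i where i: "i \<le> j" "n vQ = \<alpha> ^ i" "s 0 = R (j - i) @ s0" "0 < i"
        using pow by auto
      then obtain i' where i': "i = Suc i'" by (cases i) auto
      have "n vQ div n val = \<alpha> ^ i'"
        using i i' regs(2)[of n] 1 \<alpha> by simp
      moreover have "rev T @ R (j - i) = R (j - i')"
        using i i' by (simp add: R_def flip: Suc_diff_Suc)
      moreover have "bit_length (n vQ div n val) < z"
        using 1 i \<alpha> regs(2)[of n] bit_length_div_less[of "n vQ" \<alpha>] by auto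
      ultimately show ?case
        using 1 i i' T regs[of n] regs_boundedD[OF 1(1), of vrcd] regs_boundedD[OF 1(1), of vm]
          less_power_div[OF regs_boundedD[OF 1(1), of vQ], of "n val"] by (auto intro!: exI[of _ i'])
    qed
  qed (auto simp: regs_bounded_bit_length)
  have loop2: "triple b ?I2
      (While (Const 1 <. Reg vQ)
       (vQ <~ Reg vQ div. Reg val ;;
        vx <~ Reg vcd ;; vi <~ Reg vm ;; emit ;;
        vx <~ Const 0 ;; vi <~ Reg vt div. Reg vQ ;; emit ;; vt <~ Reg vt mod. Reg vQ))
      (\<lambda>n s. ?I2 n s \<and> expr_val (Const 1 <. Reg vQ) n s = 0)"
  proof (rule triple_while[where m = "\<lambda>n s. bit_length (n vQ)"], goal_cases)
    case (1 z)
    show ?case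
    proof (rule triple_pre, (rule triple_intros triple_emit)+, goal_cases)
      case (1 n s)
      then obtain i W where i: "i \<le> j" "n vQ = \<alpha> ^ i" "n vt = \<sigma> mod \<alpha> ^ i" "0 < i"
        and W: "s 0 = W @ s0" "set W \<subseteq> {0, 1}"
          "mat_mod p (word_mat W) = mat_mod p (mat2 1 (int (E i)) 0 1 ** word_mat (R i))"
          "length W \<le> j * length T + (j - i) * length T + (j - i + 1) * \<alpha>"
        using pow by auto
      then obtain i' where i': "i = Suc i'" by (cases i) auto
      have j: "0 < j" using i by simp
      have Q: "n vQ div n val = \<alpha> ^ i'"
        using i i' regs(2)[of n] 1 \<alpha> by simp
      define r where "r = \<sigma> mod \<alpha> ^ i div \<alpha> ^ i'"
      have r: "r < \<alpha>"
        unfolding r_def i' by (rule less_mult_imp_div_less) (use \<alpha> in \<open>simp add: mult.commute\<close>)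
      have \<sigma>': "\<sigma> mod \<alpha> ^ i mod \<alpha> ^ i' = \<sigma> mod \<alpha> ^ i'"
        unfolding i' by (simp add: mod_mod_cancel)
      have step: "r + \<alpha> * (\<sigma> div \<alpha> ^ i) = \<sigma> div \<alpha> ^ i'"
      proof -
        have "\<sigma> = \<alpha> ^ i' * (\<alpha> * (\<sigma> div \<alpha> ^ i)) + \<sigma> mod \<alpha> ^ i"
          using mult_div_mod_eq[of "\<alpha> ^ i" \<sigma>] by (simp add: i' ac_simps)
        then have "\<sigma> div \<alpha> ^ i' = (\<sigma> mod \<alpha> ^ i + \<alpha> ^ i' * (\<alpha> * (\<sigma> div \<alpha> ^ i))) div \<alpha> ^ i'"
          by (simp add: add.commute)
        also have "\<dots> = \<alpha> * (\<sigma> div \<alpha> ^ i) + r"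
          unfolding r_def using \<alpha> by (subst div_mult_self2) auto
        finally show ?thesis by simp
      qed
      have "j - i' = Suc (j - i)" using i i' by simp
      then have "r + (\<alpha> * E i + 2 * y * n0 vv) = E i'"
        using step by (simp add: E_def algebra_simps)
      moreover obtain N M d where "word_mat T = mat2 N (int (n0 vv)) M d" "[N = int y] (mod int p)" "int p dvd M"
        using ready j by (auto simp: power_ready_def)
      ultimately have mat: "mat_mod p (word_mat (replicate r 0 @ T @ W)) = mat_mod p (mat2 1 (int (E i')) 0 1 ** word_mat (R i'))"
        using expansion_step[of T N "n0 vv" M d y p W "E i" i' r] W(3) by (simp add: R_def i' \<alpha>_def)
      have len: "length (replicate r 0 @ T @ W) \<le> j * length T + (j - i') * length T + (j - i' + 1) * \<alpha>"
        using W(4) r \<open>j - i' = Suc (j - i)\<close> by simp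
      have agree: "agree scratch n n0" using 1 by simp
      have dec: "bit_length (\<alpha> ^ i') < z"
        using 1 i \<alpha> regs(2)[OF agree] bit_length_div_less[of "n vQ" \<alpha>] Q by auto
      have less: "r < 2 ^ b" "\<sigma> mod \<alpha> ^ i' < 2 ^ b" "\<alpha> ^ i' < 2 ^ b" "n vcd < 2 ^ b" "n vm < 2 ^ b"
        using less_power_div[OF regs_boundedD[OF 1(1)], of vt "\<alpha> ^ i'"]
          less_power_mod[OF regs_boundedD[OF 1(1)], of vt "\<alpha> ^ i'"]
          less_power_div[OF regs_boundedD[OF 1(1)], of vQ "n val"] regs_boundedD[OF 1(1)]
        unfolding Q i(3) \<sigma>' r_def[symmetric] by blast+
      have le: "n vm \<le> b" "r \<le> b"
        using T[OF j] regs(7)[OF agree] r n0(8) by simp_all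
      have eqs: "n vt div \<alpha> ^ i' = r" "n vt mod \<alpha> ^ i' = \<sigma> mod \<alpha> ^ i'" "bin_word (n vcd) (n vm) = T"
        using i(3) \<sigma>' r_def T[OF j] regs(5,7)[OF agree] by simp_all
      have set: "set (replicate r 0 @ T @ W) \<subseteq> {0, 1}"
        using T(1)[OF j] W(2) by auto
      have "\<exists>i\<le>j. \<alpha> ^ i' = \<alpha> ^ i \<and> \<sigma> mod \<alpha> ^ i' = \<sigma> mod \<alpha> ^ i \<and>
          (\<exists>W'. replicate r 0 @ T @ W @ s0 = W' @ s0 \<and> set W' \<subseteq> {0, 1} \<and>
            mat_mod p (word_mat W') = mat_mod p (mat2 1 (int (E i)) 0 1 ** word_mat (R i)) \<and>
            length W' \<le> j * length T + (j - i) * length T + (j - i + 1) * \<alpha>)"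
        using i(1) i' set mat len
        by (intro exI[of _ i'] conjI exI[of _ "replicate r 0 @ T @ W"]) simp_all
      then show ?case
        using agree dec less le by (simp add: Q eqs W(1) del: length_append word_mat.simps)
    qed
  qed (auto simp: regs_bounded_bit_length)
  let ?c1 = "While (Const 1 <. Reg vQ) (vx <~ Reg vrcd ;; vi <~ Reg vm ;; emit ;; vQ <~ Reg vQ div. Reg val)"
  let ?c2 = "While (Const 1 <. Reg vQ)
       (vQ <~ Reg vQ div. Reg val ;;
        vx <~ Reg vcd ;; vi <~ Reg vm ;; emit ;;
        vx <~ Const 0 ;; vi <~ Reg vt div. Reg vQ ;; emit ;; vt <~ Reg vt mod. Reg vQ)"
  let ?mid = "vQ <~ Reg vP ;; vx <~ Const 0 ;; vi <~ Reg vt div. Reg vQ ;; emit ;; vt <~ Reg vt mod. Reg vQ ;; ?c2"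
  let ?Q = "\<lambda>n s. agree scratch n n0 \<and>
      (\<exists>W. s 0 = W @ s0 \<and> set W \<subseteq> {0, 1} \<and> mat_mod p (word_mat W) = mat_mod p (mat2 1 (int t) 0 1) \<and>
        length W \<le> 2 * j * length T + (j + 1) * y\<^sup>2)"
  have c2: "triple b ?I2 ?c2 ?Q"
  proof (rule triple_conseq[OF loop2], assumption, goal_cases)
    case (1 n s)
    then obtain W where W: "s 0 = W @ s0" "set W \<subseteq> {0, 1}"
        "mat_mod p (word_mat W) = mat_mod p (mat2 1 (int (E 0)) 0 1 ** word_mat (R 0))"
        "length W \<le> j * length T + j * length T + (j + 1) * \<alpha>"
      using pow by auto
    have "[E 0 = t] (mod p)"
    proof -
      have "[geom \<alpha> (2 * y * n0 vv) j = n0 vg] (mod p)"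
        using ready by (cases "j = 0") (auto simp: power_ready_def \<alpha>_def cong_sym)
      then have "[\<sigma> + geom \<alpha> (2 * y * n0 vv) j = (t + p - n0 vg) + n0 vg] (mod p)"
        by (intro cong_add) (simp_all add: \<sigma>_def)
      also have "(t + p - n0 vg) + n0 vg = t + p"
        using n0(7) by simp
      finally show ?thesis by (simp add: E_def cong_def)
    qed
    then have "mat_mod p (mat2 1 (int (E 0)) 0 1) = mat_mod p (mat2 1 (int t) 0 1)"
      by (intro mat_mod_mat2_eqI) (simp_all add: cong_int_iff)
    with W 1 show ?case
      by (auto simp: R_def \<alpha>_def)
  qed
  have mid: "triple b (\<lambda>n s. ?I1 n s \<and> expr_val (Const 1 <. Reg vQ) n s = 0) ?mid ?Q"
  proof (rule triple_pre, (rule c2 triple_intros triple_emit)+, goal_cases)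
    case (1 n s)
    then obtain i where n: "agree scratch n n0" "n vt = \<sigma>" and i: "n vQ = \<alpha> ^ i" "s 0 = R (j - i) @ s0"
      by blast
    from 1 have "\<not> 1 < n vQ" by simp
    with i have "i = 0" using pow[of i] by auto
    with i have s: "s 0 = R j @ s0" by simp
    \<comment> \<open>The leading digit. It is below \<alpha> because \<sigma> < p <
      \<alpha>^(j+1).\<close>
    define r where "r = \<sigma> div \<alpha> ^ j"
    have r: "r < \<alpha>"
      unfolding r_def by (rule less_mult_imp_div_less) (use \<sigma> n0(6) in simp)
    have "length (concat (replicate i (rev T))) = i * length T" for i
      by (induction i) auto
    then have len: "length (replicate r 0 @ R j) \<le> j * length T + (j - j) * length T + (j - j + 1) * \<alpha>"
      using r by (simp add: R_def)
    have "set (R j) \<subseteq> {0, 1}"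
      using T(1) by (cases "j = 0") (auto simp: R_def)
    moreover have "word_mat (replicate r 0 @ R j) = mat2 1 (int (E j)) 0 1 ** word_mat (R j)"
      by (simp add: E_def r_def word_mat_append word_mat_replicate)
    moreover have "\<sigma> < 2 ^ b"
      using 1(1) n(2) by (auto simp: regs_bounded_def)
    moreover have "n vP < 2 ^ b"
      using 1(1) by (rule regs_boundedD)
    ultimately show ?case
      using n s r len regs(3)[OF n(1)] n0(8)
      by (auto simp: r_def[symmetric] less_power_mod less_power_div intro!: exI[of _ j] exI[of _ "replicate r 0 @ R j"])
         (auto simp: r_def intro!: less_power_div)
  qed
  have c1: "triple b ?I1 (?c1 ;; ?mid) ?Q"
    by (rule triple_seq[OF mid loop1])
  show ?thesis
    unfolding write_power_def
  proof (rule triple_pre, (rule c1 triple_intros)+, goal_cases)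
    case (1 n s)
    then have "n vp = p" "n vg = n0 vg" "n vP = \<alpha> ^ j"
      using regs[of n] by auto
    moreover from this have "\<alpha> ^ j < 2 ^ b"
      using regs_boundedD[OF 1(1), of vP] by simp
    moreover have "\<sigma> < 2 ^ b"
      using \<sigma> regs_boundedD[OF 1(1), of vp] \<open>n vp = p\<close> by simp
    ultimately show ?case
      using 1 by (auto simp: \<sigma>_def[symmetric] R_def intro!: exI[of _ j])
  qed
qed

section \<open>Searching for a short word\<close>

text \<open>Minimality gives (y - 1)^2 <= L < y^2 for the bit length L of p, whence y^2 <= 4 L by y
  <= 2 (y - 1).\<close>

definition base :: "nat \<Rightarrow> nat" where
  "base p = (LEAST y. bit_length p < y\<^sup>2)"

definition step_bound :: "nat \<Rightarrow> nat" where
  "step_bound p = 2 ^ 18 * bit_length p * bit_length (bit_length p)"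

lemma bit_length_pos: "n > 0 \<Longrightarrow> bit_length n > 0"
  by (simp add: bit_length_half)

lemma bit_length_le: "bit_length n \<le> n"
  using less_exp[of n] bit_length_le_iff[of n n] by simp

lemma power_bit_length_le: "n > 0 \<Longrightarrow> 2 ^ bit_length n \<le> 2 * n"
  using floorlog_bounds[of n 2] bit_length_pos[of n]
  by (cases "bit_length n") (auto simp: bit_length_def)

lemma base_greater: "bit_length p < (base p)\<^sup>2"
proof -
  have "bit_length p < (bit_length p + 1)\<^sup>2" by (simp add: power2_eq_square)
  then show ?thesis unfolding base_def by (rule LeastI)
qed

lemma base_square_le:
  assumes "p > 0"
  shows "2 \<le> base p" "(base p)\<^sup>2 \<le> 4 * bit_length p"
proof -
  have L: "bit_length p > 0" using assms by (rule bit_length_pos)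
  show y: "2 \<le> base p"
  proof (rule ccontr)
    assume "\<not> 2 \<le> base p"
    then have "base p = 0 \<or> base p = 1" by auto
    then show False using base_greater[of p] L by auto
  qed
  have "\<not> bit_length p < (base p - 1)\<^sup>2"
    using not_less_Least[of "base p - 1" "\<lambda>y. bit_length p < y\<^sup>2"] y by (simp add: base_def)
  moreover have "(base p)\<^sup>2 \<le> (2 * (base p - 1))\<^sup>2"
    using y by (intro power_mono) auto
  ultimately show "(base p)\<^sup>2 \<le> 4 * bit_length p"
    by (simp add: power_mult_distrib)
qed

lemma step_bound_le: "step_bound p \<le> 2 ^ 18 * (bit_length p)\<^sup>2"
  unfolding step_bound_def power2_eq_square using bit_length_le[of "bit_length p"] by simp

text \<open>Registers hold whole words and so need about \<open>step_bound p\<close> bits, at most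
  2^18 L^2. The constant 2^20 leaves room for this and for all round counts.\<close>

definition fits :: "nat \<Rightarrow> nat \<Rightarrow> bool" where
  "fits p b \<longleftrightarrow> p > 1 \<and> 2 ^ 20 * (bit_length p)\<^sup>2 \<le> b"

lemma fitsD:
  assumes "fits p b"
  shows "8 * bit_length p \<le> b" "(base p)\<^sup>2 \<le> b" "step_bound p + 2 \<le> b" "20 < b"
proof -
  have p: "p > 0" and b: "1048576 * (bit_length p)\<^sup>2 \<le> b"
    using assms by (auto simp: fits_def)
  have B: "step_bound p \<le> 262144 * (bit_length p)\<^sup>2"
    using step_bound_le[of p] by simp
  have L: "1 \<le> bit_length p" using bit_length_pos[OF p] by simp
  then have L2: "bit_length p \<le> (bit_length p)\<^sup>2" by (simp add: power2_eq_square)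
  show "8 * bit_length p \<le> b" "20 < b" using L L2 b by auto
  show "(base p)\<^sup>2 \<le> b" using base_square_le(2)[OF p] L2 b by linarith
  show "step_bound p + 2 \<le> b" using B L L2 b by linarith
qed

lemma less_power_fits:
  assumes "fits p b" "(n :: nat) < 2 ^ (8 * bit_length p)"
  shows "n < 2 ^ b"
  using assms(2) by (rule less_le_trans) (intro power_increasing fitsD(1)[OF assms(1)], simp)

text \<open>Fair coins yield a uniform value below 2^L, not below p. Since 2^L <= 2 p, this costs at
  most a factor 2 in the probability of success.\<close>

definition sample :: prog where
  "sample =
    (vk <~ Const 0 ;; vi <~ Reg vL ;;
     While (Reg vi) (Flip vf ;; vk <~ Const 2 *. Reg vk +. Reg vf ;; vi <~ Reg vi -. Const 1))"

text \<open>The product in the guard is a conjunction; cutting off after \<open>vB\<close> steps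
  bounds both the time and the size of the packed words. Appending a letter acts on each row of the
  matrix separately, and only the corner v is needed later, so the lower row is never
  computed.\<close>

definition euclid :: prog where
  "euclid =
    (vx <~ Reg vy +. Reg vk *. Reg vp ;; vw <~ Reg vp *. Reg vp ;;
     vu <~ Const 1 ;; vv <~ Const 0 ;; vcd <~ Const 0 ;; vrcd <~ Const 0 ;; vpw <~ Const 1 ;; vm <~ Const 0 ;;
     While ((Const 0 <. Reg vw) *. (Reg vm <. Reg vB))
       (Ite (Reg vw <. Reg vx)
          (vx <~ Reg vx -. Reg vw ;; vv <~ Reg vu +. Reg vv ;; vcd <~ Const 2 *. Reg vcd)
          (vw <~ Reg vw -. Reg vx ;; vu <~ Reg vu +. Reg vv ;;
           vcd <~ Const 2 *. Reg vcd +. Const 1 ;; vrcd <~ Reg vrcd +. Reg vpw) ;;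
        vpw <~ Const 2 *. Reg vpw ;; vm <~ Reg vm +. Const 1) ;;
     vF <~ Reg vw =. Const 0)"

abbreviation (input) "search_regs \<equiv> {vF, vk, vi, vf, vx, vw, vu, vv, vcd, vrcd, vpw, vm}"

definition good_word :: "nat \<Rightarrow> nat \<Rightarrow> nat list \<Rightarrow> (nat \<Rightarrow> nat) \<Rightarrow> bool" where
  "good_word p y T n \<longleftrightarrow>
     set T \<subseteq> {0, 1} \<and> n vm = length T \<and> length T \<le> step_bound p \<and>
     bin_word (n vcd) (n vm) = T \<and> bin_word (n vrcd) (n vm) = rev T \<and>
     (\<exists>N M d. word_mat T = mat2 N (int (n vv)) M d \<and> [N = int y] (mod int p) \<and> int p dvd M)"

lemma good_word_upd: "good_word p y T (n(vF := k)) \<longleftrightarrow> good_word p y T n"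
  by (simp add: good_word_def)

text \<open>\<open>W\<close> is the part of the Euclidean word found so far and \<open>euc\<close>
  of the current pair is the rest. The bounds by 2^m keep all registers within b bits as long as m
  stays below the cut-off.\<close>

definition euclid_inv :: "nat \<Rightarrow> nat \<Rightarrow> (nat \<Rightarrow> nat) \<Rightarrow> nat list \<Rightarrow> bool" where
  "euclid_inv N M n W \<longleftrightarrow>
     n vm = length W \<and> W @ euc (n vx) (n vw) = euc N M \<and> 0 < n vx \<and> n vx \<le> N \<and> n vw \<le> M \<and>
     (\<exists>v1 v2. word_mat W = mat2 (int (n vu)) (int (n vv)) v1 v2) \<and>
     bin_word (n vcd) (n vm) = W \<and> bin_word (n vrcd) (n vm) = rev W \<and>
     n vcd < 2 ^ n vm \<and> n vrcd < 2 ^ n vm \<and> n vpw = 2 ^ n vm \<and> n vu + n vv \<le> 2 ^ n vm"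

lemma euclid_inv_0:
  assumes inv: "euclid_inv N M n W" and w: "0 < n vw" "n vw < n vx"
  shows "euclid_inv N M (n(vx := n vx - n vw, vv := n vu + n vv, vcd := 2 * n vcd, vpw := 2 * n vpw, vm := n vm + 1)) (W @ [0])"
proof -
  have "euc (n vx) (n vw) = 0 # euc (n vx - n vw) (n vw)"
    using w by (subst euc.simps) simp
  moreover obtain v1 v2 where "word_mat W = mat2 (int (n vu)) (int (n vv)) v1 v2"
    using inv by (auto simp: euclid_inv_def)
  then have "word_mat (W @ [0]) = mat2 (int (n vu)) (int (n vu + n vv)) v1 (v1 + v2)"
    by (simp add: word_mat_append A_mat_mat2 mat2_mult mat_1_mat2)
  moreover have "bin_word (n vrcd) (n vm + 1) = 0 # bin_word (n vrcd) (n vm)"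
  proof -
    have "n vrcd < 2 ^ n vm" "n vpw = 2 ^ n vm" using inv unfolding euclid_inv_def by blast+
    with bin_word_Cons[of "n vrcd" "n vm" 0] show ?thesis by (simp del: bin_word.simps)
  qed
  ultimately show ?thesis
    using inv w by (auto simp: euclid_inv_def simp del: bin_word.simps(2) simp: bin_word.simps(2)[of "2 * n vcd"])
qed

lemma euclid_inv_1:
  assumes inv: "euclid_inv N M n W" and w: "0 < n vw" "n vx \<le> n vw"
  shows "euclid_inv N M (n(vw := n vw - n vx, vu := n vu + n vv, vcd := 2 * n vcd + 1, vrcd := n vrcd + n vpw,
    vpw := 2 * n vpw, vm := n vm + 1)) (W @ [1])"
proof -
  have "euc (n vx) (n vw) = 1 # euc (n vx) (n vw - n vx)"
    using w inv by (subst euc.simps) (simp add: euclid_inv_def)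
  moreover obtain v1 v2 where "word_mat W = mat2 (int (n vu)) (int (n vv)) v1 v2"
    using inv by (auto simp: euclid_inv_def)
  then have "word_mat (W @ [1]) = mat2 (int (n vu + n vv)) (int (n vv)) (v1 + v2) v2"
    by (simp add: word_mat_append B_mat_mat2 mat2_mult mat_1_mat2)
  moreover have "bin_word (n vrcd + n vpw) (n vm + 1) = 1 # bin_word (n vrcd) (n vm)"
  proof -
    have "n vrcd < 2 ^ n vm" "n vpw = 2 ^ n vm" using inv unfolding euclid_inv_def by blast+
    with bin_word_Cons[of "n vrcd" "n vm" 1] show ?thesis by (simp del: bin_word.simps)
  qed
  ultimately show ?thesis
    using inv w by (auto simp: euclid_inv_def simp del: bin_word.simps(2) simp: bin_word.simps(2)[of "Suc (2 * n vcd)"])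
qed

lemma euclid_inv_good_word:
  assumes p: "prime p" and y: "0 < y" "y < p"
    and inv: "euclid_inv (y + k * p) (p\<^sup>2) n W" "n vm \<le> step_bound p" and w: "n vw = 0"
  shows "good_word p y W n"
proof -
  let ?N = "y + k * p"
  have "euc (n vx) (n vw) = []"
    using w by (subst euc.simps) simp
  with inv have W: "W = euc ?N (p\<^sup>2)"
    by (simp add: euclid_inv_def)
  have "\<not> p dvd y"
    using y by (auto dest: dvd_imp_le)
  then have "\<not> p dvd ?N"
    by (simp add: dvd_add_left_iff)
  then have "coprime ?N (p\<^sup>2)"
    using p by (simp add: prime_imp_coprime coprime_commute)
  then obtain b d where "word_mat W = mat2 (int ?N) b (int (p\<^sup>2)) d"
    using word_mat_euc[of ?N "p\<^sup>2"] y W by auto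
  moreover obtain v1 v2 where "word_mat W = mat2 (int (n vu)) (int (n vv)) v1 v2"
    using inv by (auto simp: euclid_inv_def)
  ultimately have "word_mat W = mat2 (int ?N) (int (n vv)) (int (p\<^sup>2)) d"
    by (metis mat2_nth(2))
  moreover have "[int ?N = int y] (mod int p)"
    by (simp add: cong_def)
  moreover have "int p dvd int (p\<^sup>2)"
    by simp
  ultimately have "\<exists>N M d. word_mat W = mat2 N (int (n vv)) M d \<and> [N = int y] (mod int p) \<and> int p dvd M"
    by blast
  moreover have "set W \<subseteq> {0, 1}"
    unfolding W by (rule set_euc)
  moreover have "n vm = length W" "bin_word (n vcd) (n vm) = W" "bin_word (n vrcd) (n vm) = rev W"
    using inv(1) unfolding euclid_inv_def by blast+
  moreover have "length W \<le> step_bound p"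
    using inv(2) \<open>n vm = length W\<close> by linarith
  ultimately show ?thesis
    unfolding good_word_def by blast
qed

text \<open>Failure is possible only if the full run is too long. Hence a good k succeeds with
  certainty, and the success probability of a round reduces to counting k.\<close>

lemma triple_euclid:
  assumes fits: "fits p b" and p: "prime p" and y: "y = base p" "y\<^sup>2 \<le> p"
    and n0: "n0 vp = p" "n0 vy = y" "n0 vB = step_bound p" and k: "k < 2 ^ bit_length p"
  shows "triple b (\<lambda>n s. agree search_regs n n0 \<and> n vk = k \<and> s 0 = s0) euclid
    (\<lambda>n s. agree search_regs n n0 \<and> s 0 = s0 \<and>
      (n vF = 0 \<longrightarrow> step_bound p < length (euc (y + k * p) (p\<^sup>2))) \<and>
      (n vF \<noteq> 0 \<longrightarrow> (\<exists>T. good_word p y T n)))"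
proof -
  let ?L = "bit_length p"
  let ?N = "y + k * p" and ?M = "p\<^sup>2"
  have p0: "1 < p" using p by (rule prime_gt_1_nat)
  have y0: "2 \<le> y" using base_square_le(1)[of p] p0 y by simp
  have y_less: "y < p"
  proof -
    have "y * 2 \<le> y * y" using y0 by (intro mult_le_mono2)
    then show ?thesis using y(2) y0 unfolding power2_eq_square by linarith
  qed
  have pL: "p < 2 ^ ?L" by (rule less_power_bit_length)
  have L: "1 \<le> ?L" using bit_length_pos[of p] p0 by simp
  have N: "?N < 2 ^ b"
  proof (rule less_power_fits[OF fits])
    have "?N \<le> 2 ^ ?L + 2 ^ ?L * 2 ^ ?L"
      using y_less pL k by (intro add_mono mult_le_mono) auto
    also have "\<dots> < 2 ^ (3 * ?L) + 2 ^ (3 * ?L)"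
      using L by (intro add_less_le_mono) (auto simp flip: power_add intro!: power_strict_increasing power_increasing)
    also have "\<dots> = 2 ^ (3 * ?L + 1)"
      by simp
    also have "\<dots> \<le> 2 ^ (8 * ?L)"
      using L by (intro power_increasing) auto
    finally show "?N < 2 ^ (8 * ?L)" .
  qed
  have M: "?M < 2 ^ b"
  proof (rule less_power_fits[OF fits])
    have "?M \<le> 2 ^ ?L * 2 ^ ?L"
      unfolding power2_eq_square using pL by (intro mult_le_mono) auto
    also have "\<dots> < 2 ^ (8 * ?L)"
      using L by (simp flip: power_add)
    finally show "?M < 2 ^ (8 * ?L)" .
  qed
  have pow: "2 * 2 ^ m < (2::nat) ^ b" if "m < step_bound p" for m
    using that fitsD(3)[OF fits] unfolding power_Suc[symmetric] by (intro power_strict_increasing) auto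
  let ?I = "\<lambda>n s. agree search_regs n n0 \<and> s 0 = s0 \<and> n vm \<le> step_bound p \<and> (\<exists>W. euclid_inv ?N ?M n W)"
  let ?c = "While ((Const 0 <. Reg vw) *. (Reg vm <. Reg vB))
       (Ite (Reg vw <. Reg vx)
          (vx <~ Reg vx -. Reg vw ;; vv <~ Reg vu +. Reg vv ;; vcd <~ Const 2 *. Reg vcd)
          (vw <~ Reg vw -. Reg vx ;; vu <~ Reg vu +. Reg vv ;;
           vcd <~ Const 2 *. Reg vcd +. Const 1 ;; vrcd <~ Reg vrcd +. Reg vpw) ;;
        vpw <~ Const 2 *. Reg vpw ;; vm <~ Reg vm +. Const 1)"
  have loop: "triple b ?I ?c (\<lambda>n s. ?I n s \<and> expr_val ((Const 0 <. Reg vw) *. (Reg vm <. Reg vB)) n s = 0)"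
  proof (rule triple_while[where m = "\<lambda>n s. step_bound p - n vm"], goal_cases)
    case (1 z)
    show ?case
    proof (rule triple_pre, (rule triple_intros)+, goal_cases)
      case (1 n s)
      then have *: "agree search_regs n n0" "s 0 = s0" "n vm < step_bound p" "0 < n vw" "step_bound p - n vm = z"
        using n0 by (auto simp: agree_def)
      from 1 obtain W where W: "euclid_inv ?N ?M n W" by blast
      then have bnd: "n vcd < 2 ^ n vm" "n vrcd < 2 ^ n vm" "n vpw = 2 ^ n vm" "n vu + n vv \<le> 2 ^ n vm"
        by (auto simp: euclid_inv_def)
      have less: "2 * n vcd + 1 < 2 ^ b" "n vrcd + n vpw < 2 ^ b" "2 * n vpw < 2 ^ b" "n vu + n vv < 2 ^ b" "n vm + 1 < 2 ^ b"
        using bnd pow[OF *(3)] less_exp[of "n vm"] by linarith+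
      have dec: "step_bound p - (n vm + 1) < z"
        using *(3,5) by linarith
      have less': "n vx - n vw < 2 ^ b" "n vw - n vx < 2 ^ b"
        by (rule less_power_diff[OF regs_boundedD[OF 1(1)]])+
      show ?case
      proof (cases "n vw < n vx")
        case True
        show ?thesis
          using exI[of "euclid_inv ?N ?M _", OF euclid_inv_0[OF W *(4) True]] True *(1-3) less less' dec by simp
      next
        case False
        then have "n vx \<le> n vw" by simp
        then show ?thesis
          using exI[of "euclid_inv ?N ?M _", OF euclid_inv_1[OF W *(4)]] False *(1-3) less less' dec by simp
      qed
    qed
  qed (use fitsD(3)[OF fits] in auto)
  have fin: "triple b (\<lambda>n s. ?I n s \<and> expr_val ((Const 0 <. Reg vw) *. (Reg vm <. Reg vB)) n s = 0) (vF <~ Reg vw =. Const 0)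
    (\<lambda>n s. agree search_regs n n0 \<and> s 0 = s0 \<and>
      (n vF = 0 \<longrightarrow> step_bound p < length (euc (y + k * p) (p\<^sup>2))) \<and>
      (n vF \<noteq> 0 \<longrightarrow> (\<exists>T. good_word p y T n)))"
  proof (rule triple_pre, rule triple_intros, goal_cases)
    case (1 n s)
    then obtain W where W: "euclid_inv ?N ?M n W" "n vm \<le> step_bound p" "agree search_regs n n0" "s 0 = s0"
      by blast
    show ?case
    proof (cases "n vw = 0")
      case True
      then have "good_word p y W n"
        using euclid_inv_good_word[OF p _ y_less W(1,2)] y0 by simp
      then have "good_word p y W (n(vF := 1))"
        by (simp only: good_word_upd)
      with True W show ?thesis
        using fitsD(4)[OF fits] one_less_power[of "2::nat" b] by auto
    next
      case False
      then have "n vm = step_bound p"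
        using 1 W n0 by (auto simp: agree_def)
      moreover have "euc (n vx) (n vw) \<noteq> []"
        using False W(1) by (subst euc.simps) (auto simp: euclid_inv_def)
      moreover have "length W + length (euc (n vx) (n vw)) = length (euc ?N ?M)" "length W = n vm"
        using W(1) by (auto simp: euclid_inv_def simp flip: length_append)
      ultimately have "step_bound p < length (euc ?N ?M)"
        by (cases "euc (n vx) (n vw)") auto
      with False W show ?thesis by auto
    qed
  qed
  show ?thesis
    unfolding euclid_def
  proof (rule triple_pre, (rule triple_seq[OF fin loop] triple_intros)+, goal_cases)
    case (1 n s)
    have "n vp = p" "n vy = y" using 1 n0 by (auto simp: agree_def)
    moreover have "euclid_inv ?N ?M (n(vx := ?N, vw := ?M, vu := 1, vv := 0, vcd := 0, vrcd := 0, vpw := 1, vm := 0)) []"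
      using y0 by (auto simp: euclid_inv_def mat_1_mat2)
    moreover have "(1::nat) < 2 ^ b" using fitsD(4)[OF fits] by (intro one_less_power) auto
    ultimately show ?case
      using 1 N M by (auto simp: power2_eq_square)
  qed
qed

section \<open>The success probability of one round\<close>

lemma measure_bind_spmf:
  "measure (measure_spmf (bind_spmf \<mu> f)) A = (\<integral>x. measure (measure_spmf (f x)) A \<partial>measure_spmf \<mu>)"
  by (simp add: measure_spmf_bind o_def measure_spmf.measure_bind[where N = "count_space UNIV"])

lemma measure_spmf_eq_1:
  assumes "lossless_spmf \<mu>" "set_spmf \<mu> \<subseteq> A"
  shows "measure (measure_spmf \<mu>) A = 1"
proof -
  have "measure (measure_spmf \<mu>) A = measure (measure_spmf \<mu>) UNIV"
    using assms(2) by (intro measure_spmf.finite_measure_eq_AE) auto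
  then show ?thesis
    using assms(1) by (simp add: lossless_spmf_def weight_spmf_def space_measure_spmf)
qed

abbreviation (input) "sample_loop \<equiv>
  While (Reg vi) (Flip vf ;; vk <~ Const 2 *. Reg vk +. Reg vf ;; vi <~ Reg vi -. Const 1)"

lemma card_sample_split:
  fixes k :: nat
  shows "card {r. r < 2 ^ Suc i \<and> k * 2 ^ Suc i + r \<in> G} =
    card {r. r < 2 ^ i \<and> (2 * k) * 2 ^ i + r \<in> G} + card {r. r < 2 ^ i \<and> (2 * k + 1) * 2 ^ i + r \<in> G}"
proof -
  let ?A = "{r. r < 2 ^ i \<and> (2 * k) * 2 ^ i + r \<in> G}"
  let ?B = "{r. r < 2 ^ i \<and> (2 * k + 1) * 2 ^ i + r \<in> G}"
  have "{r. r < 2 ^ Suc i \<and> k * 2 ^ Suc i + r \<in> G} = ?A \<union> (\<lambda>r. 2 ^ i + r) ` ?B"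
  proof (intro equalityI subsetI)
    fix r assume r: "r \<in> {r. r < 2 ^ Suc i \<and> k * 2 ^ Suc i + r \<in> G}"
    show "r \<in> ?A \<union> (\<lambda>r. 2 ^ i + r) ` ?B"
    proof (cases "r < 2 ^ i")
      case True
      with r show ?thesis by (simp add: ac_simps)
    next
      case False
      then have "r = 2 ^ i + (r - 2 ^ i)" by simp
      moreover have "r < 2 * 2 ^ i" using r by simp
      with False have "r - 2 ^ i < 2 ^ i" by linarith
      with r False have "r - 2 ^ i \<in> ?B"
        by (simp add: algebra_simps)
      ultimately show ?thesis by blast
    qed
  qed (auto simp: algebra_simps)
  moreover have "card (?A \<union> (\<lambda>r. 2 ^ i + r) ` ?B) = card ?A + card ((\<lambda>r. 2 ^ i + r) ` ?B)"
    by (intro card_Un_disjoint) auto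
  moreover have "card ((\<lambda>r. 2 ^ i + r) ` ?B) = card ?B"
    by (intro card_image) (auto intro: inj_onI)
  ultimately show ?thesis by simp
qed

text \<open>With the high bits fixed to k and i flips to go, the result is k 2^i + r with r uniform.
  The induction splits the values of r by their top bit.\<close>

lemma measure_sample_loop:
  "num \<sigma> vi = i \<Longrightarrow> measure (measure_spmf (exec sample_loop \<sigma>)) {\<tau>. num \<tau> vk \<in> G} =
    card {r. r < 2 ^ i \<and> num \<sigma> vk * 2 ^ i + r \<in> G} / 2 ^ i"
proof (induction i arbitrary: \<sigma>)
  case 0
  then have "measure (measure_spmf (exec sample_loop \<sigma>)) {\<tau>. num \<tau> vk \<in> G} = of_bool (num \<sigma> vk \<in> G)"
    by (subst exec_while) (simp add: measure_spmf_return_spmf measure_return tick_def indicator_def)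
  moreover have "{r :: nat. r < 1 \<and> num \<sigma> vk + r \<in> G} = (if num \<sigma> vk \<in> G then {0} else {})"
    by auto
  ultimately show ?case by simp
next
  case (Suc i)
  let ?body = "Flip vf ;; vk <~ Const 2 *. Reg vk +. Reg vf ;; vi <~ Reg vi -. Const 1"
  let ?\<sigma> = "tick (1 + cost_expr (Reg vi) \<sigma>) \<sigma>"
  obtain F where F: "exec ?body ?\<sigma> = map_spmf F coin_spmf"
    "\<And>b. num (F b) vi = i" "\<And>b. num (F b) vk = 2 * num \<sigma> vk + of_bool b"
  proof
    \<comment> \<open>After the coin flip the body is deterministic, so its distribution is a point
      mass and \<open>the_elem\<close> of the support names the resulting state.\<close>
    show "exec ?body ?\<sigma> = map_spmf (\<lambda>b. the_elem (set_spmf (exec (vk <~ Const 2 *. Reg vk +. Reg vf ;; vi <~ Reg vi -. Const 1)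
        (tick 1 (set_num vf (of_bool b) ?\<sigma>))))) coin_spmf"
      by (simp add: bind_map_spmf map_spmf_conv_bind_spmf o_def)
  qed (use Suc.prems in \<open>simp_all add: tick_def set_num_def\<close>)
  let ?m = "\<lambda>\<tau>. measure (measure_spmf (exec sample_loop \<tau>)) {\<tau>. num \<tau> vk \<in> G}"
  have "exec sample_loop \<sigma> = bind_spmf (exec ?body ?\<sigma>) (exec sample_loop)"
    using Suc.prems by (subst exec_while) simp
  also have "\<dots> = bind_spmf coin_spmf (\<lambda>b. exec sample_loop (F b))"
    by (simp only: F(1) bind_map_spmf o_def)
  finally have "?m \<sigma> = (\<integral>b. ?m (F b) \<partial>measure_spmf coin_spmf)"
    by (simp only: measure_bind_spmf)
  also have "\<dots> = (?m (F False) + ?m (F True)) / 2"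
    by (simp only: integral_spmf_of_set UNIV_bool) simp
  also have "\<dots> = (card {r. r < 2 ^ i \<and> (2 * num \<sigma> vk) * 2 ^ i + r \<in> G} / 2 ^ i +
      card {r. r < 2 ^ i \<and> (2 * num \<sigma> vk + 1) * 2 ^ i + r \<in> G} / 2 ^ i) / 2"
    by (simp only: Suc.IH[OF F(2)] F(3)) simp
  also have "\<dots> = card {r. r < 2 ^ Suc i \<and> num \<sigma> vk * 2 ^ Suc i + r \<in> G} / 2 ^ Suc i"
    unfolding card_sample_split by (simp add: add_divide_distrib)
  finally show ?case .
qed

lemma triple_sample:
  assumes fits: "fits p b" and n0: "n0 vL = bit_length p"
  shows "triple b (\<lambda>n s. agree search_regs n n0 \<and> s 0 = s0) sample
    (\<lambda>n s. agree search_regs n n0 \<and> s 0 = s0 \<and> n vk < 2 ^ bit_length p)"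
proof -
  let ?L = "bit_length p"
  let ?I = "\<lambda>n s. agree search_regs n n0 \<and> s 0 = s0 \<and> n vi \<le> ?L \<and> n vk < 2 ^ (?L - n vi)"
  have L: "8 * ?L \<le> b" "20 < b" using fitsD[OF fits] by auto
  have loop: "triple b ?I sample_loop (\<lambda>n s. ?I n s \<and> expr_val (Reg vi) n s = 0)"
  proof (rule triple_while[where m = "\<lambda>n s. n vi"], goal_cases)
    case (1 z)
    show ?case
    proof (rule triple_pre, (rule triple_intros)+, goal_cases)
      case (1 n s)
      then have i: "?L - (n vi - 1) = Suc (?L - n vi)" by auto
      have k: "2 * n vk + 1 < 2 ^ (?L - (n vi - 1))"
      proof -
        have "n vk < 2 ^ (?L - n vi)" using 1(2) by blast
        then show ?thesis unfolding i power_Suc by linarith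
      qed
      also have "\<dots> \<le> 2 ^ b" using L by (intro power_increasing) auto
      finally have "2 * n vk + 1 < 2 ^ b" .
      with k 1 L less_power_diff[OF regs_boundedD[OF 1(1)], of vi 1] show ?case by auto
    qed
  qed (use L in auto)
  have loop': "triple b ?I sample_loop (\<lambda>n s. agree search_regs n n0 \<and> s 0 = s0 \<and> n vk < 2 ^ ?L)"
    by (rule triple_conseq[OF loop]) auto
  show ?thesis
    unfolding sample_def
  proof (rule triple_pre, (rule loop' triple_intros)+, goal_cases)
    case (1 n s)
    then have "n vL = ?L" using n0 by (auto simp: agree_def)
    with 1 regs_boundedD[OF 1(1), of vL] show ?case by auto
  qed
qed

text \<open>Starting with the flag set when p < y^2 skips the search for primes that need no word
  T.\<close>

definition search :: prog where
  "search = (vF <~ Reg vp <. Reg val ;; While (Reg vF =. Const 0) (sample ;; euclid))"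

text \<open>Half of the k below p are good, and p is at least half of 2^L.\<close>

lemma success_probability:
  assumes p: "prime p" and y: "y = base p" "y\<^sup>2 \<le> p"
  defines "G \<equiv> {k. k < 2 ^ bit_length p \<and> length (euc (y + k * p) (p\<^sup>2)) \<le> step_bound p}"
  shows "1 / 4 \<le> real (card G) / 2 ^ bit_length p"
proof -
  have p0: "0 < p" using p by (rule prime_gt_0_nat)
  have y0: "2 \<le> y" using base_square_le(1)[OF p0] y by simp
  have "y + 1 < p"
  proof -
    have "y * 2 \<le> y * y" using y0 by (intro mult_le_mono2)
    then have "2 * y \<le> p" using y(2) unfolding power2_eq_square by linarith
    moreover have "p \<noteq> 4" using p by (auto dest: prime_nat_iff[THEN iffD1])
    ultimately show ?thesis using y0 by linarith
  qed
  note base_eq = y(1)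
  from \<open>y + 1 < p\<close> interpret euc_sampling p y
    using p y0 by unfold_locales
  have "p \<le> 2 * card {k \<in> {..<p}. length (euc (y + k * p) (p\<^sup>2)) \<le> step_bound p}"
    using card_short_euc[OF base_greater[of p, folded base_eq] base_square_le(2)[OF p0, folded base_eq]]
    unfolding step_bound_def by simp
  also have "card {k \<in> {..<p}. length (euc (y + k * p) (p\<^sup>2)) \<le> step_bound p} \<le> card G"
    unfolding G_def using less_power_bit_length[of p] by (intro card_mono) auto
  finally have "p \<le> 2 * card G" by simp
  moreover have "2 ^ bit_length p \<le> 2 * p" by (rule power_bit_length_le[OF p0])
  ultimately have "2 ^ bit_length p \<le> 4 * card G" by simp
  then have "real (2 ^ bit_length p) \<le> real (4 * card G)" by (simp only: of_nat_le_iff)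
  then show ?thesis by (simp add: field_simps)
qed

lemma triple_search:
  assumes fits: "fits p b" and p: "prime p"
    and n0: "n0 vp = p" "n0 vL = bit_length p" "n0 vy = base p" "n0 val = (base p)\<^sup>2" "n0 vB = step_bound p"
  shows "triple b (\<lambda>n s. agree search_regs n n0 \<and> s 0 = s0) search
    (\<lambda>n s. agree search_regs n n0 \<and> s 0 = s0 \<and> ((base p)\<^sup>2 \<le> p \<longrightarrow> (\<exists>T. good_word p (base p) T n)))"
proof -
  let ?y = "base p" and ?L = "bit_length p"
  let ?I = "\<lambda>n s. agree search_regs n n0 \<and> s 0 = s0 \<and> (n vF = 0 \<longrightarrow> ?y\<^sup>2 \<le> p) \<and>
    (n vF \<noteq> 0 \<longrightarrow> ?y\<^sup>2 \<le> p \<longrightarrow> (\<exists>T. good_word p ?y T n))"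
  let ?S = "\<lambda>n s. agree search_regs n n0 \<and> s 0 = s0 \<and> n vk < 2 ^ ?L"
  have euclid: "spec b (exec euclid \<tau>) (\<lambda>n s. agree search_regs n n0 \<and> s 0 = s0 \<and>
      (n vF = 0 \<longrightarrow> step_bound p < length (euc (?y + num \<tau> vk * p) (p\<^sup>2))) \<and>
      (n vF \<noteq> 0 \<longrightarrow> (\<exists>T. good_word p ?y T n))) (time \<tau> + prog_cost b euclid * (b + 1))"
    if "?y\<^sup>2 \<le> p" "regs_bounded b (num \<tau>)" "?S (num \<tau>) (stk \<tau>)" for \<tau> :: config
    using that by (intro hoareD[OF triple_euclid[OF fits p refl that(1) n0(1,3,5), of "num \<tau> vk" s0, unfolded triple_def]]) auto
  have "triple b (\<lambda>n s. ?S n s \<and> ?y\<^sup>2 \<le> p) euclid ?I"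
    unfolding triple_def hoare_def
  proof (intro allI impI, elim conjE, goal_cases)
    case (1 \<sigma>)
    show ?case by (rule spec_weaken[OF euclid]) (use 1 in auto)
  qed
  moreover have "triple b (\<lambda>n s. ?I n s \<and> expr_val (Reg vF =. Const 0) n s \<noteq> 0) sample (\<lambda>n s. ?S n s \<and> ?y\<^sup>2 \<le> p)"
  proof (cases "?y\<^sup>2 \<le> p")
    case True
    then show ?thesis
      by (intro triple_conseq[OF triple_sample[where p = p and ?n0.0 = n0 and ?s0.0 = s0, OF fits n0(2)]]) auto
  next
    case False
    then show ?thesis by (auto simp: triple_def hoare_def)
  qed
  ultimately have body: "triple b (\<lambda>n s. ?I n s \<and> expr_val (Reg vF =. Const 0) n s \<noteq> 0) (sample ;; euclid) ?I"
    by (rule triple_seq)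
  have loop: "triple b ?I (While (Reg vF =. Const 0) (sample ;; euclid)) (\<lambda>n s. ?I n s \<and> expr_val (Reg vF =. Const 0) n s = 0)"
  proof (rule triple_while_search[OF body])
    fix \<sigma> :: config
    assume \<sigma>: "regs_bounded b (num \<sigma>)" "?I (num \<sigma>) (stk \<sigma>)" "expr_val (Reg vF =. Const 0) (num \<sigma>) (stk \<sigma>) \<noteq> 0"
    then have y: "?y\<^sup>2 \<le> p" by auto
    define G where "G = {k. k < 2 ^ bit_length p \<and> length (euc (?y + k * p) (p\<^sup>2)) \<le> step_bound p}"
    let ?F = "{\<tau> :: config. expr_val (Reg vF =. Const 0) (num \<tau>) (stk \<tau>) = 0}"
    have sample: "regs_bounded b (num \<tau>) \<and> ?S (num \<tau>) (stk \<tau>)" if "\<tau> \<in> set_spmf (exec sample \<sigma>)" for \<tau>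
      using hoareD[OF triple_sample[where p = p and ?n0.0 = n0 and ?s0.0 = s0, OF fits n0(2), unfolded triple_def], of \<sigma>] \<sigma> that
      by (auto simp: spec_def)
    have "1 / 4 \<le> real (card G) / 2 ^ ?L"
      using success_probability[OF p refl y] by (simp add: G_def)
    also have "\<dots> = measure (measure_spmf (exec sample \<sigma>)) {\<tau>. num \<tau> vk \<in> G}"
    proof -
      have L: "num \<sigma> vL = ?L" using \<sigma> n0 by (auto simp: agree_def)
      obtain \<sigma>' where \<sigma>': "exec sample \<sigma> = exec sample_loop \<sigma>'" "num \<sigma>' vi = ?L" "num \<sigma>' vk = 0"
      proof
        let ?\<sigma>1 = "the_elem (set_spmf (exec (vk <~ Const 0) \<sigma>))"
        let ?\<sigma>2 = "the_elem (set_spmf (exec (vi <~ Reg vL) ?\<sigma>1))"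
        show "exec sample \<sigma> = exec sample_loop ?\<sigma>2"
          by (simp add: sample_def)
      qed (use L in \<open>simp_all add: tick_def set_num_def\<close>)
      have "{r. r < 2 ^ ?L \<and> 0 * 2 ^ ?L + r \<in> G} = G" by (auto simp: G_def)
      with measure_sample_loop[OF \<sigma>'(2), of G] show ?thesis
        by (simp only: \<sigma>') 
    qed
    \<comment> \<open>Conditioning on the sampled state: where k lies in \<open>G\<close> the
      Euclidean run succeeds with probability 1, elsewhere 0 is a lower bound.\<close>
    also have "\<dots> = (\<integral>\<tau>. indicator {\<tau>. num \<tau> vk \<in> G} \<tau> \<partial>measure_spmf (exec sample \<sigma>))"
      by simp
    also have "\<dots> \<le> (\<integral>\<tau>. measure (measure_spmf (exec euclid \<tau>)) ?F \<partial>measure_spmf (exec sample \<sigma>))"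
    proof (rule integral_mono_AE)
      show "integrable (measure_spmf (exec sample \<sigma>)) (\<lambda>\<tau>. measure (measure_spmf (exec euclid \<tau>)) ?F)"
        by (intro measure_spmf.integrable_const_bound[where B = 1]) (auto simp: measure_spmf.subprob_measure_le_1)
      show "AE \<tau> in measure_spmf (exec sample \<sigma>). indicator {\<tau>. num \<tau> vk \<in> G} \<tau> \<le> measure (measure_spmf (exec euclid \<tau>)) ?F"
      proof (simp, intro ballI)
        fix \<tau> assume \<tau>: "\<tau> \<in> set_spmf (exec sample \<sigma>)"
        show "indicator {\<tau>. num \<tau> vk \<in> G} \<tau> \<le> measure (measure_spmf (exec euclid \<tau>)) {\<tau>. 0 < num \<tau> vF}"
        proof (cases "num \<tau> vk \<in> G")
          case True
          then have "lossless_spmf (exec euclid \<tau>)" "set_spmf (exec euclid \<tau>) \<subseteq> {\<tau>. 0 < num \<tau> vF}"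
            using euclid[OF y, of \<tau>] sample[OF \<tau>] by (auto simp: spec_def G_def)
          then show ?thesis using True by (simp add: measure_spmf_eq_1)
        qed simp
      qed
    qed (auto intro!: integrable_real_indicator simp: measure_spmf.emeasure_eq_measure)
    also have "\<dots> = measure (measure_spmf (exec (sample ;; euclid) \<sigma>)) ?F"
      by (simp only: exec.simps measure_bind_spmf)
    finally show "1 / 4 \<le> measure (measure_spmf (exec (sample ;; euclid) \<sigma>)) ?F" .
  qed
  have loop': "triple b ?I (While (Reg vF =. Const 0) (sample ;; euclid))
      (\<lambda>n s. agree search_regs n n0 \<and> s 0 = s0 \<and> ((base p)\<^sup>2 \<le> p \<longrightarrow> (\<exists>T. good_word p (base p) T n)))"
    by (rule triple_conseq[OF loop]) auto
  show ?thesis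
    unfolding search_def
  proof (rule triple_pre, (rule loop' triple_intros)+, goal_cases)
    case (1 n s)
    then have "n vp = p" "n val = ?y\<^sup>2" using n0 by (auto simp: agree_def)
    moreover have "(1::nat) < 2 ^ b" using fitsD(4)[OF fits] by (intro one_less_power) auto
    ultimately show ?case using 1 by auto
  qed
qed

section \<open>Parameters, exponent shift and modular inverse\<close>

definition set_params :: prog where
  "set_params =
    (vL <~ Const 0 ;; vx <~ Reg vp ;; bit_length_prog vx vL ;;
     vl <~ Const 0 ;; vx <~ Reg vL ;; bit_length_prog vx vl ;;
     vy <~ Const 1 ;; While (Reg vy *. Reg vy <. Reg vL +. Const 1) (vy <~ Reg vy +. Const 1) ;;
     val <~ Reg vy *. Reg vy ;; vB <~ Const (2 ^ 18) *. Reg vL *. Reg vl)"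

lemma triple_set_params:
  assumes fits: "fits p b" and n0: "n0 vp = p"
  shows "triple b (\<lambda>n s. n = n0 \<and> s = s0) set_params
    (\<lambda>n s. agree {vx, vL, vl, vy, val, vB} n n0 \<and> s = s0 \<and> n vL = bit_length p \<and> n vy = base p \<and>
      n val = (base p)\<^sup>2 \<and> n vB = step_bound p)"
proof -
  let ?L = "bit_length p" and ?l = "bit_length (bit_length p)"
  have b: "8 * ?L \<le> b" "20 < b" "step_bound p + 2 \<le> b" "(base p)\<^sup>2 \<le> b" using fitsD[OF fits] by auto
  have less: "m < 2 ^ b" if "m \<le> b" for m :: nat
    using that less_exp[of b] by (rule le_less_trans)
  have p: "p < 2 ^ b"
    by (rule less_power_fits[OF fits])
       (rule less_le_trans[OF less_power_bit_length], rule power_increasing, auto)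
  have l: "?l \<le> ?L" by (rule bit_length_le)
  let ?I = "\<lambda>n s. agree {vx, vL, vl, vy, val, vB} n n0 \<and> s = s0 \<and> n vL = ?L \<and> n vl = ?l \<and>
    1 \<le> n vy \<and> n vy \<le> ?L + 1 \<and> (\<forall>z < n vy. z\<^sup>2 \<le> ?L)"
  let ?c = "While (Reg vy *. Reg vy <. Reg vL +. Const 1) (vy <~ Reg vy +. Const 1)"
  have loop: "triple b ?I ?c (\<lambda>n s. ?I n s \<and> expr_val (Reg vy *. Reg vy <. Reg vL +. Const 1) n s = 0)"
  proof (rule triple_while[where m = "\<lambda>n s. ?L + 1 - n vy"], goal_cases)
    case (1 z)
    show ?case
    proof (rule triple_pre, (rule triple_intros)+, goal_cases)
      case (1 n s)
      then have *: "agree {vx, vL, vl, vy, val, vB} n n0" "s = s0" "n vL = ?L" "n vl = ?l"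
        "1 \<le> n vy" "\<forall>z < n vy. z\<^sup>2 \<le> ?L" "?L + 1 - n vy = z"
        by blast+
      from 1 * have y: "(n vy)\<^sup>2 \<le> ?L" by (auto simp: power2_eq_square split: if_splits)
      then have "n vy \<le> ?L"
        using *(5) order_trans[of "n vy" "(n vy)\<^sup>2"] by (simp add: power2_eq_square)
      moreover have "\<forall>z < n vy + 1. z\<^sup>2 \<le> ?L"
        using *(6) y by (auto simp: less_Suc_eq)
      moreover have "n vy + 1 < 2 ^ b"
        using \<open>n vy \<le> ?L\<close> b by (intro less) simp
      ultimately show ?case
        using *(1-5,7) by auto
    qed
  qed (use b in auto)
  have params: "triple b ?I (?c ;; val <~ Reg vy *. Reg vy ;; vB <~ Const (2 ^ 18) *. Reg vL *. Reg vl)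
    (\<lambda>n s. agree {vx, vL, vl, vy, val, vB} n n0 \<and> s = s0 \<and> n vL = ?L \<and> n vy = base p \<and>
      n val = (base p)\<^sup>2 \<and> n vB = step_bound p)"
  proof (rule triple_seq[OF _ loop], rule triple_pre, (rule triple_intros)+, goal_cases)
    case (1 n s)
    then have *: "agree {vx, vL, vl, vy, val, vB} n n0" "s = s0" "n vL = ?L" "n vl = ?l"
      "\<forall>z < n vy. z\<^sup>2 \<le> ?L"
      by blast+
    from 1 * have "?L < (n vy)\<^sup>2" by (auto simp: power2_eq_square)
    then have y: "n vy = base p"
      unfolding base_def using *(5) by (intro Least_equality[symmetric]) (auto simp: not_less[symmetric])
    have "base p * base p < 2 ^ b" "2 ^ 18 * ?L * ?l < 2 ^ b"
      using b by (auto intro!: less simp: power2_eq_square step_bound_def)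
    then show ?case
      using * y by (auto simp: power2_eq_square step_bound_def)
  qed
  have neq: "vx \<noteq> vL" "vx \<noteq> vl" by simp_all
  show ?thesis
    unfolding set_params_def
  proof (rule triple_pre, (rule params triple_bit_length_prog[OF neq(1)] triple_bit_length_prog[OF neq(2)] triple_intros)+, goal_cases)
    case (1 n s)
    have "?L < 2 ^ b" "?l < 2 ^ b" "(1::nat) < 2 ^ b"
      using b l by (auto intro!: less)
    then show ?case
      using 1 n0 p by (auto simp: agree_def)
  qed
qed

text \<open>The shift is built modulo p alongside the power of \<alpha>, which keeps the registers
  small. If p < \<alpha>, the loop is never entered and the content of \<open>vv\<close> does not
  matter.\<close>

definition set_shift :: prog where
  "set_shift =
    (vg <~ Const 0 ;; vP <~ Const 1 ;;
     While (Reg vP *. Reg val <. Reg vp +. Const 1)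
       (vg <~ (Reg vg *. Reg val +. Const 2 *. Reg vy *. Reg vv) mod. Reg vp ;; vP <~ Reg vP *. Reg val))"

lemma triple_set_shift:
  assumes n0: "n0 vp = p" "0 < p" "n0 val = y\<^sup>2" "2 \<le> y" "n0 vy = y"
  shows "triple b (\<lambda>n s. n = n0 \<and> s = s0) set_shift
    (\<lambda>n s. agree {vg, vP} n n0 \<and> s = s0 \<and>
      (\<exists>j. n vP = (y\<^sup>2) ^ j \<and> (y\<^sup>2) ^ j \<le> p \<and> p < (y\<^sup>2) ^ Suc j \<and> n vg < p \<and>
        n vg = geom (y\<^sup>2) (2 * y * n0 vv) j mod p))"
proof -
  define \<alpha> where "\<alpha> = y\<^sup>2"
  let ?\<beta> = "2 * y * n0 vv"
  have \<alpha>: "2 \<le> \<alpha>"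
    using mult_le_mono[OF n0(4) n0(4)] by (simp add: \<alpha>_def power2_eq_square)
  let ?I = "\<lambda>n s. agree {vg, vP} n n0 \<and> s = s0 \<and>
    (\<exists>j. n vP = \<alpha> ^ j \<and> \<alpha> ^ j \<le> p \<and> n vg = geom \<alpha> ?\<beta> j mod p)"
  let ?g = "Reg vP *. Reg val <. Reg vp +. Const 1"
  have loop: "triple b ?I (While ?g (vg <~ (Reg vg *. Reg val +. Const 2 *. Reg vy *. Reg vv) mod. Reg vp ;; vP <~ Reg vP *. Reg val))
    (\<lambda>n s. ?I n s \<and> expr_val ?g n s = 0)"
  proof (rule triple_while[where m = "\<lambda>n s. bit_length (n vp div n vP)"], goal_cases)
    case (1 z)
    show ?case
    proof (rule triple_pre, (rule triple_intros)+, goal_cases)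
      case (1 n s)
      then obtain j where *: "agree {vg, vP} n n0" "s = s0" "n vP = \<alpha> ^ j" "\<alpha> ^ j \<le> p" "n vg = geom \<alpha> ?\<beta> j mod p"
        "expr_val ?g n s \<noteq> 0" "bit_length (n vp div n vP) = z"
        by blast
      have r: "n vp = p" "n val = \<alpha>" "n vy = y" "n vv = n0 vv"
        using *(1) n0 by (auto simp: agree_def \<alpha>_def)
      have le: "\<alpha> ^ j * \<alpha> \<le> p"
        using *(6) by (auto simp: r *(3) split: if_splits)
      have "(n vg * \<alpha> + 2 * y * n0 vv) mod p = geom \<alpha> ?\<beta> (Suc j) mod p"
        unfolding *(5) geom.simps by (intro mod_add_cong mod_mult_left_eq) simp
      moreover have "p < 2 ^ b" using regs_boundedD[OF 1(1), of vp] r by simp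
      moreover from this have "(n vg * \<alpha> + 2 * y * n0 vv) mod p < 2 ^ b"
        using n0(2) by (meson less_trans mod_less_divisor)
      moreover have "bit_length (p div (\<alpha> ^ j * \<alpha>)) < z"
      proof -
        have "bit_length (p div \<alpha> ^ j div \<alpha>) < bit_length (p div \<alpha> ^ j)"
          using *(4) \<alpha> by (intro bit_length_div_less) (auto simp: div_greater_zero_iff)
        then show ?thesis using *(7) r *(3) by (simp add: div_mult2_eq)
      qed
      ultimately show ?case
        using *(1-3) r le by (auto intro!: exI[of _ "Suc j"] simp: mult.commute)
    qed
  next
    case (2 n s)
    have "bit_length (n vp div n vP) \<le> bit_length (n vp)"
      unfolding bit_length_def by (intro floorlog_mono div_le_dividend)
    then show ?case using regs_bounded_bit_length[OF 2(1), of vp] by simp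
  qed
  have loop': "triple b ?I (While ?g (vg <~ (Reg vg *. Reg val +. Const 2 *. Reg vy *. Reg vv) mod. Reg vp ;; vP <~ Reg vP *. Reg val))
    (\<lambda>n s. agree {vg, vP} n n0 \<and> s = s0 \<and>
      (\<exists>j. n vP = (y\<^sup>2) ^ j \<and> (y\<^sup>2) ^ j \<le> p \<and> p < (y\<^sup>2) ^ Suc j \<and> n vg < p \<and>
        n vg = geom (y\<^sup>2) (2 * y * n0 vv) j mod p))"
  proof (rule triple_conseq[OF loop], assumption, goal_cases)
    case (1 n s)
    then obtain j where *: "agree {vg, vP} n n0" "s = s0" "n vP = \<alpha> ^ j" "\<alpha> ^ j \<le> p" "n vg = geom \<alpha> ?\<beta> j mod p"
      "expr_val ?g n s = 0"
      by blast
    have r: "n vp = p" "n val = \<alpha>"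
      using *(1) n0 by (auto simp: agree_def \<alpha>_def)
    have "p < \<alpha> ^ j * \<alpha>"
      using *(6) by (auto simp: r *(3) split: if_splits)
    then show ?case
      using * n0(2) by (auto simp: \<alpha>_def mult.commute intro!: exI[of _ j])
  qed
  show ?thesis
    unfolding set_shift_def
  proof (rule triple_pre, (rule loop' triple_intros)+, goal_cases)
    case (1 n s)
    have "n vp < 2 ^ b" using 1(1) by (rule regs_boundedD)
    then have "(1::nat) < 2 ^ b \<or> p = 1" using 1 n0 by auto
    show ?case
      using 1 n0 \<open>(1::nat) < 2 ^ b \<or> p = 1\<close> regs_boundedD[OF 1(1), of vy] by (auto intro!: exI[of _ 0])
  qed
qed

text \<open>Fermat inversion by square and multiply, with one round for each bit of p - 2. The loop
  preserves r x^e modulo p.\<close>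

definition set_inverse :: prog where
  "set_inverse =
    (vr <~ Const 1 ;; vx <~ Reg vc ;; ve <~ Reg vp -. Const 2 ;;
     While (Reg ve)
       (Ite (Reg ve mod. Const 2) (vr <~ (Reg vr *. Reg vx) mod. Reg vp) Skip ;;
        vx <~ (Reg vx *. Reg vx) mod. Reg vp ;; ve <~ Reg ve div. Const 2))"

lemma fermat_inverse:
  assumes p: "prime (p :: nat)" and c: "\<not> p dvd c"
  shows "[c ^ (p - 2) * c = 1] (mod p)"
proof -
  have "p - 1 = Suc (p - 2)"
    using prime_ge_2_nat[OF p] by simp
  then have "c ^ (p - 2) * c = c ^ (p - 1)"
    by simp
  with fermat_theorem[OF p c] show ?thesis by simp
qed

lemma triple_set_inverse:
  assumes p: "prime p" and n0: "n0 vp = p" "0 < n0 vc" "n0 vc < p"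
  shows "triple b (\<lambda>n s. n = n0 \<and> s = s0) set_inverse
    (\<lambda>n s. agree {vr, vx, ve} n n0 \<and> s = s0 \<and> [n vr * n0 vc = 1] (mod p))"
proof -
  define c where "c = n0 vc"
  have p1: "1 < p" using p by (rule prime_gt_1_nat)
  let ?I = "\<lambda>n s. agree {vr, vx, ve} n n0 \<and> s = s0 \<and> [n vr * n vx ^ n ve = c ^ (p - 2)] (mod p)"
  let ?c = "While (Reg ve)
       (Ite (Reg ve mod. Const 2) (vr <~ (Reg vr *. Reg vx) mod. Reg vp) Skip ;;
        vx <~ (Reg vx *. Reg vx) mod. Reg vp ;; ve <~ Reg ve div. Const 2)"
  have loop: "triple b ?I ?c (\<lambda>n s. ?I n s \<and> expr_val (Reg ve) n s = 0)"
  proof (rule triple_while[where m = "\<lambda>n s. bit_length (n ve)"], goal_cases)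
    case (1 z)
    show ?case
    proof (rule triple_pre, (rule triple_intros)+, goal_cases)
      case (1 n s)
      then have *: "agree {vr, vx, ve} n n0" "s = s0" "[n vr * n vx ^ n ve = c ^ (p - 2)] (mod p)"
        "expr_val (Reg ve) n s \<noteq> 0" "bit_length (n ve) = z"
        by blast+
      have r: "n vp = p" using *(1) n0 by (auto simp: agree_def)
      have "p < 2 ^ b" using regs_boundedD[OF 1(1), of vp] r by simp
      then have less: "k mod p < 2 ^ b" for k
        using p1 by (meson less_trans mod_less_divisor zero_less_one)
      have ve: "n ve div 2 < 2 ^ b" by (rule less_power_div[OF regs_boundedD[OF 1(1)]])
      have dec: "bit_length (n ve div 2) < z"
        using bit_length_div_less[of "n ve" 2] *(4,5) by simp
      define h where "h = n ve div 2"
      have sq: "[(n vx * n vx mod p) ^ h = n vx ^ (2 * h)] (mod p)"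
        by (simp add: cong_def power_mod power_mult power2_eq_square)
      show ?case
      proof (cases "n ve mod 2 = 0")
        case True
        then have e: "n ve = 2 * h" by (auto simp: h_def)
        have "[n vr * (n vx * n vx mod p) ^ h = n vr * n vx ^ n ve] (mod p)"
          unfolding e by (rule cong_mult[OF cong_refl sq])
        from cong_trans[OF this *(3)] show ?thesis
          using True *(1,2) r less ve dec by (simp add: h_def)
      next
        case False
        then have e: "n ve = Suc (2 * h)" unfolding h_def by presburger
        have "[(n vr * n vx mod p) * (n vx * n vx mod p) ^ h = n vr * n vx * n vx ^ (2 * h)] (mod p)"
          by (rule cong_mult[OF _ sq]) simp
        also have "n vr * n vx * n vx ^ (2 * h) = n vr * n vx ^ n ve"
          unfolding e by simp
        finally have "[(n vr * n vx mod p) * (n vx * n vx mod p) ^ h = c ^ (p - 2)] (mod p)"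
          using *(3) cong_trans by blast
        then show ?thesis
          using False *(1,2) r less ve dec by (simp add: h_def)
      qed
    qed
  qed (auto simp: regs_bounded_bit_length)
  have loop': "triple b ?I ?c (\<lambda>n s. agree {vr, vx, ve} n n0 \<and> s = s0 \<and> [n vr * n0 vc = 1] (mod p))"
  proof (rule triple_conseq[OF loop], assumption, goal_cases)
    case (1 n s)
    have "\<not> p dvd c" using n0 by (auto simp: c_def dest: dvd_imp_le)
    have "[n vr = c ^ (p - 2)] (mod p)" using 1 by auto
    then have "[n vr * c = c ^ (p - 2) * c] (mod p)"
      by (rule cong_mult) simp
    with fermat_inverse[OF p \<open>\<not> p dvd c\<close>] have "[n vr * c = 1] (mod p)"
      using cong_trans by blast
    with 1 show ?case by (auto simp: c_def)
  qed
  show ?thesis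
    unfolding set_inverse_def
  proof (rule triple_pre, (rule loop' triple_intros)+, goal_cases)
    case (1 n s)
    then have "p < 2 ^ b" using regs_boundedD[OF 1(1), of vp] n0 by auto
    then have "(1::nat) < 2 ^ b" "p - 2 < 2 ^ b" using p1 by auto
    then show ?case
      using 1 n0 regs_boundedD[OF 1(1), of vc] by (auto simp: c_def)
  qed
qed

section \<open>The algorithm\<close>

lemma triple_ex: "(\<And>x. triple b (P x) c Q) \<Longrightarrow> triple b (\<lambda>n s. \<exists>x. P x n s) c Q"
  unfolding triple_def hoare_def by blast

definition setup_prog :: prog where
  "setup_prog =
    (Pop vp 0 ;; Pop va 0 ;; Pop vb 0 ;; Pop vc 0 ;; Pop vd 0 ;; set_params ;; search ;; set_shift)"

definition input_regs :: "nat \<Rightarrow> nat \<Rightarrow> nat \<Rightarrow> nat \<Rightarrow> nat \<Rightarrow> (nat \<Rightarrow> nat) \<Rightarrow> bool" where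
  "input_regs p a b c d n \<longleftrightarrow> n vp = p \<and> n va = a \<and> n vb = b \<and> n vc = c \<and> n vd = d"

definition ready :: "nat \<Rightarrow> nat \<Rightarrow> (nat \<Rightarrow> nat) \<Rightarrow> bool" where
  "ready p k n \<longleftrightarrow> (\<exists>j T. power_ready p (base p) j T k n \<and> ((base p)\<^sup>2) ^ j \<le> p \<and> length T \<le> step_bound p)"

lemma power_ready_agree:
  assumes "agree X n n0" "X \<inter> {vp, val, vP, vg, vm, vcd, vrcd, vv} = {}"
  shows "power_ready p y j T b n \<longleftrightarrow> power_ready p y j T b n0"
proof -
  have "n vp = n0 vp" "n val = n0 val" "n vP = n0 vP" "n vg = n0 vg" "n vm = n0 vm" "n vcd = n0 vcd"
    "n vrcd = n0 vrcd" "n vv = n0 vv"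
    using assms by (auto simp: agree_def)
  then show ?thesis by (simp only: power_ready_def)
qed

lemma ready_agree:
  assumes "agree X n n0" "X \<inter> {vp, val, vP, vg, vm, vcd, vrcd, vv} = {}"
  shows "ready p b n \<longleftrightarrow> ready p b n0"
  unfolding ready_def power_ready_agree[OF assms] ..

lemma triple_setup_prog:
  assumes fits: "fits p k" and p: "prime p" and entries: "a < p" "b < p" "c < p" "d < p"
  shows "triple k (\<lambda>n s. s 0 = [p, a, b, c, d]) setup_prog
    (\<lambda>n s. input_regs p a b c d n \<and> ready p k n \<and> s 0 = [])"
proof -
  let ?y = "base p"
  have p0: "0 < p" using p by (rule prime_gt_0_nat)
  let ?In = "\<lambda>n s. input_regs p a b c d n \<and> s 0 = []"
  let ?Pa = "\<lambda>n. n vL = bit_length p \<and> n vy = ?y \<and> n val = ?y\<^sup>2 \<and> n vB = step_bound p"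
  have params: "triple k ?In set_params (\<lambda>n s. ?In n s \<and> ?Pa n)"
  proof (rule triple_ghost)
    fix n0 :: "nat \<Rightarrow> nat" and s0 :: "nat \<Rightarrow> nat list" assume *: "?In n0 s0"
    then have "n0 vp = p" by (simp add: input_regs_def)
    from triple_set_params[where ?n0.0 = n0 and ?s0.0 = s0, OF fits this]
    show "triple k (\<lambda>n s. n = n0 \<and> s = s0) set_params (\<lambda>n s. ?In n s \<and> ?Pa n)"
      by (rule triple_conseq) (use * in \<open>auto simp: agree_def input_regs_def\<close>)
  qed
  let ?good = "\<lambda>n. ?y\<^sup>2 \<le> p \<longrightarrow> (\<exists>T. good_word p ?y T n)"
  have search: "triple k (\<lambda>n s. ?In n s \<and> ?Pa n) search (\<lambda>n s. ?In n s \<and> ?Pa n \<and> ?good n)"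
  proof (rule triple_ghost)
    fix n0 :: "nat \<Rightarrow> nat" and s0 :: "nat \<Rightarrow> nat list" assume *: "?In n0 s0 \<and> ?Pa n0"
    have "triple k (\<lambda>n s. agree search_regs n n0 \<and> s 0 = s0 0) search
      (\<lambda>n s. agree search_regs n n0 \<and> s 0 = s0 0 \<and> ?good n)"
      using * by (intro triple_search fits p) (auto simp: input_regs_def)
    then show "triple k (\<lambda>n s. n = n0 \<and> s = s0) search (\<lambda>n s. ?In n s \<and> ?Pa n \<and> ?good n)"
      by (rule triple_conseq) (use * in \<open>auto simp: agree_def input_regs_def\<close>)
  qed
  have shift: "triple k (\<lambda>n s. ?In n s \<and> ?Pa n \<and> ?good n) set_shift (\<lambda>n s. input_regs p a b c d n \<and> ready p k n \<and> s 0 = [])"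
  proof (rule triple_ghost)
    fix n0 :: "nat \<Rightarrow> nat" and s0 :: "nat \<Rightarrow> nat list" assume *: "?In n0 s0 \<and> ?Pa n0 \<and> ?good n0"
    have y: "2 \<le> ?y" by (rule base_square_le[OF p0])
    have "triple k (\<lambda>n s. n = n0 \<and> s = s0) set_shift
      (\<lambda>n s. agree {vg, vP} n n0 \<and> s = s0 \<and>
      (\<exists>j. n vP = (?y\<^sup>2) ^ j \<and> (?y\<^sup>2) ^ j \<le> p \<and> p < (?y\<^sup>2) ^ Suc j \<and> n vg < p \<and>
        n vg = geom (?y\<^sup>2) (2 * ?y * n0 vv) j mod p))"
      using * p0 y by (intro triple_set_shift) (auto simp: input_regs_def)
    then show "triple k (\<lambda>n s. n = n0 \<and> s = s0) set_shift (\<lambda>n s. input_regs p a b c d n \<and> ready p k n \<and> s 0 = [])"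
    proof (rule triple_conseq)
      fix n s assume "agree {vg, vP} n n0 \<and> s = s0 \<and>
        (\<exists>j. n vP = (?y\<^sup>2) ^ j \<and> (?y\<^sup>2) ^ j \<le> p \<and> p < (?y\<^sup>2) ^ Suc j \<and> n vg < p \<and>
          n vg = geom (?y\<^sup>2) (2 * ?y * n0 vv) j mod p)"
      then obtain j where j: "agree {vg, vP} n n0" "s = s0" "n vP = (?y\<^sup>2) ^ j" "(?y\<^sup>2) ^ j \<le> p"
        "p < (?y\<^sup>2) ^ Suc j" "n vg < p" "n vg = geom (?y\<^sup>2) (2 * ?y * n0 vv) j mod p"
        by blast
      have r: "n vp = p" "n val = ?y\<^sup>2" "n vm = n0 vm" "n vcd = n0 vcd" "n vrcd = n0 vrcd" "n vv = n0 vv"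
        using j(1) * by (auto simp: agree_def input_regs_def)
      have "ready p k n"
      \<comment> \<open>j = 0 means p < \<alpha>, where the empty word will do. Otherwise \<alpha>
        <= p, and this is the case in which the search has delivered a word.\<close>
      proof (cases "j = 0")
        case True
        then have "power_ready p ?y j [] k n"
          using r j(3-7) p0 y fitsD(2)[OF fits] by (simp add: power_ready_def)
        then show ?thesis
          using j(4) unfolding ready_def by (metis list.size(3) zero_le)
      next
        case False
        have "(?y\<^sup>2) ^ 1 \<le> (?y\<^sup>2) ^ j"
          using False y by (intro power_increasing) (auto simp: power2_eq_square)
        with j(4) have "?y\<^sup>2 \<le> p" by simp
        with * obtain T where T: "good_word p ?y T n0" by blast
        have len: "length T \<le> step_bound p" "length T \<le> k"
          using T fitsD(3)[OF fits] by (auto simp: good_word_def)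
        have "[n vg = geom (?y\<^sup>2) (2 * ?y * n vv) j] (mod p)"
          using j(7) r(6) by (simp add: cong_def)
        then have "power_ready p ?y j T k n"
          using False r j(3-6) p0 y fitsD(2)[OF fits] len(2) T
          unfolding power_ready_def good_word_def r by blast
        then show ?thesis
          using j(4) len(1) unfolding ready_def by blast
      qed
      then show "input_regs p a b c d n \<and> ready p k n \<and> s 0 = []"
        using j(1,2) * by (auto simp: agree_def input_regs_def)
    qed
  qed
  note rest = triple_seq[OF triple_seq[OF shift search] params]
  show ?thesis
    unfolding setup_prog_def
  proof (rule triple_pre, (rule rest triple_intros)+, goal_cases)
    case (1 n s)
    have "p < 2 ^ k"
      by (rule less_power_fits[OF fits])
         (rule less_le_trans[OF less_power_bit_length], rule power_increasing, auto)
    then show ?case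
      using 1 entries by (auto simp: input_regs_def)
  qed
qed

text \<open>A matrix with \<open>c = 0\<close> is first multiplied by \<open>B\<^sup>-\<^sup>1\<close> from the left.\<close>

definition solver :: prog where
  "solver =
    (setup_prog ;;
     vfl <~ Const 0 ;;
     Ite (Reg vc) Skip
       (vc <~ Reg vp -. Reg va ;; vd <~ (Reg vd +. Reg vp -. Reg vb) mod. Reg vp ;; vfl <~ Const 1) ;;
     set_inverse ;;
     vt <~ ((Reg vd +. Const 1 +. Reg vp -. Reg vc) *. Reg vr) mod. Reg vp ;; write_power ;; Push 0 (Const 1) ;;
     vt <~ (Reg vc +. Reg vp -. Const 2) mod. Reg vp ;; write_power ;; Push 0 (Const 1) ;;
     vt <~ ((Reg va +. Const 1 +. Reg vp -. Reg vc) *. Reg vr) mod. Reg vp ;; write_power ;;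
     Ite (Reg vfl) (Push 0 (Const 1)) Skip)"

definition power_word :: "nat \<Rightarrow> nat \<Rightarrow> nat \<Rightarrow> nat list \<Rightarrow> bool" where
  "power_word p m t W \<longleftrightarrow>
     set W \<subseteq> {0, 1} \<and> mat_mod p (word_mat W) = mat_mod p (mat2 1 (int t) 0 1) \<and> length W \<le> m"

text \<open>Here the factor log log p cancels. From 2^(l-1) <= L < \<alpha> and \<alpha>^j <= p <
  2^L follows (l - 1) j < L, hence l j <= 2 L. The 2 j copies of T and rev(T), each of at most 2^18
  L l letters, thus have at most 2^20 L^2 letters together; the digit blocks add no more than 8
  L^2.\<close>

lemma ready_length:
  assumes p: "1 < p" and j: "((base p)\<^sup>2) ^ j \<le> p" and m: "m \<le> step_bound p"
  shows "2 * j * m + (j + 1) * (base p)\<^sup>2 \<le> 2 ^ 21 * (bit_length p)\<^sup>2"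
proof -
  define L where "L = bit_length p"
  define l where "l = bit_length L"
  have L: "2 \<le> L"
  proof (rule ccontr)
    assume "\<not> 2 \<le> L"
    then have "(2::nat) ^ L \<le> 2 ^ 1" by (intro power_increasing) auto
    with less_power_bit_length[of p] p show False by (simp add: L_def)
  qed
  have l: "2 \<le> l"
  proof (rule ccontr)
    assume "\<not> 2 \<le> l"
    then have "(2::nat) ^ l \<le> 2 ^ 1" by (intro power_increasing) auto
    with less_power_bit_length[of L] L show False by (simp add: l_def)
  qed
  have base: "L < (base p)\<^sup>2" "(base p)\<^sup>2 \<le> 4 * L"
    using base_greater[of p] base_square_le(2)[of p] p by (simp_all add: L_def)
  have "2 ^ (l - 1) \<le> L"
    using floorlog_bounds[of L 2] L by (simp add: l_def bit_length_def)
  then have "(2 ^ (l - 1)) ^ j \<le> ((base p)\<^sup>2) ^ j"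
    using base(1) by (intro power_mono) auto
  also have "\<dots> < 2 ^ L"
    using j less_power_bit_length[of p] by (simp add: L_def)
  finally have "(2::nat) ^ ((l - 1) * j) < 2 ^ L"
    by (simp only: power_mult)
  then have "(l - 1) * j < L"
    by (rule power_less_imp_less_exp[rotated]) simp
  moreover have "l * j \<le> (2 * (l - 1)) * j"
    using l by (intro mult_le_mono1) simp
  moreover have "(2 * (l - 1)) * j = 2 * ((l - 1) * j)"
    by simp
  ultimately have jl: "l * j \<le> 2 * L"
    by linarith
  have "2 * j \<le> l * j"
    using l by (rule mult_le_mono1)
  with jl have jL: "j \<le> L" by linarith
  have "2 * j * m \<le> 2 * j * (2 ^ 18 * L * l)"
    using m unfolding step_bound_def L_def l_def by (intro mult_le_mono2)
  also have "\<dots> = 2 ^ 19 * L * (l * j)"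
    by simp
  also have "\<dots> \<le> 2 ^ 19 * L * (2 * L)"
    using jl by (intro mult_le_mono2)
  also have "\<dots> = 2 ^ 20 * L\<^sup>2"
    by (simp add: power2_eq_square)
  finally have "2 * j * m \<le> 2 ^ 20 * L\<^sup>2" .
  moreover have "(j + 1) * (base p)\<^sup>2 \<le> (L + L) * (4 * L)"
    using jL L base(2) by (intro mult_le_mono) auto
  moreover have "(L + L) * (4 * L) = 8 * L\<^sup>2"
    by (simp add: power2_eq_square)
  ultimately have "2 * j * m + (j + 1) * (base p)\<^sup>2 \<le> 2 ^ 20 * L\<^sup>2 + 8 * L\<^sup>2"
    by linarith
  also have "\<dots> \<le> 2 ^ 21 * L\<^sup>2" by simp
  finally show ?thesis by (simp add: L_def)
qed

lemma triple_write_power_ready: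
  assumes ready: "ready p b n0" and t: "t < p" and p: "1 < p"
  shows "triple b (\<lambda>n s. agree scratch n n0 \<and> n vt = t \<and> s 0 = s0) write_power
    (\<lambda>n s. agree scratch n n0 \<and> (\<exists>W. s 0 = W @ s0 \<and> power_word p (2 ^ 21 * (bit_length p)\<^sup>2) t W))"
proof -
  obtain j T where *: "power_ready p (base p) j T b n0" "((base p)\<^sup>2) ^ j \<le> p" "length T \<le> step_bound p"
    using ready by (auto simp: ready_def)
  show ?thesis
  proof (rule triple_conseq[OF triple_write_power[OF *(1) t, of s0]], assumption, goal_cases)
    case (1 n s)
    then show ?case
      using ready_length[OF p *(2,3)] unfolding power_word_def by (meson order_trans)
  qed
qed

text \<open>The output stack grows at the front, so the factors of A^x B A^s B A^z are written from
  right to left. Adding p before each subtraction avoids truncation at 0.\<close>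

lemma triple_write_matrix:
  assumes ready: "ready p k n0" and p: "1 < p"
    and n0: "n0 vp = p" "n0 va = a" "n0 vc = c" "n0 vd = d" "n0 vr = r" "n0 vfl = fl"
  defines "P \<equiv> power_word p (2 ^ 21 * (bit_length p)\<^sup>2)"
  shows "triple k (\<lambda>n s. n = n0 \<and> s 0 = [])
    (vt <~ ((Reg vd +. Const 1 +. Reg vp -. Reg vc) *. Reg vr) mod. Reg vp ;; write_power ;; Push 0 (Const 1) ;;
     vt <~ (Reg vc +. Reg vp -. Const 2) mod. Reg vp ;; write_power ;; Push 0 (Const 1) ;;
     vt <~ ((Reg va +. Const 1 +. Reg vp -. Reg vc) *. Reg vr) mod. Reg vp ;; write_power ;;
     Ite (Reg vfl) (Push 0 (Const 1)) Skip)
    (\<lambda>n s. \<exists>X Y Z. s 0 = (if fl = 0 then [] else [1]) @ X @ 1 # Y @ 1 # Z \<and>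
      P (((a + 1 + p - c) * r) mod p) X \<and> P ((c + p - 2) mod p) Y \<and> P (((d + 1 + p - c) * r) mod p) Z)"
proof -
  define x where "x = ((a + 1 + p - c) * r) mod p"
  define y where "y = (c + p - 2) mod p"
  define z where "z = ((d + 1 + p - c) * r) mod p"
  have less: "x < p" "y < p" "z < p" using p by (simp_all add: x_def y_def z_def)
  have regs: "n vp = p" "n va = a" "n vc = c" "n vd = d" "n vr = r" "n vfl = fl" if "agree scratch n n0" for n
    using that n0 by (auto simp: agree_def)
  have pb: "u < 2 ^ k" if "regs_bounded k n" "agree scratch n n0" "u < p" for n u
    using that(3) regs_boundedD[OF that(1), of vp] regs(1)[OF that(2)] by simp
  let ?S = "\<lambda>n. agree scratch n n0"
  have w1: "triple k (\<lambda>n s. ?S n \<and> n vt = z \<and> s 0 = []) write_power (\<lambda>n s. \<exists>Z. ?S n \<and> P z Z \<and> s 0 = Z)"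
    by (rule triple_conseq[OF triple_write_power_ready[OF ready less(3) p, of "[]"]]) (auto simp: P_def)
  have w2: "triple k (\<lambda>n s. \<exists>Z. ?S n \<and> n vt = y \<and> P z Z \<and> s 0 = 1 # Z) write_power
    (\<lambda>n s. \<exists>Y Z. ?S n \<and> P y Y \<and> P z Z \<and> s 0 = Y @ 1 # Z)"
  proof (rule triple_ex)
    fix Z
    show "triple k (\<lambda>n s. ?S n \<and> n vt = y \<and> P z Z \<and> s 0 = 1 # Z) write_power
      (\<lambda>n s. \<exists>Y Z. ?S n \<and> P y Y \<and> P z Z \<and> s 0 = Y @ 1 # Z)"
    proof (cases "P z Z")
      case True
      then show ?thesis
        by (intro triple_conseq[OF triple_write_power_ready[OF ready less(2) p, of "1 # Z"]]) (auto simp: P_def)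
    next
      case False
      then show ?thesis by (auto simp: triple_def hoare_def)
    qed
  qed
  have w3: "triple k (\<lambda>n s. \<exists>Y Z. ?S n \<and> n vt = x \<and> P y Y \<and> P z Z \<and> s 0 = 1 # Y @ 1 # Z) write_power
    (\<lambda>n s. \<exists>X Y Z. ?S n \<and> P x X \<and> P y Y \<and> P z Z \<and> s 0 = X @ 1 # Y @ 1 # Z)"
  proof (intro triple_ex)
    fix Y Z
    show "triple k (\<lambda>n s. ?S n \<and> n vt = x \<and> P y Y \<and> P z Z \<and> s 0 = 1 # Y @ 1 # Z) write_power
      (\<lambda>n s. \<exists>X Y Z. ?S n \<and> P x X \<and> P y Y \<and> P z Z \<and> s 0 = X @ 1 # Y @ 1 # Z)"
    proof (cases "P y Y \<and> P z Z")
      case True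
      then show ?thesis
        by (intro triple_conseq[OF triple_write_power_ready[OF ready less(1) p, of "1 # Y @ 1 # Z"]]) (auto simp: P_def)
    next
      case False
      then show ?thesis by (auto simp: triple_def hoare_def)
    qed
  qed
  let ?Q = "\<lambda>n s. \<exists>X Y Z. s 0 = (if fl = 0 then [] else [1]) @ X @ 1 # Y @ 1 # Z \<and> P x X \<and> P y Y \<and> P z Z"
  have e3: "triple k (\<lambda>n s. \<exists>X Y Z. ?S n \<and> P x X \<and> P y Y \<and> P z Z \<and> s 0 = X @ 1 # Y @ 1 # Z)
    (Ite (Reg vfl) (Push 0 (Const 1)) Skip) ?Q"
  proof (rule triple_pre, (rule triple_intros)+, goal_cases)
    case (1 n s)
    then obtain X Y Z where *: "?S n" "P x X" "P y Y" "P z Z" "s 0 = X @ 1 # Y @ 1 # Z" by blast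
    then show ?case using regs(6)[OF *(1)] by auto
  qed
  let ?c3 = "vt <~ ((Reg va +. Const 1 +. Reg vp -. Reg vc) *. Reg vr) mod. Reg vp ;; write_power ;;
     Ite (Reg vfl) (Push 0 (Const 1)) Skip"
  have e2: "triple k (\<lambda>n s. \<exists>Y Z. ?S n \<and> P y Y \<and> P z Z \<and> s 0 = Y @ 1 # Z) (Push 0 (Const 1) ;; ?c3) ?Q"
  proof (rule triple_pre, (rule triple_seq[OF e3 w3] triple_intros)+, goal_cases)
    case (1 n s)
    then obtain Y Z where *: "?S n" "P y Y" "P z Z" "s 0 = Y @ 1 # Z" by blast
    then show ?case using regs[OF *(1)] pb[OF 1(1) *(1) less(1)] by (simp add: x_def) blast
  qed
  let ?c2 = "vt <~ (Reg vc +. Reg vp -. Const 2) mod. Reg vp ;; write_power ;; Push 0 (Const 1) ;; ?c3"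
  have e1: "triple k (\<lambda>n s. \<exists>Z. ?S n \<and> P z Z \<and> s 0 = Z) (Push 0 (Const 1) ;; ?c2) ?Q"
  proof (rule triple_pre, (rule triple_seq[OF e2 w2] triple_intros)+, goal_cases)
    case (1 n s)
    then obtain Z where *: "?S n" "P z Z" "s 0 = Z" by blast
    then show ?case using regs[OF *(1)] pb[OF 1(1) *(1) less(2)] by (auto simp: y_def)
  qed
  show ?thesis
    unfolding x_def[symmetric] y_def[symmetric] z_def[symmetric]
  proof (rule triple_pre, (rule triple_seq[OF e1 w1] triple_intros)+, goal_cases)
    case (1 n s)
    then have *: "?S n" "s 0 = []" by auto
    then show ?case using regs[OF *(1)] pb[OF 1(1) *(1) less(3)] by (auto simp: z_def)
  qed
qed

text \<open>For c = 0 the decomposition is applied to B^-1 M, whose lower row is (-a, d - b) modulo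
  p; the extra letter B in front restores M.\<close>

lemma word_mat_solution:
  assumes p: "prime p" and M: "M \<in> carrier (SL2 p)"
    and entries: "M $ 1 $ 1 = int a" "M $ 1 $ 2 = int b" "M $ 2 $ 1 = int c" "M $ 2 $ 2 = int d"
      "a < p" "b < p" "c < p" "d < p"
    and c': "c' = (if c = 0 then p - a else c)" "d' = (if c = 0 then (d + p - b) mod p else d)"
    and r: "[r * c' = 1] (mod p)"
    and X: "power_word p m (((a + 1 + p - c') * r) mod p) X" and Y: "power_word p m ((c' + p - 2) mod p) Y"
    and Z: "power_word p m (((d' + 1 + p - c') * r) mod p) Z"
  shows "mat_mod p (word_mat ((if c = 0 then [1] else []) @ X @ 1 # Y @ 1 # Z)) = M"
proof -
  have p1: "2 \<le> p" using p by (rule prime_ge_2_nat)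
  have M_eq: "M = mat2 (int a) (int b) (int c) (int d)"
    using entries by (intro mat2_eqI) simp_all
  have "[det M = 1] (mod int p)" using M by (simp add: SL2_def)
  then have det: "[int a * int d - int b * int c = 1] (mod int p)"
    by (simp add: M_eq det_2)
  have c'_le: "c' \<le> p" using entries c' by (auto split: if_splits)
  have mod_p: "[int (u mod p) = int u] (mod int p)" for u
    by (simp add: zmod_int)
  have det': "[int a * int d' - int b * int c' = 1] (mod int p)"
  proof (cases "c = 0")
    case True
    have "[int d' = int d + int p - int b] (mod int p)"
      using True c'(2) mod_p[of "d + p - b"] entries(6) by (simp add: of_nat_diff)
    then have "[int a * int d' - int b * int c' = int a * (int d + int p - int b) - int b * (int p - int a)] (mod int p)"
      using True c'(1) entries(5) by (intro cong_diff cong_mult) (auto simp: of_nat_diff)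
    also have "int a * (int d + int p - int b) - int b * (int p - int a) = int a * int d + int p * (int a - int b)"
      by (simp add: algebra_simps)
    also have "[\<dots> = int a * int d] (mod int p)"
      by (simp add: cong_def)
    also have "[int a * int d = 1] (mod int p)"
      using det True by simp
    finally show ?thesis .
  next
    case False
    then show ?thesis using det c' by simp
  qed
  have r': "[int r * int c' = 1] (mod int p)"
    using r by (metis cong_int_iff of_nat_1 of_nat_mult)
  have sub: "[int (((u + 1 + p - c') * r) mod p) = (int u + 1 - int c') * int r] (mod int p)" for u
  proof -
    have "[int (((u + 1 + p - c') * r) mod p) = int ((u + 1 + p - c') * r)] (mod int p)"
      by (rule mod_p)
    moreover have "int (u + 1 + p - c') = int u + 1 + int p - int c'"
      using c'_le by (simp add: of_nat_diff)
    then have "int ((u + 1 + p - c') * r) = (int u + 1 - int c') * int r + int p * int r"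
      by (simp only: of_nat_mult) (simp add: algebra_simps)
    then have "[int ((u + 1 + p - c') * r) = (int u + 1 - int c') * int r] (mod int p)"
      by (simp only: cong_def mod_mult_self2)
    ultimately show ?thesis
      using cong_trans by blast
  qed
  have "[int ((c' + p - 2) mod p) = int (c' + p - 2)] (mod int p)"
    by (rule mod_p)
  also have "int (c' + p - 2) = int c' - 2 + int p"
    using p1 by (simp add: of_nat_diff)
  also have "[\<dots> = int c' - 2] (mod int p)"
    by (simp add: cong_def)
  finally have s: "[int ((c' + p - 2) mod p) = int c' - 2] (mod int p)" .
  have "mat_mod p (word_mat (X @ 1 # Y @ 1 # Z)) =
      mat_mod p (word_mat X ** (B_mat ** (word_mat Y ** (B_mat ** word_mat Z))))"
    by (simp add: word_mat_append)
  also have "\<dots> = mat_mod p (mat2 1 (int (((a + 1 + p - c') * r) mod p)) 0 1 ** (B_mat **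
      (mat2 1 (int ((c' + p - 2) mod p)) 0 1 ** (B_mat ** mat2 1 (int (((d' + 1 + p - c') * r) mod p)) 0 1))))"
    using X Y Z unfolding power_word_def by (intro mat_mod_eq_mult refl) simp_all
  also have "\<dots> = mat_mod p (mat2 (int a) (int b) (int c') (int d'))"
    by (rule bruhat[OF det' r' sub s sub])
  finally have main: "mat_mod p (word_mat (X @ 1 # Y @ 1 # Z)) = mat_mod p (mat2 (int a) (int b) (int c') (int d'))" .
  show ?thesis
  proof (cases "c = 0")
    case True
    have "mat_mod p (word_mat ([1] @ X @ 1 # Y @ 1 # Z)) = mat_mod p (B_mat ** word_mat (X @ 1 # Y @ 1 # Z))"
      by simp
    also have "\<dots> = mat_mod p (B_mat ** mat2 (int a) (int b) (int c') (int d'))"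
      by (intro mat_mod_eq_mult refl main)
    also have "B_mat ** mat2 (int a) (int b) (int c') (int d') = mat2 (int a) (int b) (int a + int c') (int b + int d')"
      by (simp add: B_mat_mat2 mat2_mult)
    also have "mat_mod p \<dots> = mat_mod p M"
      unfolding M_eq
    proof (rule mat_mod_mat2_eqI)
      show "[int a + int c' = int c] (mod int p)"
        using True c'(1) entries(5) by (simp add: of_nat_diff cong_def)
      have "[int b + int d' = int b + int (d + p - b)] (mod int p)"
        using True c'(2) mod_p by (intro cong_add) auto
      also have "int b + int (d + p - b) = int d + int p"
        using entries(6) by (simp add: of_nat_diff)
      also have "[\<dots> = int d] (mod int p)" by (simp add: cong_def)
      finally show "[int b + int d' = int d] (mod int p)" .
    qed simp_all
    also have "mat_mod p M = M" using M by (rule mat_mod_id)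
    finally show ?thesis using True by simp
  next
    case False
    with main c' M_eq mat_mod_id[OF M] show ?thesis by simp
  qed
qed

lemma triple_solver:
  assumes fits: "fits p k" and p: "prime p" and M: "M \<in> carrier (SL2 p)"
  shows "triple k (\<lambda>n s. s 0 = enc_instance (p, M)) solver
    (\<lambda>n s. set (s 0) \<subseteq> {0, 1} \<and> mat_mod p (word_mat (s 0)) = M \<and> length (s 0) \<le> 2 ^ 23 * (bit_length p)\<^sup>2)"
proof -
  have p1: "1 < p" using p by (rule prime_gt_1_nat)
  define a b c d where "a = nat (M $ 1 $ 1)" "b = nat (M $ 1 $ 2)" "c = nat (M $ 2 $ 1)" "d = nat (M $ 2 $ 2)"
  have "\<forall>i j. 0 \<le> M $ i $ j \<and> M $ i $ j < int p"
    using M by (simp add: SL2_def)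
  then have entries: "M $ 1 $ 1 = int a" "M $ 1 $ 2 = int b" "M $ 2 $ 1 = int c" "M $ 2 $ 2 = int d"
      "a < p" "b < p" "c < p" "d < p"
    by (auto simp: a_b_c_d_def nat_less_iff)
  have enc: "enc_instance (p, M) = [p, a, b, c, d]"
    by (simp add: a_b_c_d_def)
  define c' where "c' = (if c = 0 then p - a else c)"
  define d' where "d' = (if c = 0 then (d + p - b) mod p else d)"
  define fl :: nat where "fl = (if c = 0 then 1 else 0)"
  have c'_bounds: "0 < c'" "c' < p"
  proof -
    have "[int a * int d - int b * int c = 1] (mod int p)"
      using M entries by (simp add: SL2_def det_2)
    \<comment> \<open>For c = 0 the determinant is a d modulo p, so a is nonzero and c' = p - a is
      invertible.\<close>
    then have "a \<noteq> 0" if "c = 0"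
      using p1 that by (intro notI) (simp add: cong_def)
    then show "0 < c'" "c' < p"
      using entries p1 by (auto simp: c'_def)
  qed
  let ?m = "2 ^ 21 * (bit_length p)\<^sup>2"
  let ?R = "\<lambda>n s. n vp = p \<and> n va = a \<and> n vc = c' \<and> n vd = d' \<and> n vfl = fl \<and> ready p k n \<and> s 0 = []"
  let ?S = "\<lambda>n s. ?R n s \<and> [n vr * c' = 1] (mod p)"
  let ?Q = "\<lambda>n s. set (s 0) \<subseteq> {0, 1} \<and> mat_mod p (word_mat (s 0)) = M \<and> length (s 0) \<le> 2 ^ 23 * (bit_length p)\<^sup>2"
  let ?out = "vt <~ ((Reg vd +. Const 1 +. Reg vp -. Reg vc) *. Reg vr) mod. Reg vp ;; write_power ;; Push 0 (Const 1) ;;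
     vt <~ (Reg vc +. Reg vp -. Const 2) mod. Reg vp ;; write_power ;; Push 0 (Const 1) ;;
     vt <~ ((Reg va +. Const 1 +. Reg vp -. Reg vc) *. Reg vr) mod. Reg vp ;; write_power ;;
     Ite (Reg vfl) (Push 0 (Const 1)) Skip"
  have emission: "triple k ?S ?out ?Q"
  proof (rule triple_ghost)
    fix n0 :: "nat \<Rightarrow> nat" and s0 :: "nat \<Rightarrow> nat list" assume S: "?S n0 s0"
    have "triple k (\<lambda>n s. n = n0 \<and> s 0 = []) ?out
      (\<lambda>n s. \<exists>X Y Z. s 0 = (if fl = 0 then [] else [1]) @ X @ 1 # Y @ 1 # Z \<and>
      power_word p ?m (((a + 1 + p - c') * n0 vr) mod p) X \<and> power_word p ?m ((c' + p - 2) mod p) Y \<and>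
      power_word p ?m (((d' + 1 + p - c') * n0 vr) mod p) Z)"
      using S p1 by (intro triple_write_matrix) auto
    then show "triple k (\<lambda>n s. n = n0 \<and> s = s0) ?out ?Q"
    proof (rule triple_conseq)
      fix n s assume "\<exists>X Y Z. s 0 = (if fl = 0 then [] else [1]) @ X @ 1 # Y @ 1 # Z \<and>
      power_word p ?m (((a + 1 + p - c') * n0 vr) mod p) X \<and> power_word p ?m ((c' + p - 2) mod p) Y \<and>
      power_word p ?m (((d' + 1 + p - c') * n0 vr) mod p) Z"
      then obtain X Y Z where *: "s 0 = (if fl = 0 then [] else [1]) @ X @ 1 # Y @ 1 # Z"
        "power_word p ?m (((a + 1 + p - c') * n0 vr) mod p) X" "power_word p ?m ((c' + p - 2) mod p) Y"
        "power_word p ?m (((d' + 1 + p - c') * n0 vr) mod p) Z" by blast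
      have s: "s 0 = (if c = 0 then [1] else []) @ X @ 1 # Y @ 1 # Z"
        using *(1) by (simp add: fl_def)
      have "mat_mod p (word_mat (s 0)) = M"
        unfolding s using S by (intro word_mat_solution[OF p M entries c'_def d'_def _ *(2-4)]) simp
      moreover have "set (s 0) \<subseteq> {0, 1}"
        using *(2-4) by (auto simp: s power_word_def)
      moreover have "length (s 0) \<le> 3 * ?m + 3"
        using *(2-4) by (auto simp: s power_word_def)
      moreover have "1 \<le> (bit_length p)\<^sup>2"
        using bit_length_pos[of p] p1 by simp
      \<comment> \<open>Three powers of A and at most three letters B: 3 m + 3 <= 4 m, and 4 * 2^21
        = 2^23.\<close>
      then have "3 \<le> ?m" by simp
      ultimately show "?Q n s" by auto
    qed (use S in auto)
  qed
  have inverse: "triple k ?R set_inverse ?S"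
  proof (rule triple_ghost)
    fix n0 :: "nat \<Rightarrow> nat" and s0 :: "nat \<Rightarrow> nat list" assume R: "?R n0 s0"
    have "triple k (\<lambda>n s. n = n0 \<and> s = s0) set_inverse
      (\<lambda>n s. agree {vr, vx, ve} n n0 \<and> s = s0 \<and> [n vr * n0 vc = 1] (mod p))"
      using R c'_bounds by (intro triple_set_inverse p) auto
    then show "triple k (\<lambda>n s. n = n0 \<and> s = s0) set_inverse ?S"
    proof (rule triple_conseq)
      fix n s assume *: "agree {vr, vx, ve} n n0 \<and> s = s0 \<and> [n vr * n0 vc = 1] (mod p)"
      then have "ready p k n \<longleftrightarrow> ready p k n0"
        by (intro ready_agree[of "{vr, vx, ve}"]) auto
      with * R show "?S n s" by (auto simp: agree_def)
    qed auto
  qed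
  show ?thesis
    unfolding solver_def enc
  proof (rule triple_pre, (rule triple_seq[OF emission inverse] triple_intros)+, rule triple_conseq[OF triple_setup_prog[OF fits p entries(5-8)]],
      assumption, goal_cases)
    case (1 n s)
    then have n: "n vp = p" "n va = a" "n vb = b" "n vc = c" "n vd = d" "ready p k n" "s 0 = []"
      by (auto simp: input_regs_def)
    have upd: "ready p k (n(vfl := u))" "ready p k (n(vfl := u, vc := v, vd := w, vfl := x))" for u v w x
    proof -
      have "ready p k n'" if "agree {vfl, vc, vd} n' n" for n'
        using ready_agree[OF that] n(6) by simp
      then show "ready p k (n(vfl := u))" "ready p k (n(vfl := u, vc := v, vd := w, vfl := x))"
        by simp_all
    qed
    have "p < 2 ^ k" using regs_boundedD[OF 1(1), of vp] n by simp
    then have "p - a < 2 ^ k" "(d + p - b) mod p < 2 ^ k" "(1::nat) < 2 ^ k"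
      using p1 by (auto intro: less_trans[OF mod_less_divisor])
    then show ?case
      using n upd by (auto simp: c'_def d'_def fl_def)
  qed auto
qed

section \<open>From triples to efficient solvability\<close>

lemma word_problem_efficient_quadratic:
  "word_problem_efficient (\<lambda>p. 2 ^ 23 * (real (bit_length p))\<^sup>2)"
proof -
  obtain q :: "nat poly" where q: "\<And>b. prog_cost b solver = poly q b"
    using prog_cost_poly by blast
  \<comment> \<open>For an instance of size S all registers get 2^20 S^2 bits. The composition
    evaluates the program cost at this value, and the second factor is the price b + 1 of one
    unit.\<close>
  let ?Q = "pcompose q [:0, 0, 2 ^ 20:] * [:1, 0, 2 ^ 20:]"
  have "lossless_spmf (run solver (enc_instance i)) \<and>
      (\<forall>\<sigma>\<in>set_spmf (run solver (enc_instance i)). \<exists>w. result \<sigma> = map enc_letter w \<and>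
        (case i of (p, M) \<Rightarrow> \<lambda>w. zemor_hash p w = M \<and> real (length w) \<le> 2 ^ 23 * (real (bit_length p))\<^sup>2) w) \<and>
      expected_time solver (enc_instance i) \<le> of_nat (poly ?Q (list_size (enc_instance i)))"
    if "i \<in> hash_instances" for i
  proof -
    obtain p M where i: "i = (p, M)" by (cases i)
    with that have p: "prime p" and M: "M \<in> carrier (SL2 p)"
      by (auto simp: hash_instances_def)
    define S where "S = list_size (enc_instance i)"
    define k where "k = 2 ^ 20 * S\<^sup>2"
    have "bit_length p \<le> S"
      by (simp add: S_def i list_size_def)
    then have fits: "fits p k"
      using prime_gt_1_nat[OF p] by (simp add: fits_def k_def power_mono)
    let ?P = "\<lambda>n s. set (s 0) \<subseteq> {0, 1} \<and> mat_mod p (word_mat (s 0)) = M \<and> length (s 0) \<le> 2 ^ 23 * (bit_length p)\<^sup>2"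
    have spec: "spec k (run solver (enc_instance i)) ?P (0 + prog_cost k solver * (k + 1))"
      using hoareD[OF triple_solver[OF fits p M, unfolded triple_def], of "init_config (enc_instance i)"]
      by (simp add: run_def init_config_def i regs_bounded_def)
    have "\<exists>w. result \<sigma> = map enc_letter w \<and> zemor_hash p w = M \<and> real (length w) \<le> 2 ^ 23 * (real (bit_length p))\<^sup>2"
      if "\<sigma> \<in> set_spmf (run solver (enc_instance i))" for \<sigma>
    proof -
      define w where "w = map (\<lambda>x. if x = 0 then LA else LB) (result \<sigma>)"
      have \<sigma>: "?P (num \<sigma>) (stk \<sigma>)"
        using spec that by (auto simp: spec_def)
      then have w: "map enc_letter w = result \<sigma>"
        by (auto simp: w_def result_def o_def intro!: map_idI)
      have "real (length w) \<le> real (2 ^ 23 * (bit_length p)\<^sup>2)"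
        unfolding of_nat_le_iff using \<sigma> by (simp add: w_def result_def)
      then show ?thesis
        using \<sigma> w by (intro exI[of _ w]) (simp add: zemor_hash_word_mat result_def)
    qed
    moreover have "poly ?Q S = prog_cost k solver * (k + 1)"
      by (simp add: q poly_pcompose k_def power2_eq_square ac_simps)
    then have "expected_time solver (enc_instance i) \<le> of_nat (poly ?Q S)"
      using spec by (simp add: spec_def expected_time_def)
    ultimately show ?thesis
      using spec by (simp add: spec_def i S_def)
  qed
  then show ?thesis
    unfolding word_problem_efficient_def efficiently_solvable_def by (intro exI[of _ solver] exI[of _ ?Q] ballI) blast
qed

lemma word_problem_efficient_mono:
  assumes "word_problem_efficient L" "\<And>p. prime p \<Longrightarrow> L p \<le> L' p"
  shows "word_problem_efficient L'"
proof -
  obtain c q where *: "\<forall>i\<in>hash_instances. lossless_spmf (run c (enc_instance i)) \<and>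
      (\<forall>\<sigma>\<in>set_spmf (run c (enc_instance i)). \<exists>w. result \<sigma> = map enc_letter w \<and>
        (case i of (p, M) \<Rightarrow> \<lambda>w. zemor_hash p w = M \<and> real (length w) \<le> L p) w) \<and>
      expected_time c (enc_instance i) \<le> of_nat (poly q (list_size (enc_instance i)))"
    using assms(1) unfolding word_problem_efficient_def efficiently_solvable_def by blast
  show ?thesis
    unfolding word_problem_efficient_def efficiently_solvable_def
  proof (intro exI[of _ c] exI[of _ q] ballI conjI)
    fix i \<sigma> assume i: "i \<in> hash_instances" and \<sigma>: "\<sigma> \<in> set_spmf (run c (enc_instance i))"
    obtain p M where pM: "i = (p, M)" "prime p"
      using i by (auto simp: hash_instances_def)
    obtain w where "result \<sigma> = map enc_letter w" "zemor_hash p w = M" "real (length w) \<le> L p"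
      using * i \<sigma> pM by fastforce
    then show "\<exists>w. result \<sigma> = map enc_letter w \<and>
        (case i of (p, M) \<Rightarrow> \<lambda>w. zemor_hash p w = M \<and> real (length w) \<le> L' p) w"
      using assms(2)[OF pM(2)] pM by (intro exI[of _ w]) auto
  qed (use * in auto)
qed

text \<open>With ln 2 >= 2/3, both L - 1 and 1 are at most (3/2) ln p.\<close>

lemma bit_length_le_ln:
  assumes "2 \<le> p"
  shows "real (bit_length p) \<le> 3 * ln (real p)"
proof -
  have ln2: "2 / 3 \<le> ln (2 :: real)"
    by (rule ln2_ge_two_thirds)
  have ln_p: "ln 2 \<le> ln (real p)" using assms by simp
  have "2 ^ (bit_length p - 1) \<le> p"
    using floorlog_bounds[of p 2] assms by (simp add: bit_length_def)
  then have "real (2 ^ (bit_length p - 1)) \<le> real p"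
    by (simp only: of_nat_le_iff)
  then have "ln (2 ^ (bit_length p - 1)) \<le> ln (real p)"
    using assms by (subst ln_le_cancel_iff) auto
  then have "real (bit_length p - 1) * ln 2 \<le> ln (real p)"
    by (simp add: ln_realpow)
  moreover have "real (bit_length p - 1) * (2 / 3) \<le> real (bit_length p - 1) * ln 2"
    using ln2 by (intro mult_left_mono) auto
  moreover have "real (bit_length p) \<le> real (bit_length p - 1) + 1" by simp
  ultimately show ?thesis
    using ln2 ln_p by linarith
qed

theorem mainTheorem1:
  assumes "factoring_efficient"
  shows "(\<exists>C :: real. word_problem_efficient (\<lambda>p. C * (ln (real p))\<^sup>2)) \<and>
         \<not> zemor_preimage_resistant"
proof
  have "word_problem_efficient (\<lambda>p. (2 ^ 23 * 9) * (ln (real p))\<^sup>2)"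
  proof (rule word_problem_efficient_mono[OF word_problem_efficient_quadratic])
    fix p :: nat assume "prime p"
    then have "(real (bit_length p))\<^sup>2 \<le> (3 * ln (real p))\<^sup>2"
      using bit_length_le_ln[of p] prime_ge_2_nat[of p] by (intro power_mono) auto
    then show "2 ^ 23 * (real (bit_length p))\<^sup>2 \<le> (2 ^ 23 * 9) * (ln (real p))\<^sup>2"
      by (simp add: power_mult_distrib)
  qed
  then show "\<exists>C :: real. word_problem_efficient (\<lambda>p. C * (ln (real p))\<^sup>2)" by blast
  have "word_problem_efficient (\<lambda>p. real (poly [:0, 0, 2 ^ 23:] (bit_length p)))"
    by (rule word_problem_efficient_mono[OF word_problem_efficient_quadratic]) (simp add: power2_eq_square)
  then show "\<not> zemor_preimage_resistant"
    unfolding zemor_preimage_resistant_def by blast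
qed

end
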